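(* There is a constant $C>0$ such that for any sequence of integers $(t_n)_{n \ge 1}$ with $t_n \to \infty$ and $t_n = o(n)$, the total variation distance between the laws of \[ \left(F_0(\mathsf{T}_n^\Omega),\ (F_i(\mathsf{T}_n^\Omega))_{1 \le i \le \Delta(\mathsf{T}_n^\Omega) - t_n},\ \mathbf{1}\Big\{\textstyle\sum_{i = \Delta(\mathsf{T}_n^\Omega) - t_n }^{\Delta(\mathsf{T}_n^\Omega)} |F_i(\mathsf{T}_n^\Omega)| \ge C t_n \Big\} \right) \quad\text{and}\quad \left(\mathsf{T}^\bullet,\ (\mathsf{T}^i)_{1 \le i \le \Delta_{\langle n \rangle} - t_n},\ 0\right) \] tends to zero as $n\to\infty$, where \[ \Delta_{\langle n \rangle} := \sup \left\{ d \ge 1 \ :\ L_\Omega(\mathsf{T}^\bullet) + \sum_{i=1}^d L_\Omega(\mathsf{T}^i) \le n \right\}. \]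
   Context: Setting. $\xi$ is a random variable with values in $\mathbb{N}_0=\{0,1,2,\dots\}$ such that $\mathbb{P}(\xi=0)>0$, $\mathbb{P}(\xi\le 1)<1$, $\mathbb{E}[\xi]<1$, and there are a slowly varying function $f$ and a constant $\alpha>1$ with $\mathbb{P}(\xi=n)=f(n)n^{-1-\alpha}$ for all large enough integers $n$. $\Omega\subset\mathbb{N}_0$ is a fixed non-empty set with $\mathbb{P}(\xi\in\Omega)>0$ such that $\Omega$ or its complement $\mathbb{N}_0\setminus\Omega$ is finite. $\mathsf{T}$ is a Galton--Watson tree with offspring distribution $\xi$, regarded as a plane tree (rooted tree in which the offspring of each vertex is linearly ordered). The outdegree of a vertex is its number of children. For a finite plane tree $T$, $|T|$ is the number of vertices, $L_\Omega(T)$ the number of vertices with outdegree in $\Omega$, and $\Delta(T)$ the maximal outdegree. For $n$ large enough, $\mathsf{T}_n^\Omega$ denotes $\mathsf{T}$ conditioned on $L_\Omega(\mathsf{T})=n$. Decomposition. The fringe subtree of a plane tree at a vertex is the subtree consisting of the vertex and all its descendants. For a finite plane tree $T$, let $v$ be the lexicographically first (i.e. first in depth-first-search order) vertex of maximal outdegree. $(F_i(T))_{1\le i\le\Delta(T)}$ is the ordered list of the fringe subtrees at the children of $v$, and $F_0(T)$ is the marked plane tree obtained from $T$ by marking $v$ and cutting away all descendants of $v$. The tree $\mathsf{T}^\bullet$. Let $\hat\xi$ have values in $\mathbb{N}\cup\{\infty\}$ with $\mathbb{P}(\hat\xi=k)=k\,\mathbb{P}(\xi=k)$ for $k<\infty$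 and $\mathbb{P}(\hat\xi=\infty)=1-\mathbb{E}[\xi]$. $\mathsf{T}^\bullet$ is the random plane tree with a marked leaf constructed as follows: start with a root vertex and sample an independent copy of $\hat\xi$. If it equals infinity, mark the root and stop. Otherwise give the root that many offspring, choose one of them uniformly at random and declare it special, identify each non-special offspring with the root of an independent copy of $\mathsf{T}$, and iterate the construction at the special offspring vertex (with fresh independent copies). $(\mathsf{T}^i)_{i\ge1}$ are independent copies of $\mathsf{T}$, independent of $\mathsf{T}^\bullet$. *)

theory Defs
  imports "HOL-Probability.Probability" "HOL-Library.List_Lexorder"
    "HOL-Library.Landau_Symbols" "HOL-Library.Extended_Nat" "HOL-Library.Countable"
begin

section \<open>Finite plane trees\<close>

datatype ptree = Node (children: "ptree list")

instance ptree :: countable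
  by countable_datatype

text \<open>A vertex is addressed by the list of (0-based) child positions on the path leading to it
  from the root (Ulam--Harris notation). \<^term>\<open>fringe\<close> is meaningful for addresses of
  vertices only.\<close>

primrec is_vertex :: "nat list \<Rightarrow> ptree \<Rightarrow> bool" where
  "is_vertex [] T \<longleftrightarrow> True"
| "is_vertex (i # u) T \<longleftrightarrow> i < length (children T) \<and> is_vertex u (children T ! i)"

definition vertices :: "ptree \<Rightarrow> nat list set" where
  "vertices T = {u. is_vertex u T}"

primrec fringe :: "nat list \<Rightarrow> ptree \<Rightarrow> ptree" where
  "fringe [] T = T"
| "fringe (i # u) T = fringe u (children T ! i)"

definition outdeg :: "ptree \<Rightarrow> nat list \<Rightarrow> nat" where
  "outdeg T u = length (children (fringe u T))"

definition num_vertices :: "ptree \<Rightarrow> nat" where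
  "num_vertices T = card (vertices T)"

definition L :: "nat set \<Rightarrow> ptree \<Rightarrow> nat" where
  "L \<Omega> T = card {u \<in> vertices T. outdeg T u \<in> \<Omega>}"

definition max_outdeg :: "ptree \<Rightarrow> nat" where
  "max_outdeg T = Max (outdeg T ` vertices T)"

text \<open>The order on addresses is the one of \<^theory>\<open>HOL-Library.List_Lexorder\<close>, in which a proper
  prefix precedes its extensions; on the vertices of a tree this is the depth-first-search order.\<close>

definition first_max :: "ptree \<Rightarrow> nat list" where
  "first_max T = Min {u \<in> vertices T. outdeg T u = max_outdeg T}"

primrec cut :: "nat list \<Rightarrow> ptree \<Rightarrow> ptree" where
  "cut [] T = Node []"
| "cut (i # u) T = Node ((children T)[i := cut u (children T ! i)])"

text \<open>A marked plane tree is a plane tree together with the address of its marked vertex.\<close>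

type_synonym mtree = "ptree \<times> nat list"

definition F0 :: "ptree \<Rightarrow> mtree" where
  "F0 T = (cut (first_max T) T, first_max T)"

text \<open>\<open>Fs T\<close> is the list \<open>(F\<^sub>1(T), \<dots>, F\<^sub>\<Delta>(T))\<close>.\<close>

definition Fs :: "ptree \<Rightarrow> ptree list" where
  "Fs T = children (fringe (first_max T) T)"

definition F_size :: "nat \<Rightarrow> ptree \<Rightarrow> nat" where
  "F_size i T = (if i = 0 then num_vertices (fst (F0 T)) else num_vertices (Fs T ! (i - 1)))"


section \<open>The random trees\<close>

primrec iid_spmf :: "nat \<Rightarrow> 'a spmf \<Rightarrow> 'a list spmf" where
  "iid_spmf 0 p = return_spmf []"
| "iid_spmf (Suc k) p = bind_spmf p (\<lambda>x. map_spmf (\<lambda>xs. x # xs) (iid_spmf k p))"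

lemma iid_spmf_mono [partial_function_mono]:
  assumes "mono_spmf B"
  shows "mono_spmf (\<lambda>f. iid_spmf k (B f))"
proof (induction k)
  case 0
  show ?case by (simp add: monotone_def)
next
  case (Suc k)
  show ?case
    unfolding iid_spmf.simps by (intro partial_function_mono assms Suc.IH)
qed

text \<open>The Galton--Watson tree. The least fixed point in \<open>spmf\<close> drops exactly the infinite
  realisations: \<open>spmf (GW \<xi>) T\<close> is the probability of the finite tree \<open>T\<close>, and the missing mass is
  the probability of non-extinction, which vanishes in the subcritical case
  (\<open>lossless_GW\<close> below).\<close>

partial_function (spmf) GW :: "nat pmf \<Rightarrow> ptree spmf" where
  "GW \<xi> = bind_pmf \<xi> (\<lambda>k. map_spmf Node (iid_spmf k (GW \<xi>)))"

definition GW_cond :: "nat pmf \<Rightarrow> nat set \<Rightarrow> nat \<Rightarrow> ptree spmf" where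
  "GW_cond \<xi> \<Omega> n = cond_spmf (GW \<xi>) {T. L \<Omega> T = n}"

abbreviation mean :: "nat pmf \<Rightarrow> real" where
  "mean \<xi> \<equiv> measure_pmf.expectation \<xi> real"

definition xi_hat :: "nat pmf \<Rightarrow> enat pmf" where
  "xi_hat \<xi> = embed_pmf (\<lambda>x. case x of enat k \<Rightarrow> real k * pmf \<xi> k | \<infinity> \<Rightarrow> 1 - mean \<xi>)"

text \<open>\<open>j\<close> is the 0-based position of the special offspring; the list \<open>ts\<close> consists of the trees at
  the \<open>k - 1\<close> non-special offspring. The value \<open>k = 0\<close> has probability zero.\<close>

partial_function (spmf) GW_bullet :: "nat pmf \<Rightarrow> mtree spmf" where
  "GW_bullet \<xi> = bind_pmf (xi_hat \<xi>) (\<lambda>x.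
     if x = \<infinity> then return_spmf (Node [], [])
     else bind_spmf (spmf_of_set {..<the_enat x}) (\<lambda>j.
       bind_spmf (iid_spmf (the_enat x - 1) (GW \<xi>)) (\<lambda>ts.
         map_spmf (\<lambda>(s, v). (Node (take j ts @ s # drop j ts), j # v)) (GW_bullet \<xi>))))"

lemma pmf_xi_hat:
  assumes "integrable (measure_pmf \<xi>) real" "mean \<xi> \<le> 1"
  shows "pmf (xi_hat \<xi>) (enat k) = real k * pmf \<xi> k" "pmf (xi_hat \<xi>) \<infinity> = 1 - mean \<xi>"
proof -
  let ?f = "\<lambda>x. case x of enat k \<Rightarrow> real k * pmf \<xi> k | \<infinity> \<Rightarrow> 1 - mean \<xi>"
  have split: "ennreal (?f x) = ennreal (?f x) * indicator (range enat) x + ennreal (?f x) * indicator {\<infinity>} x" for x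
    by (cases x) (auto simp: indicator_def)
  have "(\<integral>\<^sup>+x. ennreal (?f x) \<partial>count_space UNIV) =
      (\<integral>\<^sup>+x. ennreal (?f x) * indicator (range enat) x + ennreal (?f x) * indicator {\<infinity>} x \<partial>count_space UNIV)"
    by (rule nn_integral_cong) (rule split)
  also have "\<dots> = (\<integral>\<^sup>+x. ennreal (?f x) * indicator (range enat) x \<partial>count_space UNIV) +
      (\<integral>\<^sup>+x. ennreal (?f x) * indicator {\<infinity>} x \<partial>count_space UNIV)"
    by (rule nn_integral_add) auto
  also have "\<dots> = (\<integral>\<^sup>+x. ennreal (?f x) \<partial>count_space (range enat)) + (\<integral>\<^sup>+x. ennreal (?f x) \<partial>count_space {\<infinity>})"
    by (intro arg_cong2[of _ _ _ _ "(+)"] nn_integral_count_space_indicator[symmetric])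
       (simp_all add: NO_MATCH_def)
  also have "(\<integral>\<^sup>+x. ennreal (?f x) \<partial>count_space (range enat)) =
      (\<integral>\<^sup>+k. ennreal (real k * pmf \<xi> k) \<partial>count_space UNIV)"
    by (subst nn_integral_bij_count_space[of enat UNIV, symmetric])
       (auto simp: bij_betw_def inj_on_def)
  also have "\<dots> = (\<integral>\<^sup>+k. ennreal (real k) \<partial>measure_pmf \<xi>)"
    by (subst nn_integral_measure_pmf) (simp add: ennreal_mult' mult.commute)
  also have "\<dots> = ennreal (mean \<xi>)"
    using assms(1) by (intro nn_integral_eq_integral) auto
  also have "(\<integral>\<^sup>+x. ennreal (?f x) \<partial>count_space {\<infinity>}) = ennreal (1 - mean \<xi>)"
    by (subst nn_integral_count_space_finite) auto
  also have "ennreal (mean \<xi>) + ennreal (1 - mean \<xi>) = 1"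
    using assms(2) by (subst ennreal_plus[symmetric]) (auto intro: Bochner_Integration.integral_nonneg)
  finally have 1: "(\<integral>\<^sup>+x. ennreal (?f x) \<partial>count_space UNIV) = 1" .
  have "pmf (xi_hat \<xi>) x = ?f x" for x
    unfolding xi_hat_def using assms(2)
    by (intro pmf_embed_pmf 1) (auto split: enat.split)
  from this[of "enat k"] this[of \<infinity>]
  show "pmf (xi_hat \<xi>) (enat k) = real k * pmf \<xi> k" "pmf (xi_hat \<xi>) \<infinity> = 1 - mean \<xi>"
    by simp_all
qed

lemma weight_iid_spmf: "weight_spmf (iid_spmf k p) = weight_spmf p ^ k"
  by (induction k) (simp_all add: weight_bind_spmf o_def)

lemma lossless_GW:
  assumes int: "integrable (measure_pmf \<xi>) real" and m: "mean \<xi> < 1"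
  shows "lossless_spmf (GW \<xi>)"
proof -
  let ?q = "weight_spmf (GW \<xi>)"
  have q01: "0 \<le> ?q" "?q \<le> 1"
    by (auto simp: weight_spmf_nonneg weight_spmf_le_1)
  have "GW \<xi> = bind_spmf (spmf_of_pmf \<xi>) (\<lambda>k. map_spmf Node (iid_spmf k (GW \<xi>)))"
    by (subst GW.simps) simp
  then have "?q = weight_spmf (bind_spmf (spmf_of_pmf \<xi>) (\<lambda>k. map_spmf Node (iid_spmf k (GW \<xi>))))"
    by (rule arg_cong)
  also have "\<dots> = measure_pmf.expectation \<xi> (\<lambda>k. ?q ^ k)"
    by (simp add: weight_bind_spmf o_def weight_iid_spmf del: bind_spmf_of_pmf)
  finally have q: "?q = measure_pmf.expectation \<xi> (\<lambda>k. ?q ^ k)" .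
  have bern: "1 - ?q ^ k \<le> real k * (1 - ?q)" for k
    using Bernoulli_inequality[of "?q - 1" k] q01 by (simp add: algebra_simps)
  have intq: "integrable (measure_pmf \<xi>) (\<lambda>k. ?q ^ k)"
    by (rule measure_pmf.integrable_const_bound[where B = 1])
       (auto simp: q01 power_le_one)
  have "1 - ?q = measure_pmf.expectation \<xi> (\<lambda>k. 1 - ?q ^ k)"
    using intq q by simp
  also have "\<dots> \<le> measure_pmf.expectation \<xi> (\<lambda>k. real k * (1 - ?q))"
    using intq int by (intro integral_mono bern) auto
  also have "\<dots> = mean \<xi> * (1 - ?q)"
    by simp
  finally have "(1 - mean \<xi>) * (1 - ?q) \<le> 0"
    by (simp add: algebra_simps)
  with m q01 have "?q = 1"
    by (simp add: mult_le_0_iff)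
  then show ?thesis
    by (simp add: lossless_spmf_def)
qed

lemma lossless_GW_bullet:
  assumes int: "integrable (measure_pmf \<xi>) real" and m: "mean \<xi> < 1"
  shows "lossless_spmf (GW_bullet \<xi>)"
proof -
  let ?q = "weight_spmf (GW_bullet \<xi>)"
  let ?B = "\<lambda>x. if x = \<infinity> then return_spmf (Node [], [])
     else bind_spmf (spmf_of_set {..<the_enat x}) (\<lambda>j.
       bind_spmf (iid_spmf (the_enat x - 1) (GW \<xi>)) (\<lambda>ts.
         map_spmf (\<lambda>(s, v). (Node (take j ts @ s # drop j ts), j # v)) (GW_bullet \<xi>)))"
  have w1: "weight_spmf (GW \<xi>) = 1"
    using lossless_GW[OF assms] by (simp add: lossless_spmf_def)
  have pos: "the_enat x > 0" if "x \<in> set_pmf (xi_hat \<xi>)" "x \<noteq> \<infinity>" for x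
    using that pmf_xi_hat(1)[of \<xi> 0] assms
    by (cases x) (auto simp: set_pmf_iff intro!: Nat.gr0I)
  have "GW_bullet \<xi> = bind_spmf (spmf_of_pmf (xi_hat \<xi>)) ?B"
    by (subst GW_bullet.simps) simp
  then have "?q = weight_spmf (bind_spmf (spmf_of_pmf (xi_hat \<xi>)) ?B)"
    by (rule arg_cong)
  also have "\<dots> = measure_pmf.expectation (xi_hat \<xi>) (\<lambda>x. weight_spmf (?B x))"
    by (simp add: weight_bind_spmf o_def del: bind_spmf_of_pmf)
  also have "\<dots> = measure_pmf.expectation (xi_hat \<xi>) (\<lambda>x. ?q + indicator {\<infinity>} x * (1 - ?q))"
    using pos
    by (intro integral_cong_AE)
       (auto simp: AE_measure_pmf_iff weight_bind_spmf o_def weight_iid_spmf w1 weight_spmf_of_set)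
  also have "\<dots> = ?q + (1 - mean \<xi>) * (1 - ?q)"
    using pmf_xi_hat(2)[of \<xi>] assms
    by (subst Bochner_Integration.integral_add)
       (auto simp: measure_pmf_single measure_pmf.emeasure_eq_measure)
  finally have "?q = 1"
    using m by simp
  then show ?thesis
    by (simp add: lossless_spmf_def)
qed

text \<open>The joint law of the marked tree and of the independent sequence \<open>(T\<^sup>i)\<^sub>i\<^sub>\<ge>\<^sub>1\<close>.\<close>

definition limit_space :: "nat pmf \<Rightarrow> (mtree \<times> (nat \<Rightarrow> ptree)) measure" where
  "limit_space \<xi> = measure_spmf (GW_bullet \<xi>) \<Otimes>\<^sub>M (\<Pi>\<^sub>M i\<in>{1..}. measure_spmf (GW \<xi>))"

text \<open>The supremum is 0 if the set is empty; the set is almost surely bounded whenever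
  \<open>\<xi>\<close> charges \<open>\<Omega>\<close>.\<close>

definition Delta_n :: "nat set \<Rightarrow> nat \<Rightarrow> mtree \<Rightarrow> (nat \<Rightarrow> ptree) \<Rightarrow> nat" where
  "Delta_n \<Omega> n T T' = Sup {d. d \<ge> 1 \<and> L \<Omega> (fst T) + (\<Sum>i=1..d. L \<Omega> (T' i)) \<le> n}"


section \<open>The two laws being compared\<close>

text \<open>Both laws take into account arbitrary integers \<open>t\<close>: a list with upper index bound
  \<open>\<Delta> - t \<le> 0\<close> is empty, and in the sum only the indices \<open>i \<ge> 0\<close>, for which \<open>F\<^sub>i\<close> is defined, occur.\<close>

definition law_cond ::
    "nat pmf \<Rightarrow> nat set \<Rightarrow> real \<Rightarrow> nat \<Rightarrow> int \<Rightarrow> (mtree \<times> ptree list \<times> nat) measure" where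
  "law_cond \<xi> \<Omega> C n t = measure_spmf (map_spmf
     (\<lambda>T. let m = nat (int (max_outdeg T) - t) in
        (F0 T, take m (Fs T),
         of_bool (real (\<Sum>i=m..max_outdeg T. F_size i T) \<ge> C * of_int t)))
     (GW_cond \<xi> \<Omega> n))"

definition law_limit ::
    "nat pmf \<Rightarrow> nat set \<Rightarrow> nat \<Rightarrow> int \<Rightarrow> (mtree \<times> ptree list \<times> nat) measure" where
  "law_limit \<xi> \<Omega> n t = distr (limit_space \<xi>) (count_space UNIV)
     (\<lambda>(T, T'). let m = nat (int (Delta_n \<Omega> n T T') - t) in
        (T, map T' [1..<Suc m], 0))"

definition tv_dist :: "'a measure \<Rightarrow> 'a measure \<Rightarrow> real" where
  "tv_dist M N = (SUP A\<in>sets M. \<bar>measure M A - measure N A\<bar>)"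

definition slowly_varying :: "(real \<Rightarrow> real) \<Rightarrow> bool" where
  "slowly_varying f \<longleftrightarrow>
     (\<exists>X. f \<in> borel_measurable (restrict_space borel {X..}) \<and> (\<forall>x\<ge>X. f x > 0)) \<and>
     (\<forall>c>0. ((\<lambda>x. f (c * x) / f x) \<longlongrightarrow> 1) at_top)"

end

theory Submission
  imports Defs "HOL-Real_Asymp.Real_Asymp" "HOL-Computational_Algebra.Formal_Power_Series"
begin

text \<open>
Write \<open>p\<^sub>k\<close> for the offspring probabilities, \<open>\<mu> < 1\<close> for their mean and \<open>m\<close> for the mean of the
number \<open>L\<close> of counted vertices of the Galton--Watson tree. Cutting a finite tree at a vertex with
\<open>d\<close> children leaves a tree with a marked leaf and \<open>d\<close> fringe subtrees, and \<open>graft\<close> undoes the cut.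
The probability of a tree is a product over its vertices, and the spine of the marked tree is built
exactly so that this product factorises (\<open>pmf_gw_graft\<close>):
  \<open>P(graft of (T, v) and ts) = p\<^sub>d / (1 - \<mu>) \<cdot> P(marked tree = (T, v)) \<cdot> \<Prod> P(tree = ts\<^sub>i)\<close>.
Hence, up to the requirement that the cut vertex be the first vertex of maximal outdegree, the tree
conditioned on \<open>L = n\<close> is a marked tree together with \<open>d\<close> independent trees whose counts sum to a value
prescribed by \<open>n\<close>, weighted by \<open>p\<^sub>d\<close>.

One large degree. The maximal degree is close to \<open>n / m\<close>: a tree with \<open>L = n\<close> all of whose degrees are at
most \<open>\<delta> n\<close> is polynomially unlikely of any prescribed order for small \<open>\<delta>\<close>, by a Chernoff bound in which
the truncated generating function of the tree is dominated through a supersolution of its fixed point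
equation (\<open>prob_L_small_max_outdeg\<close>); for linear degrees away from \<open>n / m\<close> the weak law of large numbers
applies. In the remaining window regular variation makes \<open>p\<^sub>d\<close> almost constant (\<open>window\<close>).

Exact hitting and first passage. In the conditioned tree the walk \<open>L(T) + L(T\<^sub>1) + \<dots> + L(T\<^sub>d)\<close> has to hit
the level given by \<open>n\<close>; in the limit model \<open>d\<close> is the last time at which the walk is at most \<open>n\<close>. The last
\<open>t\<close> trees are not observed, so both models are compared after convolution with the law of \<open>t\<close> further
steps. This law charges neighbouring integers and is therefore almost invariant under shifts
(\<open>power_shift_l1_tendsto_0\<close>), which gives that \<open>m\<close> times the hitting probability is close to the passage
probability, not only for each \<open>d\<close> but in total over all \<open>d\<close>, because the expected number of visits of the walk
to a point is bounded (\<open>hit_overshoot_compare\<close>). The same estimate contains the renewal theorem that is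
needed for the normalisation \<open>P(L = n)\<close>, which is asymptotically \<open>p\<^sub>d / ((1 - \<mu>) m)\<close> with \<open>d\<close> the integer part of \<open>n / m\<close>.

One-sided bounds. Since both laws are probability measures, it suffices that every event has, up to a small
additive error, at least the same probability under the conditioned law as under the limit law (\<open>tv_dist_le\<close>).
This requires an upper bound for \<open>P(L = n)\<close> (\<open>prob_L_eq_upper\<close>) and a lower bound for the joint probabilities
(\<open>prob_cond_map_lower\<close>). In the lower bound one may discard forests with another vertex of large degree and
forests whose last \<open>t + 1\<close> trees have at least \<open>C t\<close> vertices; by the law of large numbers the latter are
rare as soon as \<open>C\<close> exceeds the mean size of a tree.
\<close>

section \<open>Regular variation\<close>

text \<open>Uniformity comes from a measure argument in the logarithmic coordinates \<open>g x = ln (f (exp x))\<close>. By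
  dominated convergence the set of those \<open>y\<close> in \<open>[0, 2]\<close> for which \<open>g (x + y) - g x\<close> is not small has
  small measure for large \<open>x\<close>. For \<open>0 \<le> c \<le> 1\<close> the exceptional points seen from \<open>x\<close> and from \<open>x + c\<close> do not
  cover \<open>[x + c, x + 2]\<close>, and a point outside both links \<open>g x\<close> to \<open>g (x + c)\<close>.\<close>

lemma slowly_varying_uniform:
  assumes "slowly_varying f" and "\<epsilon> > 0"
  shows "\<forall>\<^sub>F x in at_top. \<forall>c\<in>{1..2}. \<bar>f (c * x) / f x - 1\<bar> \<le> \<epsilon>"
proof -
  from assms(1) obtain X0 where mf: "f \<in> borel_measurable (restrict_space borel {X0..})"
    and pos: "\<And>x. x \<ge> X0 \<Longrightarrow> f x > 0" and lim: "\<And>c. c > 0 \<Longrightarrow> ((\<lambda>x. f (c * x) / f x) \<longlongrightarrow> 1) at_top"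
    unfolding slowly_varying_def by blast
  define X where "X = max X0 1"
  define g where "g x = ln (f (max X (exp x)))" for x
  have g_eq: "g x = ln (f (exp x))" if "x \<ge> ln X" for x
  proof -
    have "exp x \<ge> X" using that unfolding X_def by (metis exp_le_cancel_iff exp_ln less_le_trans max.cobounded2 zero_less_one)
    then show ?thesis by (simp add: g_def max_absorb2)
  qed
  have mg[measurable]: "g \<in> borel_measurable borel"
  proof -
    have "(\<lambda>x. max X (exp x)) \<in> borel \<rightarrow>\<^sub>M restrict_space borel {X0..}"
      by (rule measurable_restrict_space2) (auto simp: X_def)
    from measurable_compose[OF this mf] show ?thesis unfolding g_def by measurable
  qed
  have glim: "((\<lambda>x. g (x + u) - g x) \<longlongrightarrow> 0) at_top" for u
  proof -
    have "((\<lambda>x. ln (f (exp u * exp x) / f (exp x))) \<longlongrightarrow> ln 1) at_top"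
      by (intro tendsto_ln filterlim_compose[OF lim exp_at_top]) auto
    moreover have "\<forall>\<^sub>F x in at_top. ln (f (exp u * exp x) / f (exp x)) = g (x + u) - g x"
      using eventually_ge_at_top[of "ln X"] eventually_ge_at_top[of "ln X - u"]
    proof eventually_elim
      case (elim x)
      have "exp x \<ge> X0" "exp (x + u) \<ge> X0"
        using elim exp_ln[of X] exp_le_cancel_iff[of "ln X" x] exp_le_cancel_iff[of "ln X" "x + u"]
        by (auto simp: X_def)
      from pos[OF this(1)] pos[OF this(2)]
      have "f (exp x) > 0" "f (exp (x + u)) > 0" .
      then show ?case using elim by (simp add: g_eq ln_div exp_add[symmetric] add.commute)
    qed
    ultimately show ?thesis by (simp add: tendsto_cong)
  qed
  define \<delta> where "\<delta> = ln (1 + \<epsilon>)"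
  have \<delta>: "\<delta> > 0" using assms(2) by (simp add: \<delta>_def)
  define E where "E x = {y \<in> {0..2::real}. \<bar>g (x + y) - g x\<bar> \<ge> \<delta>/2}" for x
  have E_meas[measurable]: "E x \<in> sets borel" for x unfolding E_def by measurable
  have E_fin: "emeasure lborel (E x) < \<infinity>" for x
  proof -
    have "E x \<subseteq> {0..2}" by (auto simp: E_def)
    from emeasure_mono[OF this, of lborel] have "emeasure lborel (E x) \<le> 2" by simp
    also have "\<dots> < \<infinity>" by simp
    finally show ?thesis .
  qed
  have "((\<lambda>x. \<integral>y. indicator (E x) y \<partial>lborel) \<longlongrightarrow> integral\<^sup>L lborel (\<lambda>y::real. 0::real)) at_top"
  proof (rule integral_dominated_convergence_at_top[where M = lborel and s = "\<lambda>x. indicator (E x)" and w = "indicator {0..2}"])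
    show "\<forall>\<^sub>F x in at_top. AE y in lborel. norm (indicator (E x) y :: real) \<le> indicator {0..2} y"
      by (auto simp: indicator_def E_def)
    show "AE y in lborel. ((\<lambda>x. indicator (E x) y :: real) \<longlongrightarrow> 0) at_top"
    proof (rule AE_I2)
      fix y :: real
      have "\<forall>\<^sub>F x in at_top. \<bar>g (x + y) - g x\<bar> < \<delta>/2"
        using tendstoD[OF glim[of y], of "\<delta>/2"] \<delta> by (simp add: dist_real_def)
      then have "\<forall>\<^sub>F x in at_top. indicator (E x) y = (0::real)"
        by eventually_elim (auto simp: E_def)
      then show "((\<lambda>x. indicator (E x) y :: real) \<longlongrightarrow> 0) at_top" by (simp add: tendsto_eventually)
    qed
  qed (auto simp: integrable_indicator_iff)
  then have "((\<lambda>x. measure lborel (E x)) \<longlongrightarrow> 0) at_top" by simp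
  from order_tendstoD(2)[OF this, of "1/2"]
  have "\<forall>\<^sub>F x in at_top. measure lborel (E x) < 1/2" by simp
  then obtain x0 where x0: "\<And>x. x \<ge> x0 \<Longrightarrow> measure lborel (E x) < 1/2"
    by (auto simp: eventually_at_top_linorder)
  have unif: "\<bar>g (x + c) - g x\<bar> < \<delta>" if "x \<ge> x0" "c \<in> {0..1}" for x c
  proof -
    define F where "F = (\<lambda>y. - c + y) -` (E (x + c)) \<inter> space lborel"
    have F_meas[measurable]: "F \<in> sets borel" 
    proof -
      have "(\<lambda>y. - c + y) \<in> borel \<rightarrow>\<^sub>M borel" by simp
      from measurable_sets[OF this E_meas] show ?thesis by (simp add: F_def)
    qed
    have "measure lborel (E (x + c)) = measure (distr lborel borel (\<lambda>y. -c + y)) (E (x + c))"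
      by (simp only: lborel_distr_plus)
    also have "\<dots> = measure lborel F"
      by (subst measure_distr) (auto simp: F_def simp del: uminus_add_conv_diff)
    finally have mF: "measure lborel F < 1/2" using x0[of "x + c"] that by auto
    have Fsub: "F \<subseteq> {c..c+2}" by (auto simp: F_def E_def)
    have F_fin: "emeasure lborel F < \<infinity>"
    proof -
      from emeasure_mono[OF Fsub, of lborel] have "emeasure lborel F \<le> 2" by simp
      also have "\<dots> < \<infinity>" by simp
      finally show ?thesis .
    qed
    \<comment> \<open>\<open>F\<close> is the exceptional set of \<open>x + c\<close>, seen from \<open>x\<close>; each of \<open>E x\<close> and \<open>F\<close> has measure below \<open>1/2\<close>\<close>
    have "\<not> {c..2} \<subseteq> E x \<union> F"
    proof
      assume sub: "{c..2} \<subseteq> E x \<union> F"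
      have "measure lborel {c..2} \<le> measure lborel (E x \<union> F)"
        using E_fin[of x] F_fin sub
        by (intro measure_mono_fmeasurable fmeasurable.Un) (auto simp: fmeasurable_def less_top)
      also have "\<dots> \<le> measure lborel (E x) + measure lborel F"
        by (rule measure_Un_le) auto
      also have "\<dots> < 1" using x0[of x] that mF by simp
      finally show False using that by simp
    qed
    then obtain u where u: "u \<in> {c..2}" "u \<notin> E x" "u \<notin> F" by blast
    then have "\<bar>g (x + u) - g x\<bar> < \<delta>/2" using that by (auto simp: E_def)
    moreover have "\<bar>g (x + u) - g (x + c)\<bar> < \<delta>/2"
      using u that by (auto simp: E_def F_def algebra_simps)
    ultimately show ?thesis by linarith
  qed
  have "\<forall>\<^sub>F x in at_top. x \<ge> max (exp x0) X" by (rule eventually_ge_at_top)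
  then show ?thesis
  proof eventually_elim
    case (elim x)
    show ?case
    proof
      fix c :: real assume c: "c \<in> {1..2}"
      have X: "X \<ge> 1" "X \<ge> X0" by (auto simp: X_def)
      have x1: "x \<ge> 1" "x \<ge> X" using elim X by auto
      have "c * x \<ge> 1 * x" using c x1 by (intro mult_right_mono) auto
      then have cx: "c * x \<ge> X" using x1 by linarith
      have "ln c \<le> 1" using c ln_le_minus_one[of c] by auto
      then have lc: "ln c \<in> {0..1}" using c by auto
      have "ln x \<ge> x0" using elim x1 by (subst ln_ge_iff) auto
      from unif[OF this lc] have "\<bar>g (ln x + ln c) - g (ln x)\<bar> < \<delta>" .
      moreover have "g (ln x + ln c) = ln (f (c * x))"
      proof -
        have e: "ln x + ln c = ln (c * x)" using c x1 by (simp add: ln_mult)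
        have "ln X \<le> ln (c * x)" using cx X by simp
        then show ?thesis unfolding e using cx X by (subst g_eq) auto
      qed
      moreover have "g (ln x) = ln (f x)" using x1 X by (subst g_eq) auto
      moreover have fp: "f x > 0" "f (c * x) > 0" using pos x1 X cx by auto
      ultimately have "\<bar>ln (f (c * x) / f x)\<bar> < \<delta>" by (simp add: ln_div)
      then have "- \<delta> \<le> ln (f (c * x) / f x)" "ln (f (c * x) / f x) \<le> \<delta>" by auto
      then have "exp (- \<delta>) \<le> exp (ln (f (c * x) / f x))" "exp (ln (f (c * x) / f x)) \<le> exp \<delta>" by auto
      moreover have "exp (ln (f (c * x) / f x)) = f (c * x) / f x" using fp by simp
      moreover have "exp \<delta> = 1 + \<epsilon>" "exp (- \<delta>) = 1 / (1 + \<epsilon>)"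
        using assms(2) by (simp_all add: \<delta>_def exp_minus inverse_eq_divide)
      moreover have "1 - \<epsilon> \<le> 1 / (1 + \<epsilon>)" using assms(2) by (simp add: field_simps)
      ultimately show "\<bar>f (c * x) / f x - 1\<bar> \<le> \<epsilon>" by (simp add: abs_le_iff)
    qed
  qed
qed

lemma slowly_varying_pos:
  assumes "slowly_varying f"
  shows "\<forall>\<^sub>F x in at_top. f x > 0"
  using assms unfolding slowly_varying_def eventually_at_top_linorder by metis

text \<open>Potter's bounds, by iterating the uniform estimate over dyadic steps. A full step costs a factor of at
  most \<open>2 powr \<theta>\<close>; the leading constant absorbs the last, incomplete step.\<close>

lemma slowly_varying_Potter:
  assumes "slowly_varying f" and "\<theta> > 0"
  shows "\<forall>\<^sub>F x in at_top. \<forall>y\<ge>x. f y \<le> 2 * (y / x) powr \<theta> * f x \<and> f x \<le> 2 * (y / x) powr \<theta> * f y"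
proof -
  \<comment> \<open>small enough that a change of \<open>f\<close> by \<open>1 \<plusminus> \<epsilon>\<close> is a factor within \<open>2 powr (\<plusminus> \<theta>)\<close>\<close>
  define \<epsilon> where "\<epsilon> = min (1/2) (1 - 2 powr - \<theta>)"
  have pw: "2 powr - \<theta> < (1::real)" using assms by (simp add: powr_less_one)
  have \<epsilon>: "\<epsilon> > 0" "\<epsilon> \<le> 1/2" "1 / (1 - \<epsilon>) \<le> 2 powr \<theta>" "1 + \<epsilon> \<le> 2 powr \<theta>"
  proof -
    show e1: "\<epsilon> > 0" using pw by (auto simp: \<epsilon>_def)
    show e1': "\<epsilon> \<le> 1/2" unfolding \<epsilon>_def by (rule min.cobounded1)
    note e1 = e1 e1'
    have e2: "1 - \<epsilon> \<ge> 2 powr - \<theta>" by (auto simp: \<epsilon>_def)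
    then have "1 / (1 - \<epsilon>) \<le> 1 / (2 powr - \<theta>)" using e1 by (intro divide_left_mono) auto
    then show e3: "1 / (1 - \<epsilon>) \<le> 2 powr \<theta>" by (simp add: powr_minus field_simps)
    have "(1 + \<epsilon>) * (1 - \<epsilon>) \<le> 1" by (simp add: algebra_simps)
    then have "1 + \<epsilon> \<le> 1 / (1 - \<epsilon>)" using e1 by (simp add: field_simps)
    with e3 show "1 + \<epsilon> \<le> 2 powr \<theta>" by simp
  qed
  from slowly_varying_uniform[OF assms(1) \<epsilon>(1)] slowly_varying_pos[OF assms(1)]
    eventually_gt_at_top[of 0]
  have "\<forall>\<^sub>F x in at_top. (\<forall>c\<in>{1..2}. \<bar>f (c * x) / f x - 1\<bar> \<le> \<epsilon>) \<and> f x > 0 \<and> x > 0"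
    by eventually_elim auto
  then obtain x0 where x0: "\<And>x c. x \<ge> x0 \<Longrightarrow> c \<in> {1..2} \<Longrightarrow> \<bar>f (c * x) / f x - 1\<bar> \<le> \<epsilon>"
      "\<And>x. x \<ge> x0 \<Longrightarrow> f x > 0" "\<And>x. x \<ge> x0 \<Longrightarrow> x > 0"
    unfolding eventually_at_top_linorder by blast
  have step: "f (c * x) \<le> 2 powr \<theta> * f x \<and> f x \<le> 2 powr \<theta> * f (c * x)
      \<and> f (c * x) \<le> 2 * f x \<and> f x \<le> 2 * f (c * x)" if "x \<ge> x0" "c \<in> {1..2}" for x c
  proof -
    from x0(1)[OF that] have a: "f (c * x) / f x \<le> 1 + \<epsilon>" "f (c * x) / f x \<ge> 1 - \<epsilon>" by auto
    have p: "f x > 0" by (rule x0(2)[OF that(1)])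
    from a p have b: "f (c * x) \<le> (1 + \<epsilon>) * f x" "f (c * x) \<ge> (1 - \<epsilon>) * f x" by (auto simp: field_simps)
    have "1 * x \<le> c * x" using that x0(3)[OF that(1)] by (intro mult_right_mono) auto
    then have pc: "f (c * x) > 0" using x0(2)[of "c * x"] that by simp
    have b2: "f x \<le> (1 / (1 - \<epsilon>)) * f (c * x)" using b(2) \<epsilon> by (simp add: field_simps)
    have "1 / (1 - \<epsilon>) \<le> 2" using \<epsilon> by (simp add: field_simps)
    then have "1 / (1 - \<epsilon>) * f (c * x) \<le> 2 * f (c * x)" using pc by (intro mult_right_mono) auto
    moreover have "1 / (1 - \<epsilon>) * f (c * x) \<le> 2 powr \<theta> * f (c * x)" using pc \<epsilon> by (intro mult_right_mono) auto
    moreover have "(1 + \<epsilon>) * f x \<le> 2 * f x" using p \<epsilon> by (intro mult_right_mono) auto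
    moreover have "(1 + \<epsilon>) * f x \<le> 2 powr \<theta> * f x" using p \<epsilon> by (intro mult_right_mono) auto
    ultimately show ?thesis using b(1) b2 by linarith
  qed
  have iter: "f (2 ^ k * x) \<le> (2 ^ k) powr \<theta> * f x \<and> f x \<le> (2 ^ k) powr \<theta> * f (2 ^ k * x) \<and> 2 ^ k * x \<ge> x0"
    if "x \<ge> x0" for x k
  proof (induction k)
    case (Suc k)
    from step[of "2 ^ k * x" 2] Suc
    have s: "f (2 * (2 ^ k * x)) \<le> 2 powr \<theta> * f (2 ^ k * x)" "f (2 ^ k * x) \<le> 2 powr \<theta> * f (2 * (2 ^ k * x))"
      by auto
    have e: "(2 ^ Suc k) powr \<theta> = 2 powr \<theta> * (2 ^ k :: real) powr \<theta>" by (simp add: powr_mult)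
    have "2 powr \<theta> * f (2 ^ k * x) \<le> 2 powr \<theta> * ((2 ^ k) powr \<theta> * f x)"
      using Suc by (intro mult_left_mono) auto
    from order_trans[OF s(1) this] have "f (2 ^ Suc k * x) \<le> 2 powr \<theta> * ((2 ^ k) powr \<theta> * f x)"
      by (simp only: power_Suc mult.assoc)
    moreover have "(2 ^ k) powr \<theta> * f (2 ^ k * x) \<le> (2 ^ k) powr \<theta> * (2 powr \<theta> * f (2 * (2 ^ k * x)))"
      using s(2) by (intro mult_left_mono) auto
    from order_trans[OF conjunct1[OF conjunct2[OF Suc]] this]
    have "f x \<le> (2 ^ k) powr \<theta> * (2 powr \<theta> * f (2 ^ Suc k * x))"
      by (simp only: power_Suc mult.assoc)
    moreover have "2 ^ Suc k * x \<ge> x0"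
    proof -
      have "x > 0" using x0(3) that by auto
      then have "1 * (2 ^ k * x) \<le> 2 * (2 ^ k * x)" by (intro mult_right_mono) auto
      also have "\<dots> = 2 ^ Suc k * x" by simp
      finally show ?thesis using Suc by linarith
    qed
    ultimately show ?case unfolding e by (simp add: mult_ac)
  qed (use that in auto)
  have "\<forall>\<^sub>F x in at_top. x \<ge> x0" by (rule eventually_ge_at_top)
  then show ?thesis
  proof eventually_elim
    case (elim x)
    show ?case
    proof (intro allI impI)
      fix y assume y: "y \<ge> x"
      have xp: "x > 0" using x0(3) elim by auto
      define k where "k = nat \<lfloor>log 2 (y / x)\<rfloor>"
      have l0: "log 2 (y / x) \<ge> 0" using y xp by simp
      have "real k \<le> log 2 (y / x)" "log 2 (y / x) \<le> real k + 1"
        using l0 by (auto simp: k_def)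
      then have "2 powr real k \<le> 2 powr log 2 (y / x)" "2 powr log 2 (y / x) \<le> 2 powr (real k + 1)"
        by (auto simp: powr_le_cancel_iff)
      then have k: "2 ^ k \<le> y / x" "y / x \<le> 2 * 2 ^ k"
        using xp y by (auto simp: powr_realpow powr_add)
      define c where "c = y / (2 ^ k * x)"
      have c: "c \<in> {1..2}" using k xp by (auto simp: c_def field_simps)
      have yc: "y = c * (2 ^ k * x)" using xp by (simp add: c_def)
      from iter[OF elim, of k] have it: "f (2 ^ k * x) \<le> (2 ^ k) powr \<theta> * f x"
        "f x \<le> (2 ^ k) powr \<theta> * f (2 ^ k * x)" "2 ^ k * x \<ge> x0" by auto
      from step[OF it(3) c] have s: "f y \<le> 2 * f (2 ^ k * x)" "f (2 ^ k * x) \<le> 2 * f y"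
        unfolding yc by auto
      have pk: "(2 ^ k) powr \<theta> \<le> (y / x) powr \<theta>" using k assms by (intro powr_mono2) auto
      have fx: "f x > 0" using x0(2) elim by auto
      have fy: "f y > 0" using x0(2) elim y by auto
      have "f y \<le> 2 * ((2 ^ k) powr \<theta> * f x)" using s it by linarith
      also have "\<dots> \<le> 2 * ((y / x) powr \<theta> * f x)" using pk fx by simp
      finally have 1: "f y \<le> 2 * (y / x) powr \<theta> * f x" by simp
      have "(2 ^ k) powr \<theta> * f (2 ^ k * x) \<le> (2 ^ k) powr \<theta> * (2 * f y)"
        using s by (intro mult_left_mono) auto
      with it have "f x \<le> (2 ^ k) powr \<theta> * (2 * f y)" by linarith
      also have "\<dots> \<le> (y / x) powr \<theta> * (2 * f y)" using pk fy by simp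
      finally have 2: "f x \<le> 2 * (y / x) powr \<theta> * f y" by simp
      from 1 2 show "f y \<le> 2 * (y / x) powr \<theta> * f x \<and> f x \<le> 2 * (y / x) powr \<theta> * f y" ..
    qed
  qed
qed

locale regularly_varying_seq =
  fixes p :: "nat \<Rightarrow> real" and f :: "real \<Rightarrow> real" and \<alpha> :: real
  assumes sv: "slowly_varying f" and \<alpha>: "\<alpha> > 1"
    and p_eq: "\<forall>\<^sub>F n in sequentially. p n = f (real n) * real n powr (- 1 - \<alpha>)"
begin

lemma eventually_p_pos: "\<forall>\<^sub>F n in sequentially. p n > 0"
  using p_eq eventually_compose_filterlim[OF slowly_varying_pos[OF sv] filterlim_real_sequentially]
    eventually_gt_at_top[of 0]
  by eventually_elim simp

lemma Potter:
  assumes "\<theta> > 0"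
  shows "\<forall>\<^sub>F n in sequentially. \<forall>m\<ge>n.
    p m \<le> 2 * (real m / real n) powr (\<theta> - 1 - \<alpha>) * p n \<and>
    p n \<le> 2 * (real m / real n) powr (\<theta> + 1 + \<alpha>) * p m"
  using eventually_all_ge_at_top[OF p_eq] eventually_gt_at_top[of 0]
    eventually_compose_filterlim[OF slowly_varying_Potter[OF sv assms] filterlim_real_sequentially]
proof eventually_elim
  case (elim n)
  show ?case
  proof (intro allI impI)
    fix m assume m: "m \<ge> n"
    define a b where "a = real n" and "b = real m"
    have ab: "0 < a" "a \<le> b" using elim m by (auto simp: a_def b_def)
    have pn: "p n = f a * a powr (- 1 - \<alpha>)" and pm: "p m = f b * b powr (- 1 - \<alpha>)"
      using elim m by (auto simp: a_def b_def)
    have f1: "f b \<le> 2 * (b / a) powr \<theta> * f a" and f2: "f a \<le> 2 * (b / a) powr \<theta> * f b"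
      using elim m by (auto simp: a_def b_def)
    have "p m \<le> 2 * (b / a) powr \<theta> * f a * b powr (- 1 - \<alpha>)"
      unfolding pm using f1 by (intro mult_right_mono) auto
    also have "\<dots> = 2 * (b / a) powr (\<theta> - 1 - \<alpha>) * p n"
      using ab unfolding pn
      by (simp add: powr_divide powr_diff powr_minus powr_add field_simps)
    finally have 1: "p m \<le> 2 * (b / a) powr (\<theta> - 1 - \<alpha>) * p n" .
    have "p n \<le> 2 * (b / a) powr \<theta> * f b * a powr (- 1 - \<alpha>)"
      unfolding pn using f2 by (intro mult_right_mono) auto
    also have "\<dots> = 2 * (b / a) powr (\<theta> + 1 + \<alpha>) * p m"
      using ab unfolding pm
      by (simp add: powr_divide powr_diff powr_minus powr_add field_simps)
    finally show "p m \<le> 2 * (real m / real n) powr (\<theta> - 1 - \<alpha>) * p n \<and>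
        p n \<le> 2 * (real m / real n) powr (\<theta> + 1 + \<alpha>) * p m"
      using 1 by (simp add: a_def b_def)
  qed
qed

text \<open>This bounds the weight of atypical degrees of linear size by the weight of the typical one.\<close>

lemma p_le_of_ge:
  assumes "\<delta> > 0"
  shows "\<exists>C>0. \<forall>\<^sub>F n in sequentially. \<forall>d. real d \<ge> \<delta> * real n \<longrightarrow> p d \<le> C * p n"
proof -
  define C where "C = max 2 (2 * (1 / \<delta>) powr (1 + 1 + \<alpha>))"
  from Potter[of 1] obtain N where N: "\<And>n m. n \<ge> N \<Longrightarrow> m \<ge> n \<Longrightarrow>
    p m \<le> 2 * (real m / real n) powr (1 - 1 - \<alpha>) * p n \<and>
    p n \<le> 2 * (real m / real n) powr (1 + 1 + \<alpha>) * p m"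
    unfolding eventually_at_top_linorder by auto
  have "\<forall>\<^sub>F n in sequentially. \<forall>d. real d \<ge> \<delta> * real n \<longrightarrow> p d \<le> C * p n"
    using eventually_ge_at_top[of N] eventually_ge_at_top[of "nat \<lceil>N / \<delta>\<rceil>"] eventually_p_pos
      eventually_gt_at_top[of 0]
  proof eventually_elim
    case (elim n)
    show ?case
    proof (intro allI impI)
      fix d assume d: "real d \<ge> \<delta> * real n"
      have dN: "d \<ge> N"
      proof -
        have "real N / \<delta> \<le> real n" using elim by linarith
        then have "real N \<le> \<delta> * real n" using assms by (simp add: field_simps)
        with d show ?thesis by simp
      qed
      show "p d \<le> C * p n"
      proof (cases "d \<ge> n")
        case True
        have "(real d / real n) powr (1 - 1 - \<alpha>) = 1 / ((real d / real n) powr \<alpha>)"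
          by (simp add: powr_minus divide_inverse)
        also have "\<dots> \<le> 1" using True elim \<alpha> by (simp add: divide_le_eq ge_one_powr_ge_zero)
        finally have "2 * (real d / real n) powr (1 - 1 - \<alpha>) * p n \<le> 2 * 1 * p n"
          using elim by (intro mult_right_mono mult_left_mono) auto
        also have "\<dots> \<le> C * p n" using elim by (intro mult_right_mono) (auto simp: C_def)
        finally have "2 * (real d / real n) powr (1 - 1 - \<alpha>) * p n \<le> C * p n" .
        moreover have "p d \<le> 2 * (real d / real n) powr (1 - 1 - \<alpha>) * p n"
          using N[of n d] elim True by blast
        ultimately show ?thesis by linarith
      next
        case False
        have "real d > 0" using d assms elim by (smt (verit) mult_pos_pos of_nat_0_less_iff)
        then have "real n / real d \<le> 1 / \<delta>" using d assms by (simp add: field_simps)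
        then have "(real n / real d) powr (1 + 1 + \<alpha>) \<le> (1 / \<delta>) powr (1 + 1 + \<alpha>)"
          using \<alpha> by (intro powr_mono2) auto
        then have "2 * (real n / real d) powr (1 + 1 + \<alpha>) * p n \<le> 2 * (1 / \<delta>) powr (1 + 1 + \<alpha>) * p n"
          using elim by (intro mult_right_mono mult_left_mono) auto
        also have "\<dots> \<le> C * p n" using elim by (intro mult_right_mono) (auto simp: C_def)
        finally show ?thesis using N[of d n] dN False by auto
      qed
    qed
  qed
  then show ?thesis by (intro exI[of _ C]) (auto simp: C_def)
qed

lemma p_lower_bound: "\<exists>K>0. \<forall>\<^sub>F n in sequentially. p n \<ge> real n powr - K"
proof -
  from Potter[of 1] eventually_p_pos obtain N0 where N: "\<And>n m. n \<ge> N0 \<Longrightarrow> m \<ge> n \<Longrightarrow>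
    p n \<le> 2 * (real m / real n) powr (1 + 1 + \<alpha>) * p m" and pos: "\<And>n. n \<ge> N0 \<Longrightarrow> p n > 0"
    unfolding eventually_at_top_linorder by (metis (no_types, lifting) order_trans linorder_le_cases zero_less_one)
  define N where "N = max N0 1"
  have NN: "N \<ge> N0" "N \<ge> 1" by (auto simp: N_def)
  have "\<forall>\<^sub>F n in sequentially. p n \<ge> real n powr - (3 + \<alpha>)"
    using eventually_ge_at_top[of N] eventually_ge_at_top[of "nat \<lceil>2 / p N\<rceil>"]
  proof eventually_elim
    case (elim n)
    have pN: "p N > 0" by (rule pos[OF NN(1)])
    have n0: "n > 0" using elim NN by auto
    have "(real n / real N) powr (1 + 1 + \<alpha>) \<le> real n powr (1 + 1 + \<alpha>)"
      using NN \<alpha> n0 by (intro powr_mono2) (auto simp: divide_le_eq)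
    then have "2 * (real n / real N) powr (1 + 1 + \<alpha>) * p n \<le> 2 * real n powr (1 + 1 + \<alpha>) * p n"
      using pos[of n] elim NN by (intro mult_right_mono mult_left_mono) auto
    with N[of N n] NN elim have "p N \<le> 2 * real n powr (1 + 1 + \<alpha>) * p n" by auto
    moreover have "2 / p N \<le> real n" using elim by linarith
    then have "2 \<le> real n * p N" using pN by (simp add: field_simps)
    ultimately have "2 \<le> real n * (2 * real n powr (1 + 1 + \<alpha>) * p n)"
      by (smt (verit) mult_left_mono of_nat_0_le_iff)
    then have "1 \<le> real n powr (3 + \<alpha>) * p n"
      using n0 by (simp add: powr_add) (simp add: mult_ac power2_eq_square power3_eq_cube)
    moreover have "real n powr (3 + \<alpha>) > 0" using n0 by simp
    ultimately have "inverse (real n powr (3 + \<alpha>)) \<le> p n"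
      by (simp add: inverse_eq_divide pos_divide_le_eq mult.commute)
    then show ?case by (simp only: powr_minus)
  qed
  then show ?thesis using \<alpha> by (intro exI[of _ "3 + \<alpha>"]) auto
qed

lemma p_close:
  assumes "\<eta> > 0"
  shows "\<exists>\<epsilon>>0. \<forall>\<^sub>F n in sequentially. \<forall>d. \<bar>real d - real n\<bar> \<le> \<epsilon> * real n \<longrightarrow>
     p d \<le> (1 + \<eta>) * p n \<and> p n \<le> (1 + \<eta>) * p d"
proof -
  define \<eta>' where "\<eta>' = min (1/2) (\<eta> / 10)"
  have \<eta>': "\<eta>' > 0" "\<eta>' \<le> 1/2" "10 * \<eta>' \<le> \<eta>" using assms by (auto simp: \<eta>'_def)
  have "((\<lambda>c. c powr (1 + \<alpha>)) \<longlongrightarrow> 1 powr (1 + \<alpha>)) (at (1::real))"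
    by (intro tendsto_intros) auto
  then have "\<forall>\<^sub>F c in at (1::real). \<bar>c powr (1 + \<alpha>) - 1\<bar> < \<eta>'"
    using tendstoD[OF _ \<eta>'(1), of _ "1 powr (1 + \<alpha>)" "at (1::real)"] by (simp add: dist_real_def)
  then obtain e where e: "e > 0" "\<And>c. c \<noteq> 1 \<Longrightarrow> \<bar>c - 1\<bar> < e \<Longrightarrow> \<bar>c powr (1 + \<alpha>) - 1\<bar> < \<eta>'"
    by (auto simp: eventually_at dist_real_def)
  have e': "\<bar>c powr (1 + \<alpha>) - 1\<bar> \<le> \<eta>'" if "\<bar>c - 1\<bar> < e" for c
    using e(2)[of c] that \<eta>' by (cases "c = 1") auto
  define \<epsilon> where "\<epsilon> = min (1/2) (e / 4)"
  have \<epsilon>: "\<epsilon> > 0" "\<epsilon> \<le> 1/2" "4 * \<epsilon> \<le> e" using e by (auto simp: \<epsilon>_def)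
  from eventually_conj[OF eventually_conj[OF p_eq eventually_p_pos]
     eventually_compose_filterlim[OF slowly_varying_uniform[OF sv \<eta>'(1)] filterlim_real_sequentially]]
    eventually_compose_filterlim[OF slowly_varying_pos[OF sv] filterlim_real_sequentially]
  have "\<forall>\<^sub>F n in sequentially. p n = f n * n powr (- 1 - \<alpha>) \<and> p n > 0 \<and> f (real n) > 0 \<and>
      (\<forall>c\<in>{1..2}. \<bar>f (c * real n) / f (real n) - 1\<bar> \<le> \<eta>')"
    by eventually_elim auto
  then obtain N0 where N0: "\<And>n. n \<ge> N0 \<Longrightarrow> p n = f n * n powr (- 1 - \<alpha>)" "\<And>n. n \<ge> N0 \<Longrightarrow> p n > 0"
      "\<And>n. n \<ge> N0 \<Longrightarrow> f (real n) > 0"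
      "\<And>n c. n \<ge> N0 \<Longrightarrow> c \<in> {1..2} \<Longrightarrow> \<bar>f (c * real n) / f (real n) - 1\<bar> \<le> \<eta>'"
    unfolding eventually_at_top_linorder by metis
  \<comment> \<open>comparison of two indices of which the smaller one is large\<close>
  have cmp: "p m \<le> (1 + \<eta>) * p n \<and> p n \<le> (1 + \<eta>) * p m"
    if n: "n \<ge> N0" "n > 0" and m: "m \<ge> n" "real m \<le> (1 + 2 * \<epsilon>) * real n" for n m
  proof -
    define c where "c = real m / real n"
    have c1: "c \<ge> 1" using m n by (simp add: c_def)
    have "c \<le> 1 + 2 * \<epsilon>" using m n by (simp add: c_def field_simps)
    then have c: "c \<in> {1..2}" "\<bar>c - 1\<bar> < e" using c1 \<epsilon> by auto
    have mc: "real m = c * real n" using n by (simp add: c_def)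
    define a where "a = f (real m) / f (real n)"
    define b where "b = c powr (1 + \<alpha>)"
    have a: "a \<le> 1 + \<eta>'" "a \<ge> 1 - \<eta>'" using N0(4)[OF n(1) c(1)] by (auto simp: a_def mc)
    have b: "b \<le> 1 + \<eta>'" "b \<ge> 1" using e'[OF c(2)] c1 \<alpha>
      by (auto simp: b_def ge_one_powr_ge_zero)
    have fn: "f (real n) > 0" using N0(3) n by auto
    have "p m = a * f n * (c * real n) powr (- 1 - \<alpha>)" using N0(1)[of m] n m fn by (simp add: a_def mc)
    also have "\<dots> = a / b * p n"
      using N0(1)[OF n(1)] n c1 by (simp add: powr_mult powr_diff powr_minus b_def powr_add field_simps)
    finally have pm: "p m * b = a * p n" using b by (simp add: field_simps)
    have pp: "p n > 0" "p m > 0" using N0(2) n m by auto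
    have "p m * 1 \<le> p m * b" using b pp by (intro mult_left_mono) auto
    also have "\<dots> \<le> (1 + \<eta>') * p n" unfolding pm using a pp by (intro mult_right_mono) auto
    also have "\<dots> \<le> (1 + \<eta>) * p n" using \<eta>' pp by (intro mult_right_mono) auto
    finally have 1: "p m \<le> (1 + \<eta>) * p n" by simp
    have "(1 - \<eta>') * p n \<le> p m * b" unfolding pm using a pp by (intro mult_right_mono) auto
    also have "\<dots> \<le> p m * (1 + \<eta>')" using b pp by (intro mult_left_mono) auto
    finally have "p n \<le> (1 + \<eta>') / (1 - \<eta>') * p m" using \<eta>' by (simp add: field_simps)
    also have "(1 + \<eta>') / (1 - \<eta>') \<le> 1 + \<eta>"
    proof -
      have "1 + \<eta>' \<le> (1 + 10 * \<eta>') * (1 - \<eta>')"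
      proof -
        have "\<eta>' * \<eta>' \<le> \<eta>' * (1/2)" using \<eta>' by (intro mult_left_mono) auto
        then show ?thesis using \<eta>'(1) by (simp add: algebra_simps)
      qed
      also have "\<dots> \<le> (1 + \<eta>) * (1 - \<eta>')" using \<eta>' by (intro mult_right_mono) auto
      finally show ?thesis using \<eta>' by (simp add: field_simps)
    qed
    then have "(1 + \<eta>') / (1 - \<eta>') * p m \<le> (1 + \<eta>) * p m" using pp by (intro mult_right_mono) auto
    finally show ?thesis using 1 by simp
  qed
  have "\<forall>\<^sub>F n in sequentially. \<forall>d. \<bar>real d - real n\<bar> \<le> \<epsilon>/2 * real n \<longrightarrow>
     p d \<le> (1 + \<eta>) * p n \<and> p n \<le> (1 + \<eta>) * p d"
    using eventually_ge_at_top[of "2 * N0 + 1"]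
  proof eventually_elim
    case (elim n)
    show ?case
    proof (intro allI impI)
      fix d assume d: "\<bar>real d - real n\<bar> \<le> \<epsilon>/2 * real n"
      have nn: "real n > 0" using elim by auto
      have "\<epsilon>/2 * real n \<le> 1/4 * real n" using \<epsilon> by (intro mult_right_mono) auto
      then have d2: "real d \<ge> 3/4 * real n" using d by linarith
      then have "d \<ge> N0" "d > 0" using elim nn by linarith+
      show "p d \<le> (1 + \<eta>) * p n \<and> p n \<le> (1 + \<eta>) * p d"
      proof (cases "d \<ge> n")
        case True
        have "0 \<le> \<epsilon> * real n" using \<epsilon> by simp
        then show ?thesis using cmp[of n d] True elim d by (auto simp: algebra_simps)
      next
        case False
        have "real n \<le> real d + \<epsilon>/2 * real n" using d by linarith
        also have "\<epsilon>/2 * real n \<le> \<epsilon>/2 * (4/3 * real d)" using d2 \<epsilon> by (intro mult_left_mono) auto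
        also have "\<dots> \<le> 2 * \<epsilon> * real d" using \<epsilon> by (simp add: field_simps)
        finally show ?thesis using cmp[of d n] False \<open>d \<ge> N0\<close> \<open>d > 0\<close> by (auto simp: algebra_simps)
      qed
    qed
  qed
  then show ?thesis using \<epsilon> by (intro exI[of _ "\<epsilon>/2"]) auto
qed

text \<open>Because of \<open>\<alpha> > 1\<close> there is room for slightly more than a first moment, which is what the
  Chernoff bound for trees uses.\<close>

lemma summable_moment: "\<exists>\<rho>>0. \<rho> \<le> 1 \<and> summable (\<lambda>k. p k * real k powr (1 + \<rho>))"
proof -
  define \<rho> where "\<rho> = min 1 ((\<alpha> - 1) / 3)"
  have "\<rho> \<le> (\<alpha> - 1) / 3" unfolding \<rho>_def by (rule min.cobounded2)
  then have \<rho>: "\<rho> > 0" "\<rho> \<le> 1" "3 * \<rho> \<le> \<alpha> - 1" using \<alpha> by (auto simp: \<rho>_def)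
  from Potter[OF \<rho>(1)] eventually_p_pos obtain N0 where N: "\<And>n m. n \<ge> N0 \<Longrightarrow> m \<ge> n \<Longrightarrow>
    p m \<le> 2 * (real m / real n) powr (\<rho> - 1 - \<alpha>) * p n" and pos: "\<And>n. n \<ge> N0 \<Longrightarrow> p n > 0"
    unfolding eventually_at_top_linorder by (metis (no_types, lifting) order_trans linorder_le_cases zero_less_one)
  define N where "N = max N0 1"
  have NN: "N \<ge> N0" "N \<ge> 1" by (auto simp: N_def)
  define C where "C = 2 / real N powr (\<rho> - 1 - \<alpha>) * p N"
  have "summable (\<lambda>k. C * real k powr (2 * \<rho> - \<alpha>))"
    using \<rho> by (intro summable_mult) (auto simp: summable_real_powr_iff)
  then show ?thesis
  proof (intro exI[of _ \<rho>] conjI \<rho>)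
    assume s: "summable (\<lambda>k. C * real k powr (2 * \<rho> - \<alpha>))"
    have "\<forall>\<^sub>F k in sequentially. norm (p k * real k powr (1 + \<rho>)) \<le> C * real k powr (2 * \<rho> - \<alpha>)"
      using eventually_ge_at_top[of N]
    proof eventually_elim
      case (elim k)
      have k0: "real k > 0" "real N > 0" using elim NN by auto
      have "p k \<le> 2 * (real k / real N) powr (\<rho> - 1 - \<alpha>) * p N" using N NN elim by auto
      also have "\<dots> = C * real k powr (\<rho> - 1 - \<alpha>)"
        using k0 by (simp add: C_def powr_divide)
      finally have "p k * real k powr (1 + \<rho>) \<le> C * real k powr (\<rho> - 1 - \<alpha>) * real k powr (1 + \<rho>)"
        by (intro mult_right_mono) auto
      also have "\<dots> = C * real k powr (2 * \<rho> - \<alpha>)"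
        using k0 by (simp add: powr_add[symmetric] mult.assoc)
      finally show ?case using pos[of k] elim NN by simp
    qed
    then show "summable (\<lambda>k. p k * real k powr (1 + \<rho>))"
      using s by (rule summable_comparison_test_ev)
  qed
qed

end

section \<open>Convolution powers and renewal bounds\<close>

text \<open>A bound for the sum of the absolute values of the coefficients. Stated for partial sums it needs no
  summability conditions, and a coefficient of a product only ever sees partial sums.\<close>

definition l1_le :: "real fps \<Rightarrow> real \<Rightarrow> bool" where
  "l1_le F c \<longleftrightarrow> (\<forall>K. (\<Sum>k\<le>K. \<bar>fps_nth F k\<bar>) \<le> c)"

lemma l1_leD: "l1_le F c \<Longrightarrow> (\<Sum>k\<le>K. \<bar>fps_nth F k\<bar>) \<le> c"
  by (simp add: l1_le_def)

lemma l1_le_nonneg: "l1_le F c \<Longrightarrow> 0 \<le> c"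
  using l1_leD[of F c 0] by (simp add: order_trans[OF abs_ge_zero])

lemma l1_le_mono: "l1_le F c \<Longrightarrow> c \<le> d \<Longrightarrow> l1_le F d"
  unfolding l1_le_def by (meson order_trans)

lemma l1_le_0 [simp]: "l1_le 0 0" by (simp add: l1_le_def)

lemma l1_le_add: "l1_le F c \<Longrightarrow> l1_le G d \<Longrightarrow> l1_le (F + G) (c + d)"
  unfolding l1_le_def
proof (intro allI)
  fix K assume *: "\<forall>K. (\<Sum>k\<le>K. \<bar>fps_nth F k\<bar>) \<le> c" "\<forall>K. (\<Sum>k\<le>K. \<bar>fps_nth G k\<bar>) \<le> d"
  have "(\<Sum>k\<le>K. \<bar>fps_nth (F + G) k\<bar>) \<le> (\<Sum>k\<le>K. \<bar>fps_nth F k\<bar> + \<bar>fps_nth G k\<bar>)"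
    by (intro sum_mono) simp
  also have "\<dots> \<le> c + d" using *[rule_format, of K] by (simp add: sum.distrib)
  finally show "(\<Sum>k\<le>K. \<bar>fps_nth (F + G) k\<bar>) \<le> c + d" .
qed

lemma l1_le_minus: "l1_le F c \<Longrightarrow> l1_le (- F) c"
  by (simp add: l1_le_def)

lemma l1_le_diff: "l1_le F c \<Longrightarrow> l1_le G d \<Longrightarrow> l1_le (F - G) (c + d)"
  using l1_le_add[OF _ l1_le_minus, of F c G d] by simp

lemma l1_le_sum: "(\<And>i. i \<in> I \<Longrightarrow> l1_le (F i) (c i)) \<Longrightarrow> l1_le (\<Sum>i\<in>I. F i) (\<Sum>i\<in>I. c i)"
  by (induction I rule: infinite_finite_induct) (auto intro: l1_le_add)

lemma l1_le_mult:
  assumes F: "l1_le F c" and G: "l1_le G d"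
  shows "l1_le (F * G) (c * d)"
  unfolding l1_le_def
proof
  fix K
  have "(\<Sum>k\<le>K. \<bar>fps_nth (F * G) k\<bar>) \<le> (\<Sum>k\<le>K. \<Sum>i\<le>k. \<bar>fps_nth F i\<bar> * \<bar>fps_nth G (k - i)\<bar>)"
    unfolding fps_mult_nth atLeast0AtMost
    by (intro sum_mono order_trans[OF sum_abs]) (simp add: abs_mult)
  also have "\<dots> = (\<Sum>(i,j)\<in>{(i,j). i + j \<le> K}. \<bar>fps_nth F i\<bar> * \<bar>fps_nth G j\<bar>)"
    by (rule sum.triangle_reindex_eq[symmetric])
  also have "\<dots> \<le> (\<Sum>(i,j)\<in>{..K} \<times> {..K}. \<bar>fps_nth F i\<bar> * \<bar>fps_nth G j\<bar>)"
    by (intro sum_mono2) auto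
  also have "\<dots> = (\<Sum>i\<le>K. \<bar>fps_nth F i\<bar>) * (\<Sum>j\<le>K. \<bar>fps_nth G j\<bar>)"
    by (simp add: sum_product sum.cartesian_product)
  also have "\<dots> \<le> c * d"
    using l1_leD[OF F] l1_leD[OF G] l1_le_nonneg[OF F] by (intro mult_mono) (auto intro: sum_nonneg)
  finally show "(\<Sum>k\<le>K. \<bar>fps_nth (F * G) k\<bar>) \<le> c * d" .
qed

lemma l1_le_1: "l1_le 1 1"
  by (auto simp: l1_le_def)

lemma l1_le_X: "l1_le fps_X 1"
  unfolding l1_le_def
proof
  fix K :: nat
  have "(\<Sum>k\<le>K. \<bar>fps_nth fps_X k :: real\<bar>) = (\<Sum>k\<le>K. if k = 1 then 1 else 0)"
    by (intro sum.cong) auto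
  also have "\<dots> \<le> 1" by simp
  finally show "(\<Sum>k\<le>K. \<bar>fps_nth fps_X k :: real\<bar>) \<le> 1" .
qed

lemma l1_le_power: "l1_le F c \<Longrightarrow> l1_le (F ^ n) (c ^ n)"
  by (induction n) (auto intro: l1_le_1 l1_le_mult)

lemma l1_le_const: "l1_le (fps_const c) \<bar>c\<bar>"
  unfolding l1_le_def
proof
  fix K :: nat
  have "(\<Sum>k\<le>K. \<bar>fps_nth (fps_const c) k\<bar>) = (\<Sum>k\<le>K. if k = 0 then \<bar>c\<bar> else 0)"
    by (intro sum.cong) auto
  also have "\<dots> \<le> \<bar>c\<bar>" by simp
  finally show "(\<Sum>k\<le>K. \<bar>fps_nth (fps_const c) k\<bar>) \<le> \<bar>c\<bar>" .
qed

lemma l1_le_X_power: "l1_le (fps_X ^ n) 1"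
  using l1_le_power[OF l1_le_X, of n] by simp

lemma one_plus_X_power_nth: "fps_nth ((1 + fps_X) ^ j) k = (of_nat (j choose k) :: real)"
proof -
  have "(1 + fps_X :: real fps) ^ j = (\<Sum>i\<le>j. of_nat (j choose i) * fps_X ^ i)"
    using binomial_ring[of "fps_X :: real fps" 1 j] by (simp add: add.commute)
  also have "fps_nth \<dots> k = (\<Sum>i\<le>j. if i = k then of_nat (j choose i) else 0)"
    unfolding fps_sum_nth by (intro sum.cong) (auto simp: fps_of_nat[symmetric] fps_X_power_nth)
  also have "\<dots> = of_nat (j choose k)" by simp
  finally show ?thesis .
qed

text \<open>With \<open>n = j + 1\<close>, the identity \<open>(j choose k) - (j choose (k - 1)) = (n choose k) (n - 2 k) / n\<close> turns
  the sum of absolute coefficients into the mean absolute deviation of a symmetric binomial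
  variable, which is at most its standard deviation.\<close>

lemma binomial_shift_l1:
  "l1_le ((fps_const (1/2) * (1 + fps_X)) ^ j * (1 - fps_X)) (2 / sqrt (real (j + 1)))"
  unfolding l1_le_def
proof
  fix K
  define n where "n = j + 1"
  define s where "s = sqrt (real n)"
  have s: "s > 0" "s * s = real n" by (auto simp: s_def n_def)
  let ?P = "(fps_const (1/2) * (1 + fps_X)) ^ j * (1 - fps_X) :: real fps"
  have coef: "fps_nth ?P k = 2 * Bernstein n k (1/2) * (real n - 2 * real k) / real n" if "k \<le> n" for k
  proof -
    have e: "?P = fps_const ((1/2) ^ j) * ((1 + fps_X) ^ j - fps_X * (1 + fps_X) ^ j)"
      by (simp only: power_mult_distrib fps_const_power) (simp only: algebra_simps mult_1_left mult_1_right)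
    have "fps_nth ?P k = (1/2) ^ j * (real (j choose k) - (if k = 0 then 0 else real (j choose (k - 1))))"
      unfolding e by (simp add: one_plus_X_power_nth)
    also have "real (j choose k) - (if k = 0 then 0 else real (j choose (k - 1)))
        = real (n choose k) * (real n - 2 * real k) / real n"
    proof (cases k)
      case (Suc i)
      have 1: "real (n choose k) * real k = real n * real (j choose i)"
        using Suc_times_binomial_eq[of j i] unfolding Suc n_def
        by (metis Suc_eq_plus1 mult.commute of_nat_mult)
      have 2: "real (n choose k) * real (n - k) = real n * real (j choose k)"
      proof -
        have "(n - k) * (n choose k) = n * (j choose k)"
          using binomial_absorb_comp[of n k] by (simp add: n_def)
        then show ?thesis by (metis mult.commute of_nat_mult)
      qed
      have 3: "real (n - k) = real n - real k" using that by simp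
      show ?thesis using 1 2 Suc unfolding 3 by (simp add: field_simps n_def)
    qed (simp add: n_def)
    also have "(1/2) ^ j * (real (n choose k) * (real n - 2 * real k) / real n)
        = 2 * Bernstein n k (1/2) * (real n - 2 * real k) / real n"
    proof -
      have "Bernstein n k (1/2) = real (n choose k) * (1/2) ^ n"
        using that by (simp add: Bernstein_def power_add[symmetric])
      then have "2 * Bernstein n k (1/2) = real (n choose k) * (1/2) ^ j" by (simp add: n_def)
      then show ?thesis by simp
    qed
    finally show ?thesis .
  qed
  have coef0: "fps_nth ?P k = 0" if "k > n" for k
  proof -
    have e: "?P = fps_const ((1/2) ^ j) * ((1 + fps_X) ^ j - fps_X * (1 + fps_X) ^ j)"
      by (simp only: power_mult_distrib fps_const_power) (simp only: algebra_simps mult_1_left mult_1_right)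
    have "j < k" "j < k - 1" using that by (auto simp: n_def)
    then show ?thesis unfolding e by (simp add: one_plus_X_power_nth binomial_eq_0)
  qed
  have var: "(\<Sum>k\<le>n. Bernstein n k (1/2) * (real n - 2 * real k)\<^sup>2) = real n"
  proof -
    have "(\<Sum>k\<le>n. Bernstein n k (1/2) * (real n - 2 * real k)\<^sup>2) =
      (\<Sum>k\<le>n. (real n)\<^sup>2 * Bernstein n k (1/2) + (4 - 4 * real n) * (real k * Bernstein n k (1/2))
         + 4 * (real k * (real k - 1) * Bernstein n k (1/2)))"
      by (intro sum.cong) (auto simp: power2_eq_square algebra_simps)
    also have "\<dots> = (real n)\<^sup>2 + (4 - 4 * real n) * (real n * (1/2)) + 4 * (real n * (real n - 1) * (1/2)\<^sup>2)"
      by (simp only: sum.distrib sum_distrib_left[symmetric] sum_Bernstein sum_k_Bernstein sum_kk_Bernstein)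
    also have "\<dots> = real n" by (simp add: power2_eq_square algebra_simps)
    finally show ?thesis .
  qed
  have amgm: "2 * \<bar>y\<bar> \<le> y\<^sup>2 / s + s" for y :: real
  proof -
    have "2 * \<bar>y\<bar> * s \<le> y\<^sup>2 + s * s"
      using sum_squares_bound[of "\<bar>y\<bar>" s] by (simp add: power2_eq_square)
    then show ?thesis using s by (simp add: field_simps)
  qed
  have "(\<Sum>k\<le>K. \<bar>fps_nth ?P k\<bar>) \<le> (\<Sum>k\<le>max K n. \<bar>fps_nth ?P k\<bar>)"
    by (intro sum_mono2) auto
  also have "\<dots> = (\<Sum>k\<le>n. \<bar>fps_nth ?P k\<bar>)"
    by (rule sum.mono_neutral_right) (auto simp: coef0)
  also have "\<dots> \<le> (\<Sum>k\<le>n. Bernstein n k (1/2) * ((real n - 2 * real k)\<^sup>2 / s + s) / real n)"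
  proof (intro sum_mono)
    fix k assume "k \<in> {..n}"
    then have "\<bar>fps_nth ?P k\<bar> = Bernstein n k (1/2) * (2 * \<bar>real n - 2 * real k\<bar>) / real n"
      by (simp add: coef abs_mult Bernstein_nonneg)
    also have "\<dots> \<le> Bernstein n k (1/2) * ((real n - 2 * real k)\<^sup>2 / s + s) / real n"
      by (intro divide_right_mono mult_left_mono amgm) (auto simp: Bernstein_nonneg)
    finally show "\<bar>fps_nth ?P k\<bar> \<le> Bernstein n k (1/2) * ((real n - 2 * real k)\<^sup>2 / s + s) / real n" .
  qed
  also have "\<dots> = (\<Sum>k\<le>n. (Bernstein n k (1/2) * (real n - 2 * real k)\<^sup>2) * (1 / (s * real n))
      + Bernstein n k (1/2) * (s / real n))"
    by (intro sum.cong refl) (simp add: distrib_left add_divide_distrib)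
  also have "\<dots> = real n * (1 / (s * real n)) + 1 * (s / real n)"
    by (simp only: sum.distrib sum_distrib_right[symmetric] var sum_Bernstein)
  also have "\<dots> = 2 / s" unfolding s(2)[symmetric] using s(1) by (simp add: field_simps)
  finally show "(\<Sum>k\<le>K. \<bar>fps_nth ?P k\<bar>) \<le> 2 / sqrt (real (j + 1))" by (simp add: s_def n_def)
qed

lemma binomial_weight_tendsto_0:
  fixes x :: real
  assumes "0 < x" "x < 1"
  shows "(\<lambda>t. real (t choose j) * x ^ j * (1 - x) ^ (t - j)) \<longlonglongrightarrow> 0"
proof -
  define y where "y = 1 - x"
  have y: "0 < y" "y < 1" using assms by (auto simp: y_def)
  have "(\<lambda>t. real t ^ j * y ^ t) \<longlonglongrightarrow> 0" using y by real_asymp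
  then have lim: "(\<lambda>t. real t ^ j * y ^ t * (x ^ j / y ^ j)) \<longlonglongrightarrow> 0" by (rule tendsto_mult_left_zero)
  have "\<forall>\<^sub>F t in sequentially. norm (real (t choose j) * x ^ j * y ^ (t - j)) \<le> real t ^ j * y ^ t * (x ^ j / y ^ j)"
    using eventually_ge_at_top[of j]
  proof eventually_elim
    case (elim t)
    have c: "real (t choose j) \<le> real t ^ j"
      using binomial_le_pow[OF elim] by (metis of_nat_le_iff of_nat_power)
    have "y ^ (t - j) = y ^ t / y ^ j" using y elim by (simp add: power_diff)
    then have "norm (real (t choose j) * x ^ j * y ^ (t - j)) = real (t choose j) * (x ^ j * (y ^ t / y ^ j))"
      using y assms by (simp add: abs_mult)
    also have "\<dots> \<le> real t ^ j * (x ^ j * (y ^ t / y ^ j))" using c y assms by (intro mult_right_mono) auto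
    finally show ?case by (simp add: mult_ac)
  qed
  from Lim_null_comparison[OF this lim] show ?thesis by (simp add: y_def)
qed

text \<open>A law that charges two neighbouring integers is a mixture of some law with a fair coin flip between
  these integers. Its convolution powers are therefore mixtures of convolutions with binomial laws
  whose number of trials tends to infinity, and these are almost invariant under a shift by one.\<close>

lemma power_shift_l1_tendsto_0:
  fixes A :: "real fps"
  assumes nonneg: "\<And>k. fps_nth A k \<ge> 0" and A1: "l1_le A 1"
    and pos: "fps_nth A a > 0" "fps_nth A (a + 1) > 0"
  obtains \<sigma> where "\<sigma> \<longlonglongrightarrow> 0" "\<And>t. l1_le (A ^ t * (1 - fps_X)) (\<sigma> t)"
proof -
  \<comment> \<open>the halving keeps \<open>2 q\<close>, the weight of the coin flip, strictly below \<open>1\<close>\<close>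
  define q where "q = min (fps_nth A a) (fps_nth A (a + 1)) / 2"
  have q: "q > 0" "2 * q \<le> fps_nth A a" "2 * q \<le> fps_nth A (a + 1)" using pos by (auto simp: q_def)
  have "fps_nth A a + fps_nth A (a + 1) \<le> 1"
  proof -
    have "fps_nth A a + fps_nth A (a + 1) = (\<Sum>k\<in>{a,a+1}. \<bar>fps_nth A k\<bar>)" using nonneg by simp
    also have "\<dots> \<le> (\<Sum>k\<le>a+1. \<bar>fps_nth A k\<bar>)" by (intro sum_mono2) auto
    finally show ?thesis using l1_leD[OF A1, of "a+1"] by simp
  qed
  then have q1: "2 * q < 1" using q by simp
  define B :: "real fps" where "B = fps_const (1/2) * (1 + fps_X)"
  define R where "R = A - fps_const (2 * q) * fps_X ^ a * B"
  have Rn: "fps_nth (fps_const (2 * q) * fps_X ^ a * B) k = (if k = a then q else if k = a + 1 then q else 0)" for k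
    unfolding B_def mult.assoc by (auto simp: fps_X_power_mult_nth)
  have R: "l1_le R (1 - 2 * q)"
    unfolding l1_le_def
  proof
    fix K
    have "(\<Sum>k\<le>K. \<bar>fps_nth R k\<bar>) \<le> (\<Sum>k\<le>max K (a + 1). \<bar>fps_nth R k\<bar>)"
      by (intro sum_mono2) auto
    also have "\<dots> = (\<Sum>k\<le>max K (a + 1). \<bar>fps_nth A k\<bar> - (if k = a then q else 0) - (if k = a + 1 then q else 0))"
      using q nonneg by (intro sum.cong) (auto simp: R_def Rn)
    also have "\<dots> = (\<Sum>k\<le>max K (a + 1). \<bar>fps_nth A k\<bar>) - 2 * q"
      by (simp add: sum_subtractf)
    also have "\<dots> \<le> 1 - 2 * q" using l1_leD[OF A1] by simp
    finally show "(\<Sum>k\<le>K. \<bar>fps_nth R k\<bar>) \<le> 1 - 2 * q" .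
  qed
  define x where "x = 2 * q"
  have x: "0 < x" "x < 1" using q q1 by (auto simp: x_def)
  define w where "w t j = real (t choose j) * x ^ j * (1 - x) ^ (t - j)" for t j
  have w0: "w t j \<ge> 0" for t j using x by (simp add: w_def)
  have w1: "(\<Sum>j\<le>t. w t j) = 1" for t
    using binomial_ring[of x "1 - x" t] by (simp add: w_def)
  define \<sigma> where "\<sigma> t = (\<Sum>j\<le>t. w t j * (2 / sqrt (real (j + 1))))" for t
  have s1: "l1_le (A ^ t * (1 - fps_X)) (\<sigma> t)" for t
  proof -
    have "A = fps_const x * fps_X ^ a * B + R" by (simp add: R_def x_def)
    then have "A ^ t = (\<Sum>j\<le>t. of_nat (t choose j) * (fps_const x * fps_X ^ a * B) ^ j * R ^ (t - j))"
      by (metis binomial_ring)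
    then have "A ^ t * (1 - fps_X) =
       (\<Sum>j\<le>t. fps_const (real (t choose j) * x ^ j) * (fps_X ^ a) ^ j * (B ^ j * (1 - fps_X)) * R ^ (t - j))"
      by (simp add: sum_distrib_right sum_distrib_left power_mult_distrib fps_of_nat[symmetric] mult_ac
         fps_const_power flip: fps_const_mult)
    moreover have "l1_le \<dots> (\<Sum>j\<le>t. \<bar>real (t choose j) * x ^ j\<bar> * 1 ^ j * (2 / sqrt (real (j + 1))) * (1 - 2 * q) ^ (t - j))"
      unfolding B_def
      by (intro l1_le_sum l1_le_mult l1_le_const l1_le_power l1_le_X_power R binomial_shift_l1)
    ultimately show ?thesis using x by (simp add: \<sigma>_def w_def x_def abs_mult mult_ac)
  qed
  have s2: "\<sigma> \<longlonglongrightarrow> 0"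
  proof (rule LIMSEQ_I)
    fix r :: real assume r: "r > 0"
    obtain J :: nat where J: "real J > (4 / r)\<^sup>2" using reals_Archimedean2 by blast
    have small: "2 / sqrt (real (j + 1)) \<le> r / 2" if "j \<ge> J" for j
    proof -
      have "(4 / r)\<^sup>2 \<le> real (j + 1)" using J that by linarith
      then have "4 / r \<le> sqrt (real (j + 1))" by (rule real_le_rsqrt)
      then show ?thesis using r by (simp add: field_simps)
    qed
    have "(\<lambda>t. \<Sum>j<J. 2 * w t j) \<longlonglongrightarrow> (\<Sum>j<J. 2 * 0)"
      unfolding w_def by (intro tendsto_sum tendsto_mult tendsto_const binomial_weight_tendsto_0 x)
    then have "\<forall>\<^sub>F t in sequentially. (\<Sum>j<J. 2 * w t j) < r / 2"
      using r by (intro order_tendstoD(2)) auto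
    then obtain N where N: "\<And>t. t \<ge> N \<Longrightarrow> (\<Sum>j<J. 2 * w t j) < r / 2"
      by (auto simp: eventually_at_top_linorder)
    show "\<exists>no. \<forall>n\<ge>no. norm (\<sigma> n - 0) < r"
    proof (intro exI allI impI)
      fix t assume t: "t \<ge> N"
      have "\<sigma> t \<le> (\<Sum>j\<le>t. (if j < J then 2 * w t j else 0) + r / 2 * w t j)"
        unfolding \<sigma>_def
      proof (intro sum_mono)
        fix j
        show "w t j * (2 / sqrt (real (j + 1))) \<le> (if j < J then 2 * w t j else 0) + r / 2 * w t j"
        proof (cases "j < J")
          case True
          have "2 / sqrt (real (j + 1)) \<le> 2" by (simp add: divide_le_eq)
          then have "w t j * (2 / sqrt (real (j + 1))) \<le> w t j * 2" using w0 by (intro mult_left_mono) auto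
          then show ?thesis using True w0[of t j] r by (simp add: add_increasing2)
        next
          case False
          then have "w t j * (2 / sqrt (real (j + 1))) \<le> w t j * (r / 2)" using w0 small by (intro mult_left_mono) auto
          then show ?thesis using False by (simp add: mult.commute)
        qed
      qed
      also have "\<dots> = (\<Sum>j\<in>{..t} \<inter> {..<J}. 2 * w t j) + r / 2"
      proof -
        have "(\<Sum>j\<le>t. if j < J then 2 * w t j else 0) = (\<Sum>j\<in>{..t} \<inter> {..<J}. 2 * w t j)"
          by (subst sum.inter_restrict) auto
        moreover have "(\<Sum>j\<le>t. r / 2 * w t j) = r / 2"
          by (simp only: sum_distrib_left[symmetric] w1 mult_1_right)
        ultimately show ?thesis by (simp only: sum.distrib)
      qed
      also have "(\<Sum>j\<in>{..t} \<inter> {..<J}. 2 * w t j) \<le> (\<Sum>j<J. 2 * w t j)"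
        using w0 by (intro sum_mono2) auto
      also have "\<dots> < r / 2" by (rule N[OF t])
      finally have "\<sigma> t < r" by simp
      moreover have "\<sigma> t \<ge> 0" unfolding \<sigma>_def using w0 by (intro sum_nonneg) auto
      ultimately show "norm (\<sigma> t - 0) < r" by simp
    qed
  qed
  show ?thesis by (rule that[OF s2 s1])
qed

lemma l1_le_X_power_diff:
  assumes "l1_le (F * (1 - fps_X)) c"
  shows "l1_le (F * (fps_X ^ i - fps_X ^ j)) (real (i + j) * c)"
proof -
  have *: "l1_le (F * (fps_X ^ i - fps_X ^ (i + d))) (real d * c)" for i d
  proof (induction d)
    case (Suc d)
    have "F * (fps_X ^ i - fps_X ^ (i + Suc d)) = F * (fps_X ^ i - fps_X ^ (i + d)) + (F * (1 - fps_X)) * fps_X ^ (i + d)"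
      by (simp add: algebra_simps)
    moreover have "l1_le \<dots> (real d * c + c * 1)"
      by (intro l1_le_add Suc l1_le_mult assms l1_le_X_power)
    ultimately show ?case by (simp add: algebra_simps)
  qed simp
  have c: "c \<ge> 0" by (rule l1_le_nonneg[OF assms])
  show ?thesis
  proof (cases "i \<le> j")
    case True
    then show ?thesis using *[of i "j - i"] c by (auto elim!: l1_le_mono intro!: mult_right_mono)
  next
    case False
    have "F * (fps_X ^ i - fps_X ^ j) = - (F * (fps_X ^ j - fps_X ^ i))" by (simp add: algebra_simps)
    then show ?thesis using l1_le_minus[OF *[of j "i - j"]] False c
      by (auto elim!: l1_le_mono intro!: mult_right_mono)
  qed
qed

text \<open>As the \<open>\<tau> j\<close> sum to \<open>m\<close>, the second factor is a combination of the differences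
  \<open>fps_X ^ r - fps_X ^ Suc j\<close>. All but finitely many have small total weight, and convolution powers of \<open>A\<close>
  flatten the others. In the application \<open>\<tau>\<close> is the tail of the step distribution and \<open>m\<close> its mean.\<close>

lemma tail_smoothing_l1:
  fixes A :: "real fps" and \<tau> :: "nat \<Rightarrow> real"
  assumes \<sigma>: "\<sigma> \<longlonglongrightarrow> 0" "\<And>t. l1_le (A ^ t * (1 - fps_X)) (\<sigma> t)"
    and A1: "l1_le A 1" and \<tau>0: "\<And>j. \<tau> j \<ge> 0" and \<tau>: "\<tau> sums m"
    and "e > 0"
  shows "\<forall>\<^sub>F t in sequentially. l1_le (A ^ t * (fps_const m * fps_X ^ r - fps_X * Abs_fps \<tau>)) e"
proof -
  have "\<forall>\<^sub>F J in sequentially. (\<Sum>j<J. \<tau> j) > m - e / 4"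
    using \<tau> \<open>e > 0\<close> unfolding sums_def by (intro order_tendstoD(1)) auto
  then obtain J where J: "(\<Sum>j<J. \<tau> j) > m - e / 4" by (auto simp: eventually_at_top_linorder)
  define \<rho> where "\<rho> = m - (\<Sum>j<J. \<tau> j)"
  have \<rho>: "0 \<le> \<rho>" "\<rho> < e / 4"
    using J sum_le_suminf[of \<tau> "{..<J}"] \<tau> \<tau>0 by (auto simp: \<rho>_def sums_iff)
  define T' where "T' = Abs_fps (\<lambda>j. if j < J then 0 else \<tau> j)"
  have T': "l1_le T' \<rho>"
    unfolding l1_le_def
  proof
    fix K
    have "(\<Sum>k\<le>K. \<bar>fps_nth T' k\<bar>) \<le> (\<Sum>k<max (Suc K) J. \<bar>fps_nth T' k\<bar>)"
      by (intro sum_mono2) auto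
    also have "\<dots> = (\<Sum>k<max (Suc K) J. \<tau> k - (if k < J then \<tau> k else 0))"
      using \<tau>0 by (intro sum.cong) (auto simp: T'_def)
    also have "\<dots> = (\<Sum>k<max (Suc K) J. \<tau> k) - (\<Sum>k\<in>{..<max (Suc K) J} \<inter> {..<J}. \<tau> k)"
      by (simp add: sum_subtractf sum.inter_restrict)
    also have "{..<max (Suc K) J} \<inter> {..<J} = {..<J}" by auto
    also have "(\<Sum>k<max (Suc K) J. \<tau> k) \<le> m"
      using sum_le_suminf[of \<tau> "{..<max (Suc K) J}"] \<tau> \<tau>0 by (auto simp: sums_iff)
    finally show "(\<Sum>k\<le>K. \<bar>fps_nth T' k\<bar>) \<le> \<rho>" by (simp add: \<rho>_def)
  qed
  have split: "fps_const m * fps_X ^ r - fps_X * Abs_fps \<tau>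
      = (\<Sum>j<J. fps_const (\<tau> j) * (fps_X ^ r - fps_X ^ Suc j)) + (fps_const \<rho> * fps_X ^ r - fps_X * T')"
  proof -
    have 1: "Abs_fps \<tau> = (\<Sum>j<J. fps_const (\<tau> j) * fps_X ^ j) + T'"
    proof (rule fps_ext)
      fix k
      have "fps_nth (\<Sum>j<J. fps_const (\<tau> j) * fps_X ^ j) k = (\<Sum>j<J. if j = k then \<tau> j else 0)"
        unfolding fps_sum_nth by (intro sum.cong) (auto simp: fps_X_power_nth)
      then show "fps_nth (Abs_fps \<tau>) k = fps_nth ((\<Sum>j<J. fps_const (\<tau> j) * fps_X ^ j) + T') k"
        by (simp add: T'_def)
    qed
    have 2: "fps_const m = (\<Sum>j<J. fps_const (\<tau> j)) + fps_const \<rho>"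
      by (rule fps_ext) (auto simp: \<rho>_def fps_sum_nth)
    show ?thesis unfolding 1 2
      by (simp add: algebra_simps sum_subtractf sum_distrib_left sum_distrib_right)
  qed
  have At: "l1_le (A ^ t) 1" for t using l1_le_power[OF A1, of t] by simp
  have bound: "l1_le (A ^ t * (fps_const m * fps_X ^ r - fps_X * Abs_fps \<tau>))
     ((\<Sum>j<J. \<bar>\<tau> j\<bar> * (real (r + Suc j) * \<sigma> t)) + 1 * (\<bar>\<rho>\<bar> * 1 + 1 * \<rho>))" for t
  proof -
    have "A ^ t * (fps_const m * fps_X ^ r - fps_X * Abs_fps \<tau>) =
       (\<Sum>j<J. fps_const (\<tau> j) * (A ^ t * (fps_X ^ r - fps_X ^ Suc j))) + A ^ t * (fps_const \<rho> * fps_X ^ r - fps_X * T')"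
      unfolding split by (simp add: distrib_left sum_distrib_left mult_ac)
    moreover have "l1_le \<dots> ((\<Sum>j<J. \<bar>\<tau> j\<bar> * (real (r + Suc j) * \<sigma> t)) + 1 * (\<bar>\<rho>\<bar> * 1 + 1 * \<rho>))"
      by (intro l1_le_add l1_le_sum l1_le_mult l1_le_diff l1_le_const l1_le_X_power l1_le_X At T'
           l1_le_X_power_diff \<sigma>)
    ultimately show ?thesis by simp
  qed
  have "(\<lambda>t. \<Sum>j<J. \<bar>\<tau> j\<bar> * (real (r + Suc j) * \<sigma> t)) \<longlonglongrightarrow> (\<Sum>j<J. \<bar>\<tau> j\<bar> * (real (r + Suc j) * 0))"
    by (intro tendsto_intros \<sigma>)
  then have "\<forall>\<^sub>F t in sequentially. (\<Sum>j<J. \<bar>\<tau> j\<bar> * (real (r + Suc j) * \<sigma> t)) < e / 2"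
    using \<open>e > 0\<close> by (intro order_tendstoD(2)) auto
  then show ?thesis
    by eventually_elim (rule l1_le_mono[OF bound], use \<rho> in auto)
qed


lemma fps_mult_nth_mono:
  fixes F :: "real fps"
  assumes "\<And>k. fps_nth F k \<ge> 0" "\<And>k. fps_nth G k \<le> fps_nth H k"
  shows "fps_nth (F * G) k \<le> fps_nth (F * H) k"
  unfolding fps_mult_nth using assms by (intro sum_mono mult_left_mono) auto

lemma fps_mult_nth_nonneg:
  fixes F :: "real fps"
  assumes "\<And>k. fps_nth F k \<ge> 0" "\<And>k. fps_nth G k \<ge> 0"
  shows "fps_nth (F * G) k \<ge> 0"
  unfolding fps_mult_nth using assms by (intro sum_nonneg mult_nonneg_nonneg) auto

lemma fps_power_nth_nonneg:
  fixes F :: "real fps"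
  assumes "\<And>k. fps_nth F k \<ge> 0"
  shows "fps_nth (F ^ n) k \<ge> 0"
  by (induction n arbitrary: k) (auto intro!: fps_mult_nth_nonneg assms)

lemma fps_mult_ones_nth: "fps_nth (F * Abs_fps (\<lambda>_. 1 :: real)) k = (\<Sum>i\<le>k. fps_nth F i)"
  by (simp add: fps_mult_nth atLeast0AtMost)

lemma fps_mult_X_ones_nth: "fps_nth (F * fps_X * Abs_fps (\<lambda>_. 1 :: real)) k = (\<Sum>i<k. fps_nth F i)"
proof (cases k)
  case (Suc j)
  have "fps_nth (F * fps_X * Abs_fps (\<lambda>_. 1 :: real)) k = (\<Sum>i\<le>j. fps_nth F i)"
  proof -
    have e: "F * fps_X * Abs_fps (\<lambda>_. 1 :: real) = fps_X * (F * Abs_fps (\<lambda>_. 1))" by (simp only: mult_ac)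
    show ?thesis unfolding e Suc fps_X_mult_nth fps_mult_ones_nth by simp
  qed
  then show ?thesis by (simp add: Suc lessThan_Suc_atMost)
qed (simp add: fps_mult_nth)

text \<open>For a random walk with nonnegative steps distributed according to \<open>A\<close>, the left side is the expected
  number of visits to \<open>k\<close> up to time \<open>D\<close>. Each visit lasts a geometric time, which explains the
  constant, and there is a visit only if the walk is at \<open>k\<close> or beyond at time \<open>D\<close>. The induction
  conditions on the first step.\<close>

lemma renewal_partial_sum_le:
  fixes A :: "real fps"
  assumes nonneg: "\<And>k. fps_nth A k \<ge> 0" and A1: "l1_le A 1" and A0: "fps_nth A 0 < 1"
  shows "(\<Sum>d\<le>D. fps_nth (A ^ d) k) \<le> 1 / (1 - fps_nth A 0) * (1 - (\<Sum>i<k. fps_nth (A ^ D) i))"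
proof -
  define U where "U = 1 / (1 - fps_nth A 0)"
  have U: "U > 0" "1 + U * fps_nth A 0 = U" using A0 by (auto simp: U_def field_simps)
  define one where "one = Abs_fps (\<lambda>_. 1 :: real)"
  have "fps_nth (\<Sum>d\<le>D. A ^ d) k \<le> fps_nth (fps_const U * (one - A ^ D * fps_X * one)) k" for k
  proof (induction D arbitrary: k)
    case 0
    have "one * (1 - fps_X) = 1"
    proof (rule fps_ext)
      fix n show "fps_nth (one * (1 - fps_X)) n = fps_nth 1 n"
        by (cases n) (auto simp: right_diff_distrib one_def)
    qed
    then have "one - A ^ 0 * fps_X * one = 1" by (simp add: algebra_simps)
    moreover have "1 \<le> U" using A0 nonneg[of 0] by (simp add: U_def field_simps)
    ultimately show ?case by simp
  next
    case (Suc D)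
    have step: "(\<Sum>d\<le>Suc D. A ^ d) = 1 + A * (\<Sum>d\<le>D. A ^ d)"
      by (simp only: sum.atMost_Suc_shift sum_distrib_left power_Suc power_0)
    have "fps_nth (\<Sum>d\<le>Suc D. A ^ d) k = fps_nth 1 k + fps_nth (A * (\<Sum>d\<le>D. A ^ d)) k"
      unfolding step by simp
    also have "\<dots> \<le> fps_nth 1 k + fps_nth (A * (fps_const U * (one - A ^ D * fps_X * one))) k"
      by (intro add_left_mono fps_mult_nth_mono nonneg Suc)
    also have "A * (fps_const U * (one - A ^ D * fps_X * one)) = fps_const U * (A * one - A ^ Suc D * fps_X * one)"
      by (simp add: algebra_simps)
    also have "fps_nth 1 k + fps_nth (fps_const U * (A * one - A ^ Suc D * fps_X * one)) k
       \<le> fps_nth (fps_const U * (one - A ^ Suc D * fps_X * one)) k"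
    proof -
      have "fps_nth 1 k + U * (\<Sum>i\<le>k. fps_nth A i) \<le> U"
      proof (cases "k = 0")
        case False
        have "(\<Sum>i\<le>k. fps_nth A i) \<le> 1" using l1_leD[OF A1, of k] nonneg by simp
        then have "U * (\<Sum>i\<le>k. fps_nth A i) \<le> U * 1" using U by (intro mult_left_mono) auto
        with False show ?thesis by simp
      qed (use U in simp)
      then have "fps_nth 1 k + U * fps_nth (A * one) k \<le> U * fps_nth one k"
        unfolding one_def fps_mult_ones_nth by simp
      then show ?thesis by (simp add: right_diff_distrib)
    qed
    finally show ?case .
  qed
  from this[of k] show ?thesis
    unfolding one_def fps_mult_left_const_nth fps_sub_nth fps_mult_X_ones_nth fps_sum_nth U_def by simp
qed

lemma renewal_sum_le:
  fixes A :: "real fps"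
  assumes nonneg: "\<And>k. fps_nth A k \<ge> 0" and A1: "l1_le A 1" and A0: "fps_nth A 0 < 1"
    and "finite I"
  shows "(\<Sum>d\<in>I. fps_nth (A ^ d) k) \<le> 1 / (1 - fps_nth A 0)"
proof -
  have "(\<Sum>d\<in>I. fps_nth (A ^ d) k) \<le> (\<Sum>d\<le>Max (insert 0 I). fps_nth (A ^ d) k)"
    using assms by (intro sum_mono2) (auto intro: fps_power_nth_nonneg)
  also have "\<dots> \<le> 1 / (1 - fps_nth A 0) * (1 - (\<Sum>i<k. fps_nth (A ^ Max (insert 0 I)) i))"
    by (rule renewal_partial_sum_le assms)+
  also have "\<dots> \<le> 1 / (1 - fps_nth A 0) * 1"
    using A0 nonneg by (intro mult_left_mono) (auto intro!: sum_nonneg fps_power_nth_nonneg)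
  finally show ?thesis by simp
qed

text \<open>Visits after time \<open>D\<close> require that the walk has not passed \<open>k\<close> at time \<open>D\<close>.\<close>

lemma renewal_tail_sum_le:
  fixes A :: "real fps"
  assumes nonneg: "\<And>k. fps_nth A k \<ge> 0" and A1: "l1_le A 1" and A0: "fps_nth A 0 < 1"
    and "finite I" and ge: "\<And>d. d \<in> I \<Longrightarrow> d \<ge> D"
  shows "(\<Sum>d\<in>I. fps_nth (A ^ d) k) \<le> 1 / (1 - fps_nth A 0) * (\<Sum>i\<le>k. fps_nth (A ^ D) i)"
proof -
  have "(\<Sum>d\<in>I. fps_nth (A ^ d) k) = fps_nth (A ^ D * (\<Sum>d\<in>(\<lambda>d. d - D) ` I. A ^ d)) k"
  proof -
    have inj: "inj_on (\<lambda>d. d - D) I" using ge by (auto simp: inj_on_def) (metis le_add_diff_inverse)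
    have "A ^ D * (\<Sum>d\<in>(\<lambda>d. d - D) ` I. A ^ d) = (\<Sum>d\<in>I. A ^ D * A ^ (d - D))"
      by (simp add: sum.reindex[OF inj] sum_distrib_left)
    also have "\<dots> = (\<Sum>d\<in>I. A ^ d)"
      using ge by (intro sum.cong refl) (simp add: power_add[symmetric])
    finally show ?thesis by (simp add: fps_sum_nth)
  qed
  also have "\<dots> = (\<Sum>i\<le>k. fps_nth (A ^ D) i * (\<Sum>d\<in>(\<lambda>d. d - D) ` I. fps_nth (A ^ d) (k - i)))"
    by (simp add: fps_mult_nth fps_sum_nth atLeast0AtMost)
  also have "\<dots> \<le> (\<Sum>i\<le>k. fps_nth (A ^ D) i * (1 / (1 - fps_nth A 0)))"
    using assms by (intro sum_mono mult_left_mono renewal_sum_le fps_power_nth_nonneg) auto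
  finally show ?thesis by (simp add: sum_divide_distrib)
qed

section \<open>Sums of independent variables\<close>

text \<open>The generating function of \<open>f\<close> restricted to the event \<open>P\<close>. It is not normalised, so that
  independence becomes multiplication of power series also in the presence of events.\<close>

definition gf :: "'a pmf \<Rightarrow> ('a \<Rightarrow> bool) \<Rightarrow> ('a \<Rightarrow> nat) \<Rightarrow> real fps" where
  "gf p P f = Abs_fps (\<lambda>k. measure_pmf.prob p {x. P x \<and> f x = k})"

lemma gf_nth: "fps_nth (gf p P f) k = measure_pmf.prob p {x. P x \<and> f x = k}"
  by (simp add: gf_def)

lemma gf_nth_nonneg [simp]: "fps_nth (gf p P f) k \<ge> 0"
  by (simp add: gf_nth)

lemma gf_mono: "(\<And>x. x \<in> set_pmf p \<Longrightarrow> P x \<Longrightarrow> Q x) \<Longrightarrow> fps_nth (gf p P f) k \<le> fps_nth (gf p Q f) k"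
  unfolding gf_nth by (intro measure_pmf.finite_measure_mono_AE) (auto simp: AE_measure_pmf_iff)

lemma gf_cong: "(\<And>x. x \<in> set_pmf p \<Longrightarrow> P x \<longleftrightarrow> Q x) \<Longrightarrow> (\<And>x. x \<in> set_pmf p \<Longrightarrow> f x = g x) \<Longrightarrow> gf p P f = gf p Q g"
  unfolding gf_def by (intro arg_cong[of _ _ Abs_fps] ext measure_pmf.finite_measure_eq_AE) (auto simp: AE_measure_pmf_iff)

lemma sum_gf_nth:
  assumes "finite I"
  shows "(\<Sum>k\<in>I. fps_nth (gf p P f) k) = measure_pmf.prob p {x. P x \<and> f x \<in> I}"
proof -
  have "{x. P x \<and> f x \<in> I} = (\<Union>k\<in>I. {x. P x \<and> f x = k})" by auto
  then show ?thesis
    unfolding gf_nth using assms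
    by (subst measure_pmf.finite_measure_finite_Union[symmetric]) (auto simp: disjoint_family_on_def)
qed

lemma l1_le_gf: "l1_le (gf p P f) 1"
  unfolding l1_le_def by (simp add: sum_gf_nth abs_of_nonneg)

lemma gf_map_pmf: "gf (map_pmf h p) P f = gf p (\<lambda>x. P (h x)) (\<lambda>x. f (h x))"
  unfolding gf_def by (simp add: vimage_def)

lemma prob_pair_times: "measure_pmf.prob (pair_pmf p q) (A \<times> B) = measure_pmf.prob p A * measure_pmf.prob q B"
proof -
  have "emeasure (measure_pmf (pair_pmf p q)) (A \<times> B) = (\<integral>\<^sup>+x. \<integral>\<^sup>+y. indicator A x * indicator B y \<partial>q \<partial>p)"
    by (subst nn_integral_indicator[symmetric]) (auto simp: nn_integral_pair_pmf' indicator_times)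
  also have "\<dots> = emeasure p A * emeasure q B"
    by (simp add: nn_integral_cmult nn_integral_multc)
  finally show ?thesis by (simp add: measure_pmf.emeasure_eq_measure ennreal_mult[symmetric])
qed

lemma gf_pair:
  "gf (pair_pmf p q) (\<lambda>(x, y). P x \<and> Q y) (\<lambda>(x, y). f x + g y) = gf p P f * gf q Q g"
proof (rule fps_ext)
  fix k
  have eq: "{z. (case z of (x, y) \<Rightarrow> P x \<and> Q y) \<and> (case z of (x, y) \<Rightarrow> f x + g y) = k}
     = (\<Union>i\<le>k. {x. P x \<and> f x = i} \<times> {y. Q y \<and> g y = k - i})"
    by auto
  show "fps_nth (gf (pair_pmf p q) (\<lambda>(x, y). P x \<and> Q y) (\<lambda>(x, y). f x + g y)) k = fps_nth (gf p P f * gf q Q g) k"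
    unfolding fps_mult_nth gf_nth eq atLeast0AtMost
    by (subst measure_pmf.finite_measure_finite_Union) (auto simp: disjoint_family_on_def prob_pair_times)
qed

lemma replicate_pmf_Suc_pair: "replicate_pmf (Suc n) p = map_pmf (\<lambda>(x, xs). x # xs) (pair_pmf p (replicate_pmf n p))"
  by (simp add: map_pmf_def pair_pmf_def bind_assoc_pmf bind_return_pmf)

lemma replicate_pmf_add_pair:
  "replicate_pmf (m + n) p = map_pmf (\<lambda>(xs, ys). xs @ ys) (pair_pmf (replicate_pmf m p) (replicate_pmf n p))"
  by (simp add: replicate_pmf_distrib map_pmf_def pair_pmf_def bind_assoc_pmf bind_return_pmf)

lemma length_replicate_pmf: "xs \<in> set_pmf (replicate_pmf n p) \<Longrightarrow> length xs = n"
  by (simp add: set_replicate_pmf)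

lemma replicate_map_pmf: "replicate_pmf n (map_pmf f p) = map_pmf (map f) (replicate_pmf n p)"
  by (induction n) (simp_all add: map_pmf_def bind_assoc_pmf bind_return_pmf)

lemma gf_replicate_all:
  "gf (replicate_pmf d p) (\<lambda>xs. \<forall>x\<in>set xs. P x) (\<lambda>xs. sum_list (map g xs)) = gf p P g ^ d"
proof (induction d)
  case 0
  show ?case by (rule fps_ext) (auto simp: gf_nth measure_return_pmf)
next
  case (Suc d)
  have "gf (replicate_pmf (Suc d) p) (\<lambda>xs. \<forall>x\<in>set xs. P x) (\<lambda>xs. sum_list (map g xs))
     = gf (pair_pmf p (replicate_pmf d p)) (\<lambda>(x, xs). P x \<and> (\<forall>y\<in>set xs. P y)) (\<lambda>(x, xs). g x + sum_list (map g xs))"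
    unfolding replicate_pmf_Suc_pair gf_map_pmf by (intro gf_cong) auto
  also have "\<dots> = gf p P g * gf (replicate_pmf d p) (\<lambda>xs. \<forall>x\<in>set xs. P x) (\<lambda>xs. sum_list (map g xs))"
    by (rule gf_pair)
  finally show ?case using Suc by simp
qed

lemma gf_replicate:
  "gf (replicate_pmf d p) (\<lambda>_. True) (\<lambda>xs. sum_list (map g xs)) = gf p (\<lambda>_. True) g ^ d"
  using gf_replicate_all[of d p "\<lambda>_. True" g] by simp

text \<open>A union bound over the position of the exceptional entry: with \<open>G\<close> the series of unexceptional values,
  \<open>A ^ d - G ^ d\<close> telescopes into \<open>d\<close> products, each of which contains one factor \<open>A - G\<close>. Commutativity replaces
  an exchangeability argument.\<close>

lemma gf_replicate_ex_le:
  "fps_nth (gf (replicate_pmf d p) (\<lambda>xs. \<exists>x\<in>set xs. b x) (\<lambda>xs. sum_list (map g xs))) k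
    \<le> real d * fps_nth (gf p b g * gf p (\<lambda>_. True) g ^ (d - 1)) k"
proof -
  let ?A = "gf p (\<lambda>_. True) g" and ?G = "gf p (\<lambda>x. \<not> b x) g" and ?W = "gf p b g"
  have split: "gf q (\<lambda>_. True) h = gf q P h + gf q (\<lambda>x. \<not> P x) h" for q :: "'c pmf" and P h
  proof (rule fps_ext)
    fix k
    have "{x. True \<and> h x = k} = {x. P x \<and> h x = k} \<union> {x. \<not> P x \<and> h x = k}" by auto
    then show "fps_nth (gf q (\<lambda>_. True) h) k = fps_nth (gf q P h + gf q (\<lambda>x. \<not> P x) h) k"
      unfolding gf_nth fps_add_nth
      by (subst measure_pmf.finite_measure_Union[symmetric]) auto
  qed
  have "fps_nth (?A ^ d - ?G ^ d) k \<le> fps_nth (fps_const (real d) * (?W * ?A ^ (d - 1))) k" for k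
  proof (induction d arbitrary: k)
    case (Suc d)
    have "?A ^ Suc d - ?G ^ Suc d = ?W * ?A ^ d + ?G * (?A ^ d - ?G ^ d)"
      unfolding split[of p g b] by (simp add: algebra_simps)
    then have "fps_nth (?A ^ Suc d - ?G ^ Suc d) k = fps_nth (?W * ?A ^ d) k + fps_nth (?G * (?A ^ d - ?G ^ d)) k"
      by simp
    also have "fps_nth (?G * (?A ^ d - ?G ^ d)) k \<le> fps_nth (?G * (fps_const (real d) * (?W * ?A ^ (d - 1)))) k"
      by (intro fps_mult_nth_mono Suc) auto
    also have "\<dots> = fps_nth ((fps_const (real d) * (?W * ?A ^ (d - 1))) * ?G) k" by (simp only: mult.commute)
    also have "\<dots> \<le> fps_nth ((fps_const (real d) * (?W * ?A ^ (d - 1))) * ?A) k"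
      by (intro fps_mult_nth_mono) (auto intro!: mult_nonneg_nonneg fps_mult_nth_nonneg fps_power_nth_nonneg gf_mono)
    also have "(fps_const (real d) * (?W * ?A ^ (d - 1))) * ?A = fps_const (real d) * (?W * ?A ^ d)"
      by (cases d) (auto simp: mult_ac)
    also have "fps_nth (?W * ?A ^ d) k + fps_nth (fps_const (real d) * (?W * ?A ^ d)) k
       = fps_nth (fps_const (real (Suc d)) * (?W * ?A ^ (Suc d - 1))) k"
      unfolding fps_mult_left_const_nth diff_Suc_1 by (simp only: of_nat_Suc distrib_right mult_1_left)
    finally show ?case by simp
  qed simp
  moreover have "gf (replicate_pmf d p) (\<lambda>xs. \<exists>x\<in>set xs. b x) (\<lambda>xs. sum_list (map g xs)) = ?A ^ d - ?G ^ d"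
    using split[of "replicate_pmf d p" "\<lambda>xs. sum_list (map g xs)" "\<lambda>xs. \<exists>x\<in>set xs. b x"]
    unfolding gf_replicate gf_replicate_all[symmetric] by (simp add: algebra_simps)
  ultimately show ?thesis by simp
qed

lemma nn_integral_replicate_prod:
  "(\<integral>\<^sup>+xs. prod_list (map \<phi> xs) \<partial>replicate_pmf d p) = (\<integral>\<^sup>+x. \<phi> x \<partial>p) ^ d" for \<phi> :: "'a \<Rightarrow> ennreal"
proof (induction d)
  case (Suc d)
  have "(\<integral>\<^sup>+xs. prod_list (map \<phi> xs) \<partial>replicate_pmf (Suc d) p)
     = (\<integral>\<^sup>+x. \<integral>\<^sup>+xs. \<phi> x * prod_list (map \<phi> xs) \<partial>replicate_pmf d p \<partial>p)"
    unfolding replicate_pmf_Suc_pair by (simp add: nn_integral_pair_pmf' case_prod_unfold)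
  also have "\<dots> = (\<integral>\<^sup>+x. \<phi> x \<partial>p) ^ Suc d"
    by (simp add: nn_integral_cmult nn_integral_multc Suc)
  finally show ?case .
qed simp

lemma prob_replicate_ex_le:
  "measure_pmf.prob (replicate_pmf d p) {xs. \<exists>x\<in>set xs. P x} \<le> real d * measure_pmf.prob p {x. P x}"
proof -
  have "emeasure (replicate_pmf d p) {xs. \<exists>x\<in>set xs. P x} \<le> of_nat d * emeasure p {x. P x}"
  proof (induction d)
    case (Suc d)
    have "emeasure (replicate_pmf (Suc d) p) {xs. \<exists>x\<in>set xs. P x}
       = emeasure (pair_pmf p (replicate_pmf d p)) ({x. P x} \<times> UNIV \<union> UNIV \<times> {xs. \<exists>x\<in>set xs. P x})"
      unfolding replicate_pmf_Suc_pair by (auto simp: vimage_def intro!: arg_cong2[of _ _ _ _ emeasure])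
    also have "\<dots> \<le> emeasure (pair_pmf p (replicate_pmf d p)) ({x. P x} \<times> UNIV)
        + emeasure (pair_pmf p (replicate_pmf d p)) (UNIV \<times> {xs. \<exists>x\<in>set xs. P x})"
      by (rule emeasure_subadditive) auto
    also have "\<dots> = emeasure p {x. P x} + emeasure (replicate_pmf d p) {xs. \<exists>x\<in>set xs. P x}"
      by (simp add: measure_pmf.emeasure_eq_measure prob_pair_times)
    also have "\<dots> \<le> emeasure p {x. P x} + of_nat d * emeasure p {x. P x}"
      by (intro add_left_mono Suc)
    finally show ?case by (simp add: algebra_simps)
  qed simp
  then show ?thesis
    by (simp add: measure_pmf.emeasure_eq_measure ennreal_of_nat_eq_real_of_nat ennreal_mult[symmetric])
qed

text \<open>Either some entry exceeds \<open>b\<close>, or the exponential Markov inequality applies to the truncated entries.\<close>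

lemma truncated_Chernoff:
  fixes p :: "nat pmf"
  assumes h: "h \<ge> 0"
  shows "ennreal (measure_pmf.prob (replicate_pmf d p) {xs. real (sum_list xs) \<ge> c})
    \<le> ennreal (real d * measure_pmf.prob p {x. real x > b})
      + ennreal (exp (- h * c)) * (\<integral>\<^sup>+x. ennreal (exp (h * real x)) * indicator {x. real x \<le> b} x \<partial>p) ^ d"
proof -
  let ?\<phi> = "\<lambda>x. ennreal (exp (h * real x)) * indicator {x. real x \<le> b} x"
  let ?E1 = "{xs::nat list. \<exists>x\<in>set xs. real x > b}"
  let ?E2 = "{xs::nat list. (\<forall>x\<in>set xs. real x \<le> b) \<and> real (sum_list xs) \<ge> c}"
  have prod: "prod_list (map ?\<phi> xs) = ennreal (exp (h * real (sum_list xs)))" if "\<forall>x\<in>set xs. real x \<le> b" for xs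
    using that by (induction xs) (auto simp: exp_add algebra_simps ennreal_mult)
  have "emeasure (replicate_pmf d p) {xs. real (sum_list xs) \<ge> c} \<le> emeasure (replicate_pmf d p) (?E1 \<union> ?E2)"
    by (intro emeasure_mono) (auto simp: not_le)
  also have "\<dots> \<le> emeasure (replicate_pmf d p) ?E1 + emeasure (replicate_pmf d p) ?E2"
    by (rule emeasure_subadditive) auto
  also have "emeasure (replicate_pmf d p) ?E1 \<le> ennreal (real d * measure_pmf.prob p {x. real x > b})"
    using prob_replicate_ex_le[of d p "\<lambda>x. real x > b"] by (simp add: measure_pmf.emeasure_eq_measure)
  also have "emeasure (replicate_pmf d p) ?E2 \<le> (\<integral>\<^sup>+xs. ennreal (exp (- h * c)) * prod_list (map ?\<phi> xs) \<partial>replicate_pmf d p)"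
  proof -
    have "indicator ?E2 xs \<le> ennreal (exp (- h * c)) * prod_list (map ?\<phi> xs)" for xs
    proof (cases "xs \<in> ?E2")
      case True
      then have "h * c \<le> h * real (sum_list xs)" using h by (intro mult_left_mono) auto
      then have "1 \<le> exp (- h * c) * exp (h * real (sum_list xs))" by (simp add: exp_add[symmetric])
      then have "1 \<le> ennreal (exp (- h * c)) * ennreal (exp (h * real (sum_list xs)))"
        by (simp add: ennreal_mult[symmetric])
      then show ?thesis using True prod[of xs] by simp
    qed simp
    then have "(\<integral>\<^sup>+xs. indicator ?E2 xs \<partial>replicate_pmf d p)
        \<le> (\<integral>\<^sup>+xs. ennreal (exp (- h * c)) * prod_list (map ?\<phi> xs) \<partial>replicate_pmf d p)"
      by (intro nn_integral_mono)
    then show ?thesis by (subst (asm) nn_integral_indicator) auto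
  qed
  also have "\<dots> = ennreal (exp (- h * c)) * (\<integral>\<^sup>+x. ?\<phi> x \<partial>p) ^ d"
    by (simp add: nn_integral_cmult nn_integral_replicate_prod)
  finally show ?thesis by (simp add: measure_pmf.emeasure_eq_measure add_right_mono)
qed

text \<open>Only a first moment is available. Truncation at \<open>d / B\<close> together with the exponent \<open>h = B / d\<close> keeps \<open>h x\<close>
  below \<open>1\<close>, so the exponential is quadratic up to constants, and both error terms are governed by
  the expectation of \<open>x min (B x / d) 1\<close>, which tends to \<open>0\<close> by dominated convergence.\<close>

lemma weak_law_upper:
  fixes p :: "nat pmf"
  assumes int: "integrable p real" and a: "a > measure_pmf.expectation p real"
  shows "(\<lambda>d. measure_pmf.prob (replicate_pmf d p) {xs. real (sum_list xs) \<ge> a * real d}) \<longlonglongrightarrow> 0"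
proof (rule LIMSEQ_I)
  fix r :: real assume r: "r > 0"
  define m where "m = measure_pmf.expectation p real"
  have m0: "m \<ge> 0" unfolding m_def by (intro Bochner_Integration.integral_nonneg) auto
  obtain B where B: "B > 0" "exp (- B * (a - m)) < r / 4"
  proof -
    \<comment> \<open>any \<open>B\<close> with \<open>B (a - m)\<close> above \<open>- ln (r / 4)\<close> works\<close>
    define B where "B = max 1 ((1 - ln (r / 4)) / (a - m))"
    have am: "a - m > 0" using a by (simp add: m_def)
    have "(1 - ln (r / 4)) / (a - m) * (a - m) \<le> B * (a - m)" using am by (intro mult_right_mono) (auto simp: B_def)
    then have "- B * (a - m) < ln (r / 4)" using am by simp
    then have "exp (- B * (a - m)) < exp (ln (r / 4))" by simp
    then show ?thesis using r that[of B] by (simp add: B_def)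
  qed
  define s where "s d = measure_pmf.expectation p (\<lambda>x. real x * min (B * real x / real d) 1)" for d :: nat
  have int_s: "integrable p (\<lambda>x. real x * min (B * real x / real d) 1)" for d :: nat
    using int by (rule Bochner_Integration.integrable_bound) (auto intro!: AE_I2 simp: abs_mult B less_imp_le mult_left_le abs_of_nonneg)
  have "s \<longlonglongrightarrow> measure_pmf.expectation p (\<lambda>x. 0)"
    unfolding s_def
  proof (rule integral_dominated_convergence[where w = real])
    show "AE x in p. (\<lambda>d. real x * min (B * real x / real d) 1) \<longlonglongrightarrow> 0"
    proof (rule AE_I2)
      fix x
      have "(\<lambda>d. real x * min (B * real x / real d) 1) \<longlonglongrightarrow> real x * min 0 1"
        by (intro tendsto_intros real_tendsto_divide_at_top filterlim_real_sequentially)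
      then show "(\<lambda>d. real x * min (B * real x / real d) 1) \<longlonglongrightarrow> 0" by simp
    qed
    show "AE x in p. norm (real x * min (B * real x / real d) 1) \<le> real x" for d
      using B by (auto intro!: AE_I2 simp: abs_mult mult_left_le abs_of_nonneg)
  qed (use int in auto)
  then have s0: "s \<longlonglongrightarrow> 0" by simp
  have bound: "measure_pmf.prob (replicate_pmf d p) {xs. real (sum_list xs) \<ge> a * real d}
      \<le> B * s d + exp (- B * (a - m) + B * s d)" if d: "d > 0" for d
  proof -
    define h where "h = B / real d"
    have h: "h > 0" "h * real d = B" using B d by (auto simp: h_def)
    have sd: "s d = measure_pmf.expectation p (\<lambda>x. real x * min (h * real x) 1)"
      by (simp add: s_def h_def)
    have sd0: "s d \<ge> 0" unfolding sd using h by (intro Bochner_Integration.integral_nonneg) auto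
    have i2: "integrable p (\<lambda>x. real x * min (h * real x) 1)" using int_s[of d] by (simp add: h_def)
    have tail: "real d * measure_pmf.prob p {x. real x > 1 / h} \<le> B * s d"
    proof -
      have "measure_pmf.prob p {x. real x > 1 / h} = measure_pmf.expectation p (indicator {x. real x > 1 / h})"
        by simp
      also have "\<dots> \<le> measure_pmf.expectation p (\<lambda>x. h * (real x * min (h * real x) 1))"
      proof (intro integral_mono)
        fix x :: nat
        show "indicator {x. real x > 1 / h} x \<le> h * (real x * min (h * real x) 1)"
          using h by (auto simp: indicator_def field_simps)
        show "integrable p (indicator {x. real x > 1 / h} :: nat \<Rightarrow> real)"
          by (rule measure_pmf.integrable_const_bound[where B = 1]) auto
      qed (use i2 in auto)
      also have "\<dots> = h * s d" by (simp add: sd)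
      finally have "real d * measure_pmf.prob p {x. real x > 1 / h} \<le> real d * (h * s d)"
        by (intro mult_left_mono) auto
      then show ?thesis using h by (simp add: mult.assoc[symmetric] mult.commute)
    qed
    have "(\<integral>\<^sup>+x. ennreal (exp (h * real x)) * indicator {x. real x \<le> 1 / h} x \<partial>p)
       \<le> ennreal (exp (h * (m + s d)))"
    proof -
      have "(\<integral>\<^sup>+x. ennreal (exp (h * real x)) * indicator {x. real x \<le> 1 / h} x \<partial>p)
         \<le> (\<integral>\<^sup>+x. ennreal (1 + h * real x + h * (real x * min (h * real x) 1)) \<partial>p)"
      proof (intro nn_integral_mono)
        fix x :: nat
        show "ennreal (exp (h * real x)) * indicator {x. real x \<le> 1 / h} x
           \<le> ennreal (1 + h * real x + h * (real x * min (h * real x) 1))"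
        proof (cases "real x \<le> 1 / h")
          case True
          then have y: "0 \<le> h * real x" "h * real x \<le> 1" using h by (auto simp: field_simps)
          have "exp (h * real x) \<le> 1 + h * real x + (h * real x)\<^sup>2" using exp_bound[OF y] .
          also have "\<dots> = 1 + h * real x + h * (real x * min (h * real x) 1)"
            using y by (simp add: power2_eq_square min_absorb1 mult_ac)
          finally show ?thesis by (auto simp: indicator_def intro!: ennreal_leI)
        qed simp
      qed
      also have "\<dots> = ennreal (measure_pmf.expectation p (\<lambda>x. 1 + h * real x + h * (real x * min (h * real x) 1)))"
        using int i2 h by (intro nn_integral_eq_integral) auto
      also have "measure_pmf.expectation p (\<lambda>x. 1 + h * real x + h * (real x * min (h * real x) 1)) = 1 + h * m + h * s d"
        using int i2 by (simp add: sd m_def)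
      also have "ennreal (1 + h * m + h * s d) \<le> ennreal (exp (h * (m + s d)))"
        using exp_ge_add_one_self[of "h * (m + s d)"] by (intro ennreal_leI) (simp add: algebra_simps)
      finally show ?thesis .
    qed
    then have "(\<integral>\<^sup>+x. ennreal (exp (h * real x)) * indicator {x. real x \<le> 1 / h} x \<partial>p) ^ d
        \<le> ennreal (exp (h * (m + s d))) ^ d" by (rule power_mono) simp
    also have "ennreal (exp (h * (m + s d))) ^ d = ennreal (exp (B * (m + s d)))"
      using h by (simp add: ennreal_power exp_of_nat_mult[symmetric] mult_ac mult.assoc[symmetric])
    finally have "ennreal (exp (- h * (a * real d))) * (\<integral>\<^sup>+x. ennreal (exp (h * real x)) * indicator {x. real x \<le> 1 / h} x \<partial>p) ^ d
       \<le> ennreal (exp (- h * (a * real d))) * ennreal (exp (B * (m + s d)))"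
      by (intro mult_left_mono) auto
    also have "\<dots> = ennreal (exp (- B * (a - m) + B * s d))"
    proof -
      have e: "- h * (a * real d) + B * (m + s d) = - B * (a - m) + B * s d"
        using h(2) by (simp add: algebra_simps)
      show ?thesis unfolding e[symmetric] exp_add by (simp add: ennreal_mult)
    qed
    finally have "ennreal (exp (- h * (a * real d))) * (\<integral>\<^sup>+x. ennreal (exp (h * real x)) * indicator {x. real x \<le> 1 / h} x \<partial>p) ^ d
       \<le> ennreal (exp (- B * (a - m) + B * s d))" .
    with tail truncated_Chernoff[of h d p "a * real d" "1 / h"] have "ennreal (measure_pmf.prob (replicate_pmf d p) {xs. real (sum_list xs) \<ge> a * real d})
       \<le> ennreal (B * s d) + ennreal (exp (- B * (a - m) + B * s d))"
      using h by (meson add_mono ennreal_leI order_trans less_imp_le)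
    also have "\<dots> = ennreal (B * s d + exp (- B * (a - m) + B * s d))"
      using B sd0 by (intro ennreal_plus[symmetric]) auto
    finally show ?thesis using B sd0 by (subst (asm) ennreal_le_iff) (auto intro!: add_nonneg_nonneg)
  qed
  have "(\<lambda>d. B * s d + exp (- B * (a - m) + B * s d)) \<longlonglongrightarrow> B * 0 + exp (- B * (a - m) + B * 0)"
    by (intro tendsto_intros s0)
  moreover have "B * 0 + exp (- B * (a - m) + B * 0) < r"
  proof -
    have "exp (- B * (a - m)) < r" using B(2) r by linarith
    then show ?thesis by simp
  qed
  ultimately have "\<forall>\<^sub>F d in sequentially. B * s d + exp (- B * (a - m) + B * s d) < r"
    by (rule order_tendstoD(2))
  then have "\<forall>\<^sub>F d in sequentially. norm (measure_pmf.prob (replicate_pmf d p) {xs. real (sum_list xs) \<ge> a * real d} - 0) < r"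
    using eventually_gt_at_top[of 0] by eventually_elim (use bound in \<open>auto intro: le_less_trans\<close>)
  then show "\<exists>no. \<forall>n\<ge>no. norm (measure_pmf.prob (replicate_pmf n p) {xs. real (sum_list xs) \<ge> a * real n} - 0) < r"
    by (simp add: eventually_at_top_linorder)
qed

text \<open>The bounded variables \<open>K - min x K\<close> turn the lower tail into an upper tail.\<close>

lemma weak_law_lower:
  fixes p :: "nat pmf"
  assumes int: "integrable p real" and a: "a < measure_pmf.expectation p real"
  shows "(\<lambda>d. measure_pmf.prob (replicate_pmf d p) {xs. real (sum_list xs) \<le> a * real d}) \<longlonglongrightarrow> 0"
proof -
  have "(\<lambda>K. measure_pmf.expectation p (\<lambda>x. real (min x K))) \<longlonglongrightarrow> measure_pmf.expectation p real"
  proof (rule integral_dominated_convergence[where w = real])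
    show "AE x in p. (\<lambda>K. real (min x K)) \<longlonglongrightarrow> real x"
    proof (rule AE_I2)
      fix x
      have "\<forall>\<^sub>F K in sequentially. real (min x K) = real x"
        using eventually_ge_at_top[of x] by eventually_elim simp
      then show "(\<lambda>K. real (min x K)) \<longlonglongrightarrow> real x" by (rule tendsto_eventually)
    qed
  qed (use int in auto)
  from order_tendstoD(1)[OF this a] obtain K where K: "measure_pmf.expectation p (\<lambda>x. real (min x K)) > a"
    by (auto simp: eventually_at_top_linorder)
  define q where "q = map_pmf (\<lambda>x. K - min x K) p"
  have intK: "integrable p (\<lambda>x. real (min x K))"
    by (rule measure_pmf.integrable_const_bound[where B = "real K"]) auto
  have iq: "integrable q real"
    unfolding q_def integrable_map_pmf_eq
    by (rule measure_pmf.integrable_const_bound[where B = "real K"]) (auto simp: q_def)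
  have "measure_pmf.expectation q real = measure_pmf.expectation p (\<lambda>x. real K - real (min x K))"
    unfolding q_def by (auto intro!: Bochner_Integration.integral_cong simp: of_nat_diff)
  also have "\<dots> = real K - measure_pmf.expectation p (\<lambda>x. real (min x K))" using intK by simp
  finally have "real K - a > measure_pmf.expectation q real" using K by simp
  from weak_law_upper[OF iq this]
  have lim: "(\<lambda>d. measure_pmf.prob (replicate_pmf d q) {xs. real (sum_list xs) \<ge> (real K - a) * real d}) \<longlonglongrightarrow> 0" .
  have key: "real K * real (length xs) \<le> real (sum_list xs) + real (sum_list (map (\<lambda>x. K - min x K) xs))" for xs
  proof (induction xs)
    case (Cons x xs)
    have "K \<le> x + (K - min x K)" by simp
    then have "real K \<le> real x + real (K - min x K)" by linarith
    with Cons show ?case by (simp add: algebra_simps)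
  qed simp
  have le: "measure_pmf.prob (replicate_pmf d p) {xs. real (sum_list xs) \<le> a * real d}
     \<le> measure_pmf.prob (replicate_pmf d q) {xs. real (sum_list xs) \<ge> (real K - a) * real d}" for d
    unfolding q_def replicate_map_pmf measure_map_pmf
  proof (rule measure_pmf.finite_measure_mono_AE)
    show "AE xs in replicate_pmf d p. xs \<in> {xs. real (sum_list xs) \<le> a * real d} \<longrightarrow>
       xs \<in> map (\<lambda>x. K - min x K) -` {xs. (real K - a) * real d \<le> real (sum_list xs)}"
      unfolding AE_measure_pmf_iff
    proof (intro ballI impI)
      fix xs assume xs: "xs \<in> set_pmf (replicate_pmf d p)" "xs \<in> {xs. real (sum_list xs) \<le> a * real d}"
      show "xs \<in> map (\<lambda>x. K - min x K) -` {xs. (real K - a) * real d \<le> real (sum_list xs)}"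
        using key[of xs] xs length_replicate_pmf[OF xs(1)] by (auto simp: algebra_simps)
    qed
  qed auto
  show ?thesis
    by (rule tendsto_sandwich[OF _ _ tendsto_const lim]) (use le in auto)
qed

section \<open>Cutting and grafting plane trees\<close>

lemma vertices_Node: "vertices (Node ts) = insert [] (\<Union>i<length ts. (#) i ` vertices (ts ! i))"
proof (rule set_eqI)
  fix u show "u \<in> vertices (Node ts) \<longleftrightarrow> u \<in> insert [] (\<Union>i<length ts. (#) i ` vertices (ts ! i))"
    by (cases u) (auto simp: vertices_def)
qed

lemma finite_vertices [simp]: "finite (vertices T)"
  by (induction T) (auto simp: vertices_Node)

lemma Nil_in_vertices [simp]: "[] \<in> vertices T"
  by (simp add: vertices_def)

lemma vertices_nonempty [simp]: "vertices T \<noteq> {}"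
  using Nil_in_vertices[of T] by blast

text \<open>Additivity of vertex counts over the subtrees at the root; since the number of vertices and bounds on
  the maximal outdegree are instances of \<open>L\<close>, most facts about trees below reduce to it.\<close>

lemma L_Node: "L \<Omega> (Node ts) = of_bool (length ts \<in> \<Omega>) + sum_list (map (L \<Omega>) ts)"
proof -
  let ?S = "\<lambda>T. {u \<in> vertices T. outdeg T u \<in> \<Omega>}"
  have eq: "?S (Node ts) = (if length ts \<in> \<Omega> then {[]} else {}) \<union> (\<Union>i\<in>{..<length ts}. (#) i ` ?S (ts ! i))"
    by (auto simp: vertices_Node outdeg_def)
  have fin: "finite (\<Union>i\<in>{..<length ts}. (#) i ` ?S (ts ! i))" by simp
  have "card (\<Union>i\<in>{..<length ts}. (#) i ` ?S (ts ! i)) = (\<Sum>i<length ts. card ((#) i ` ?S (ts ! i)))"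
    by (rule card_UN_disjoint) auto
  also have "\<dots> = (\<Sum>i<length ts. L \<Omega> (ts ! i))"
    unfolding L_def by (intro sum.cong refl card_image) auto
  also have "\<dots> = sum_list (map (L \<Omega>) ts)"
    by (simp add: sum_list_sum_nth atLeast0LessThan)
  finally have "card (\<Union>i\<in>{..<length ts}. (#) i ` ?S (ts ! i)) = sum_list (map (L \<Omega>) ts)" .
  then show ?thesis
    unfolding L_def[of _ "Node ts"] eq
    by (subst card_Un_disjoint) (use fin in auto)
qed

lemma num_vertices_eq_L: "num_vertices T = L UNIV T"
  by (simp add: num_vertices_def L_def)

lemma L_eq_0_iff: "L \<Omega> T = 0 \<longleftrightarrow> (\<forall>u\<in>vertices T. outdeg T u \<notin> \<Omega>)"
  unfolding L_def by (subst card_0_eq) auto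

lemma max_outdeg_le_iff: "max_outdeg T \<le> M \<longleftrightarrow> (\<forall>u\<in>vertices T. outdeg T u \<le> M)"
  unfolding max_outdeg_def by (subst Max_le_iff) auto

text \<open>Bounds on the maximal outdegree are expressed as vanishing vertex counts, to which the additivity
  of \<open>L\<close> applies.\<close>

lemma max_outdeg_less_iff: "max_outdeg T < d \<longleftrightarrow> L {d..} T = 0"
  unfolding max_outdeg_def L_eq_0_iff
  by (subst Max_less_iff) (auto simp: not_le)

lemma max_outdeg_Node_le: "max_outdeg (Node ts) \<le> M \<longleftrightarrow> length ts \<le> M \<and> (\<forall>t\<in>set ts. max_outdeg t \<le> M)"
proof -
  have "max_outdeg (Node ts) \<le> M \<longleftrightarrow> L {Suc M..} (Node ts) = 0"
    by (simp add: max_outdeg_less_iff[symmetric] less_Suc_eq_le)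
  also have "\<dots> \<longleftrightarrow> length ts \<le> M \<and> (\<forall>t\<in>set ts. L {Suc M..} t = 0)"
    by (auto simp: L_Node not_le Suc_le_eq)
  also have "\<dots> \<longleftrightarrow> length ts \<le> M \<and> (\<forall>t\<in>set ts. max_outdeg t \<le> M)"
    by (simp add: max_outdeg_less_iff[symmetric] less_Suc_eq_le)
  finally show ?thesis .
qed

lemma first_max: "first_max T \<in> vertices T" "outdeg T (first_max T) = max_outdeg T"
proof -
  have "max_outdeg T \<in> outdeg T ` vertices T"
    unfolding max_outdeg_def by (rule Max_in) auto
  then have "{u \<in> vertices T. outdeg T u = max_outdeg T} \<noteq> {}" by auto
  from Min_in[OF _ this] show "first_max T \<in> vertices T" "outdeg T (first_max T) = max_outdeg T"
    by (auto simp: first_max_def)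
qed

lemma length_Fs: "length (Fs T) = max_outdeg T"
  using first_max(2)[of T] by (simp add: Fs_def outdeg_def)

text \<open>The inverse of cutting: the vertex at the given address receives a new list of children.\<close>

primrec graft :: "nat list \<Rightarrow> ptree \<Rightarrow> ptree list \<Rightarrow> ptree" where
  "graft [] T ts = Node ts"
| "graft (i # v) T ts = Node ((children T)[i := graft v (children T ! i) ts])"

definition marked_leaf :: "nat list \<Rightarrow> ptree \<Rightarrow> bool" where
  "marked_leaf v T \<longleftrightarrow> is_vertex v T \<and> outdeg T v = 0"

lemma marked_leaf_Nil: "marked_leaf [] T \<longleftrightarrow> T = Node []"
  by (cases T) (auto simp: marked_leaf_def outdeg_def)

lemma marked_leaf_Cons: "marked_leaf (i # v) T \<longleftrightarrow> i < length (children T) \<and> marked_leaf v (children T ! i)"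
  by (auto simp: marked_leaf_def outdeg_def)

lemma graft_cut: "is_vertex v T \<Longrightarrow> graft v (cut v T) (children (fringe v T)) = T"
  by (induction v arbitrary: T) auto

lemma marked_leaf_cut: "is_vertex v T \<Longrightarrow> marked_leaf v (cut v T)"
  by (induction v arbitrary: T) (auto simp: marked_leaf_Nil marked_leaf_Cons)

lemma cut_graft: "marked_leaf v T \<Longrightarrow> cut v (graft v T ts) = T"
  by (induction v arbitrary: T) (auto simp: marked_leaf_Nil marked_leaf_Cons)

lemma fringe_graft: "marked_leaf v T \<Longrightarrow> fringe v (graft v T ts) = Node ts"
  by (induction v arbitrary: T) (auto simp: marked_leaf_Nil marked_leaf_Cons)

lemma is_vertex_graft: "marked_leaf v T \<Longrightarrow> is_vertex v (graft v T ts)"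
  by (induction v arbitrary: T) (auto simp: marked_leaf_Nil marked_leaf_Cons)

lemma graft_F0_Fs: "graft (snd (F0 T)) (fst (F0 T)) (Fs T) = T"
  using first_max(1)[of T] by (simp add: F0_def Fs_def graft_cut vertices_def)

lemma marked_leaf_F0: "marked_leaf (snd (F0 T)) (fst (F0 T))"
  using first_max(1)[of T] by (simp add: F0_def marked_leaf_cut vertices_def)

lemma sum_list_map_update:
  fixes f :: "'a \<Rightarrow> nat"
  assumes "i < length ts"
  shows "sum_list (map f (ts[i := x])) + f (ts ! i) = sum_list (map f ts) + f x"
proof -
  have "sum_list (map f ts) = sum_list (map f (take i ts @ ts ! i # drop (Suc i) ts))"
    by (rule arg_cong[OF id_take_nth_drop[OF assms]])
  then show ?thesis using assms by (simp add: upd_conv_take_nth_drop)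
qed

lemma L_graft:
  "marked_leaf v T \<Longrightarrow> L \<Omega> (graft v T ts) + of_bool (0 \<in> \<Omega>) = L \<Omega> T + of_bool (length ts \<in> \<Omega>) + sum_list (map (L \<Omega>) ts)"
proof (induction v arbitrary: T)
  case Nil
  then show ?case by (auto simp: marked_leaf_Nil L_Node)
next
  case (Cons i v)
  then have i: "i < length (children T)" "marked_leaf v (children T ! i)" by (auto simp: marked_leaf_Cons)
  obtain ss where T: "T = Node ss" by (cases T)
  from Cons.IH[OF i(2)] sum_list_map_update[of i ss "L \<Omega>" "graft v (ss ! i) ts"] i
  show ?case by (simp add: T L_Node)
qed

text \<open>Counting the vertices of outdegree at least \<open>length ts\<close> gives exactly one, so the grafted vertex is the
  only vertex of maximal outdegree and the decomposition recovers the data.\<close>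

lemma graft_maximal:
  assumes v: "marked_leaf v T" and T: "max_outdeg T < length ts" and ts: "\<forall>t\<in>set ts. max_outdeg t < length ts"
  shows "max_outdeg (graft v T ts) = length ts" "F0 (graft v T ts) = (T, v)" "Fs (graft v T ts) = ts"
proof -
  define d where "d = length ts"
  define G where "G = graft v T ts"
  have d: "d > 0" using T by (auto simp: d_def)
  have "sum_list (map (L {d..}) ts) = 0"
    using ts by (auto simp: max_outdeg_less_iff d_def)
  then have "L {d..} G = 1"
    using L_graft[OF v, of "{d..}" ts] T d by (auto simp: d_def G_def max_outdeg_less_iff)
  then have c: "card {u \<in> vertices G. outdeg G u \<in> {d..}} = 1" by (simp add: L_def)
  have vG: "v \<in> vertices G" "outdeg G v = d"
    using is_vertex_graft[OF v] fringe_graft[OF v] by (auto simp: vertices_def outdeg_def G_def d_def)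
  have S: "{u \<in> vertices G. outdeg G u \<in> {d..}} = {v}"
  proof -
    obtain x where x: "{u \<in> vertices G. outdeg G u \<in> {d..}} = {x}" using c by (rule card_1_singletonE)
    have "v \<in> {u \<in> vertices G. outdeg G u \<in> {d..}}" using vG by simp
    then have "v = x" unfolding x by simp
    then show ?thesis using x by simp
  qed
  have m: "max_outdeg G = d"
  proof (rule antisym)
    show "max_outdeg G \<le> d" unfolding max_outdeg_le_iff
    proof
      fix u assume u: "u \<in> vertices G"
      show "outdeg G u \<le> d"
      proof (cases "outdeg G u \<ge> d")
        case True
        then have "u \<in> {u \<in> vertices G. outdeg G u \<in> {d..}}" using u by simp
        then show ?thesis unfolding S using vG by simp
      qed simp
    qed
    show "d \<le> max_outdeg G" using vG max_outdeg_le_iff[of G "max_outdeg G"] by auto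
  qed
  then show "max_outdeg (graft v T ts) = length ts" by (simp add: G_def d_def)
  have "{u \<in> vertices G. outdeg G u = max_outdeg G} = {v}"
  proof (rule equalityI)
    have "{u \<in> vertices G. outdeg G u = max_outdeg G} \<subseteq> {u \<in> vertices G. outdeg G u \<in> {d..}}"
      unfolding m by auto
    then show "{u \<in> vertices G. outdeg G u = max_outdeg G} \<subseteq> {v}" unfolding S .
  qed (use vG m in auto)
  then have f: "first_max G = v" by (simp add: first_max_def)
  show "F0 (graft v T ts) = (T, v)" using f v by (simp add: F0_def cut_graft G_def)
  show "Fs (graft v T ts) = ts" using f v by (simp add: Fs_def fringe_graft G_def)
qed

lemma sum_F_size:
  assumes "1 \<le> m" "m \<le> max_outdeg T"
  shows "(\<Sum>i=m..max_outdeg T. F_size i T) = sum_list (map num_vertices (drop (m - 1) (Fs T)))"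
proof -
  have "(\<Sum>i=m..max_outdeg T. F_size i T) = (\<Sum>i\<in>{m - 1..<max_outdeg T}. num_vertices (Fs T ! i))"
    using assms by (intro sum.reindex_bij_witness[of _ Suc "\<lambda>i. i - 1"]) (auto simp: F_size_def)
  also have "\<dots> = (\<Sum>i\<in>{0..<max_outdeg T - (m - 1)}. num_vertices (Fs T ! (m - 1 + i)))"
    using assms by (intro sum.reindex_bij_witness[of _ "\<lambda>i. m - 1 + i" "\<lambda>i. i - (m - 1)"]) auto
  also have "\<dots> = sum_list (map num_vertices (drop (m - 1) (Fs T)))"
    using assms by (simp add: sum_list_sum_nth length_Fs)
  finally show ?thesis .
qed

section \<open>The Galton--Watson tree and the marked tree\<close>

lemma pmf_bind_single:
  assumes "\<And>x. x \<in> set_pmf M \<Longrightarrow> x \<noteq> x0 \<Longrightarrow> pmf (f x) y = 0"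
  shows "pmf (bind_pmf M f) y = pmf M x0 * pmf (f x0) y"
proof -
  have "pmf (bind_pmf M f) y = measure_pmf.expectation M (\<lambda>x. indicator {x0} x * pmf (f x0) y)"
    unfolding pmf_bind using assms
    by (intro integral_cong_AE) (auto simp: AE_measure_pmf_iff indicator_def)
  then show ?thesis by (simp add: measure_pmf_single)
qed

lemma pmf_map_single:
  assumes "h x0 = y" "\<And>x. x \<in> set_pmf M \<Longrightarrow> h x = y \<Longrightarrow> x = x0"
  shows "pmf (map_pmf h M) y = pmf M x0"
proof -
  have "pmf (map_pmf h M) y = measure M (h -` {y})" by (simp add: pmf_map)
  also have "\<dots> = measure M {x0}"
    using assms by (intro measure_pmf.finite_measure_eq_AE) (auto simp: AE_measure_pmf_iff)
  finally show ?thesis by (simp add: measure_pmf_single)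
qed

lemma iid_spmf_of_pmf: "iid_spmf k (spmf_of_pmf p) = spmf_of_pmf (replicate_pmf k p)"
proof (induction k)
  case (Suc k)
  show ?case
    unfolding iid_spmf.simps Suc replicate_pmf_Suc_pair
    by (simp add: pair_pmf_def map_bind_pmf spmf_of_pmf_bind map_pmf_comp map_pmf_def[symmetric] bind_map_pmf)
qed simp

lemma pmf_replicate_pmf: "pmf (replicate_pmf k p) xs = (if length xs = k then prod_list (map (pmf p) xs) else 0)"
proof (induction k arbitrary: xs)
  case 0
  show ?case by (auto simp: pmf_return)
next
  case (Suc k)
  show ?case
  proof (cases xs)
    case Nil
    then show ?thesis
      using pmf_eq_0_set_pmf[of "replicate_pmf (Suc k) p" xs] by (auto simp: set_replicate_pmf)
  next
    case (Cons y ys)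
    have "pmf (replicate_pmf (Suc k) p) xs = pmf (pair_pmf p (replicate_pmf k p)) (y, ys)"
      unfolding replicate_pmf_Suc_pair Cons by (rule pmf_map_single) auto
    then show ?thesis using Suc[of ys] by (simp add: pmf_pair Cons)
  qed
qed

locale subcritical =
  fixes \<xi> :: "nat pmf"
  assumes integrable_\<xi>: "integrable \<xi> real" and mean_less_1: "mean \<xi> < 1"
begin

text \<open>In the subcritical case both random trees are almost surely finite, hence honest probability mass functions.\<close>

definition gw :: "ptree pmf" where "gw = (SOME p. GW \<xi> = spmf_of_pmf p)"
definition bullet :: "mtree pmf" where "bullet = (SOME p. GW_bullet \<xi> = spmf_of_pmf p)"

lemma GW_eq: "GW \<xi> = spmf_of_pmf gw"
  unfolding gw_def using lossless_GW[OF integrable_\<xi> mean_less_1]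
  by (auto simp: lossless_spmf_conv_spmf_of_pmf intro: someI)

lemma GW_bullet_eq: "GW_bullet \<xi> = spmf_of_pmf bullet"
  unfolding bullet_def using lossless_GW_bullet[OF integrable_\<xi> mean_less_1]
  by (auto simp: lossless_spmf_conv_spmf_of_pmf intro: someI)

lemma spmf_of_pmf_inject: "spmf_of_pmf p = spmf_of_pmf q \<Longrightarrow> p = q"
  by (rule pmf_eqI) (metis spmf_spmf_of_pmf)

lemma gw_unfold: "gw = bind_pmf \<xi> (\<lambda>k. map_pmf Node (replicate_pmf k gw))"
proof (rule spmf_of_pmf_inject)
  have "spmf_of_pmf gw = bind_pmf \<xi> (\<lambda>k. map_spmf Node (iid_spmf k (GW \<xi>)))"
    using GW.simps[of \<xi>] unfolding GW_eq .
  also have "\<dots> = spmf_of_pmf (bind_pmf \<xi> (\<lambda>k. map_pmf Node (replicate_pmf k gw)))"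
    by (simp add: GW_eq iid_spmf_of_pmf spmf_of_pmf_bind)
  finally show "spmf_of_pmf gw = spmf_of_pmf (bind_pmf \<xi> (\<lambda>k. map_pmf Node (replicate_pmf k gw)))" .
qed

lemma nn_integral_gw: "(\<integral>\<^sup>+T. F T \<partial>gw) = (\<integral>\<^sup>+k. \<integral>\<^sup>+ts. F (Node ts) \<partial>replicate_pmf k gw \<partial>\<xi>)"
proof -
  have "(\<integral>\<^sup>+T. F T \<partial>gw) = (\<integral>\<^sup>+T. F T \<partial>bind_pmf \<xi> (\<lambda>k. map_pmf Node (replicate_pmf k gw)))"
    by (simp only: gw_unfold[symmetric])
  then show ?thesis by simp
qed

lemma pmf_gw_Node: "pmf gw (Node ts) = pmf \<xi> (length ts) * prod_list (map (pmf gw) ts)"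
proof -
  have "pmf gw (Node ts) = pmf (bind_pmf \<xi> (\<lambda>k. map_pmf Node (replicate_pmf k gw))) (Node ts)"
    by (simp only: gw_unfold[symmetric])
  also have "\<dots> = pmf \<xi> (length ts) * pmf (map_pmf Node (replicate_pmf (length ts) gw)) (Node ts)"
    by (rule pmf_bind_single) (auto simp: pmf_eq_0_set_pmf set_replicate_pmf)
  also have "pmf (map_pmf Node (replicate_pmf (length ts) gw)) (Node ts) = pmf (replicate_pmf (length ts) gw) ts"
    by (rule pmf_map_single) auto
  finally show ?thesis by (simp add: pmf_replicate_pmf)
qed

text \<open>One step of the construction of the marked tree, conditionally on the modified offspring number.\<close>

definition bullet_step :: "enat \<Rightarrow> mtree pmf" where
  "bullet_step x = (if x = \<infinity> then return_pmf (Node [], [])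
     else bind_pmf (pmf_of_set {..<the_enat x}) (\<lambda>j.
       map_pmf (\<lambda>(ts, s, v). (Node (take j ts @ s # drop j ts), j # v))
         (pair_pmf (replicate_pmf (the_enat x - 1) gw) bullet)))"

lemma xi_hat_pos: "x \<in> set_pmf (xi_hat \<xi>) \<Longrightarrow> x \<noteq> \<infinity> \<Longrightarrow> the_enat x > 0"
  using pmf_xi_hat(1)[of \<xi> 0] integrable_\<xi> mean_less_1
  by (cases x) (auto simp: set_pmf_iff intro!: Nat.gr0I)

lemma bul_unfold: "bullet = bind_pmf (xi_hat \<xi>) bullet_step"
proof (rule spmf_of_pmf_inject)
  have "spmf_of_pmf bullet = bind_pmf (xi_hat \<xi>) (\<lambda>x.
     if x = \<infinity> then return_spmf (Node [], [])
     else bind_spmf (spmf_of_set {..<the_enat x}) (\<lambda>j.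
       bind_spmf (iid_spmf (the_enat x - 1) (GW \<xi>)) (\<lambda>ts.
         map_spmf (\<lambda>(s, v). (Node (take j ts @ s # drop j ts), j # v)) (GW_bullet \<xi>))))"
    using GW_bullet.simps[of \<xi>] unfolding GW_bullet_eq .
  also have "\<dots> = bind_pmf (xi_hat \<xi>) (\<lambda>x. spmf_of_pmf (bullet_step x))"
  proof (rule bind_pmf_cong[OF refl])
    fix x assume x: "x \<in> set_pmf (xi_hat \<xi>)"
    show "(if x = \<infinity> then return_spmf (Node [], [])
     else bind_spmf (spmf_of_set {..<the_enat x}) (\<lambda>j.
       bind_spmf (iid_spmf (the_enat x - 1) (GW \<xi>)) (\<lambda>ts.
         map_spmf (\<lambda>(s, v). (Node (take j ts @ s # drop j ts), j # v)) (GW_bullet \<xi>)))) = spmf_of_pmf (bullet_step x)"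
    proof (cases "x = \<infinity>")
      case False
      from xi_hat_pos[OF x False] have ne: "{..<the_enat x} \<noteq> {}" by auto
      have e: "spmf_of_set {..<the_enat x} = spmf_of_pmf (pmf_of_set {..<the_enat x})"
        using ne by simp
      have sp: "map_pmf (\<lambda>(ts, s, v). F ts s v) (pair_pmf P Q) = bind_pmf P (\<lambda>ts. map_pmf (\<lambda>(s, v). F ts s v) Q)"
        for F :: "ptree list \<Rightarrow> ptree \<Rightarrow> nat list \<Rightarrow> mtree" and P Q
        by (simp add: pair_pmf_def map_pmf_def bind_assoc_pmf bind_return_pmf case_prod_unfold)
      show ?thesis using False
        unfolding bullet_step_def sp e GW_eq iid_spmf_of_pmf GW_bullet_eq bind_spmf_of_pmf map_spmf_of_pmf
        by (simp only: spmf_of_pmf_bind if_False)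
    qed (simp add: bullet_step_def)
  qed
  also have "\<dots> = spmf_of_pmf (bind_pmf (xi_hat \<xi>) bullet_step)"
    by (simp add: spmf_of_pmf_bind)
  finally show "spmf_of_pmf bullet = spmf_of_pmf (bind_pmf (xi_hat \<xi>) bullet_step)" .
qed

lemma set_bullet_step:
  assumes "z \<in> set_pmf (bullet_step x)" "the_enat x > 0 \<or> x = \<infinity>"
  shows "x = \<infinity> \<and> z = (Node [], []) \<or>
    (\<exists>j ts s v. x \<noteq> \<infinity> \<and> j \<le> length ts \<and> the_enat x = Suc (length ts) \<and> (s, v) \<in> set_pmf bullet \<and>
       z = (Node (take j ts @ s # drop j ts), j # v))"
proof (cases "x = \<infinity>")
  case False
  then have ne: "{..<the_enat x} \<noteq> {}" using assms by auto
  from assms(1) False ne obtain j ts s v where *: "j < the_enat x" "ts \<in> set_pmf (replicate_pmf (the_enat x - 1) gw)"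
      "(s, v) \<in> set_pmf bullet" "z = (Node (take j ts @ s # drop j ts), j # v)"
    by (auto simp: bullet_step_def)
  from length_replicate_pmf[OF *(2)] *(1) have "the_enat x = Suc (length ts)" "j \<le> length ts" by auto
  with * False show ?thesis by blast
qed (use assms in \<open>auto simp: bullet_step_def\<close>)

lemma set_bul_marked_leaf: "(T, v) \<in> set_pmf bullet \<Longrightarrow> marked_leaf v T"
proof (induction v arbitrary: T)
  case Nil
  then obtain x where x: "x \<in> set_pmf (xi_hat \<xi>)" "(T, []) \<in> set_pmf (bullet_step x)"
    by (subst (asm) bul_unfold) auto
  with set_bullet_step[OF x(2)] xi_hat_pos[OF x(1)] show ?case by (auto simp: marked_leaf_Nil)
next
  case (Cons i v)
  then obtain x where x: "x \<in> set_pmf (xi_hat \<xi>)" "(T, i # v) \<in> set_pmf (bullet_step x)"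
    by (subst (asm) bul_unfold) auto
  with set_bullet_step[OF x(2)] xi_hat_pos[OF x(1)]
  obtain ts s where "i \<le> length ts" "(s, v) \<in> set_pmf bullet" "T = Node (take i ts @ s # drop i ts)" by auto
  with Cons.IH[of s] show ?case by (auto simp: marked_leaf_Cons nth_append)
qed

lemma pmf_bul_Nil: "pmf bullet (Node [], []) = 1 - mean \<xi>"
proof -
  have "pmf bullet (Node [], []) = pmf (bind_pmf (xi_hat \<xi>) bullet_step) (Node [], [])"
    by (simp only: bul_unfold[symmetric])
  also have "\<dots> = pmf (xi_hat \<xi>) \<infinity> * pmf (bullet_step \<infinity>) (Node [], [])"
    using set_bullet_step xi_hat_pos by (intro pmf_bind_single) (fastforce simp: pmf_eq_0_set_pmf)
  finally show ?thesis
    using pmf_xi_hat(2)[of \<xi>] integrable_\<xi> mean_less_1 by (simp add: bullet_step_def)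
qed

text \<open>The size-biasing factor \<open>k\<close> of the modified offspring law cancels against the uniform choice of the
  special child, which leaves the plain offspring probability.\<close>

lemma pmf_bul_Cons:
  assumes i: "i < length ss"
  shows "pmf bullet (Node ss, i # v) =
    pmf \<xi> (length ss) * prod_list (map (pmf gw) (take i ss @ drop (Suc i) ss)) * pmf bullet (ss ! i, v)"
proof -
  define k where "k = length ss"
  define ts0 where "ts0 = take i ss @ drop (Suc i) ss"
  have k: "k > 0" "i < k" using i by (auto simp: k_def)
  have ts0: "length ts0 = k - 1" "take i ts0 @ ss ! i # drop i ts0 = ss"
    using i by (auto simp: ts0_def k_def id_take_nth_drop[symmetric] min_def)
  have "pmf bullet (Node ss, i # v) = pmf (bind_pmf (xi_hat \<xi>) bullet_step) (Node ss, i # v)"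
    by (simp only: bul_unfold[symmetric])
  also have "\<dots> = pmf (xi_hat \<xi>) (enat k) * pmf (bullet_step (enat k)) (Node ss, i # v)"
  proof (rule pmf_bind_single)
    fix x assume x: "x \<in> set_pmf (xi_hat \<xi>)" "x \<noteq> enat k"
    show "pmf (bullet_step x) (Node ss, i # v) = 0"
    proof (rule ccontr)
      assume "pmf (bullet_step x) (Node ss, i # v) \<noteq> 0"
      then have "(Node ss, i # v) \<in> set_pmf (bullet_step x)" by (simp add: set_pmf_iff)
      from set_bullet_step[OF this] xi_hat_pos[OF x(1)] x(2) show False
        by (cases x) (auto simp: k_def min_def split: if_splits)
    qed
  qed
  also have "pmf (xi_hat \<xi>) (enat k) = real k * pmf \<xi> k"
    using integrable_\<xi> mean_less_1 by (intro pmf_xi_hat) auto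
  also have "pmf (bullet_step (enat k)) (Node ss, i # v)
     = pmf (pmf_of_set {..<k}) i * pmf (map_pmf (\<lambda>(ts, s, v). (Node (take i ts @ s # drop i ts), i # v))
         (pair_pmf (replicate_pmf (k - 1) gw) bullet)) (Node ss, i # v)"
    unfolding bullet_step_def by (simp, rule pmf_bind_single) (auto simp: pmf_eq_0_set_pmf)
  also have "pmf (map_pmf (\<lambda>(ts, s, v). (Node (take i ts @ s # drop i ts), i # v))
         (pair_pmf (replicate_pmf (k - 1) gw) bullet)) (Node ss, i # v)
     = pmf (pair_pmf (replicate_pmf (k - 1) gw) bullet) (ts0, ss ! i, v)"
  proof (rule pmf_map_single)
    fix z assume z: "z \<in> set_pmf (pair_pmf (replicate_pmf (k - 1) gw) bullet)"
      "(case z of (ts, s, v) \<Rightarrow> (Node (take i ts @ s # drop i ts), i # v)) = (Node ss, i # v)"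
    obtain ts s v' where zz: "z = (ts, s, v')" by (cases z) auto
    have "length ts = k - 1" using z zz length_replicate_pmf by auto
    moreover have "take i ts @ s # drop i ts = ss" "v' = v" using z zz by auto
    ultimately show "z = (ts0, ss ! i, v)"
      using k unfolding zz ts0_def by (auto simp: nth_append min_def)
  qed (use ts0 in auto)
  also have "\<dots> = prod_list (map (pmf gw) ts0) * pmf bullet (ss ! i, v)"
    using ts0 by (simp add: pmf_pair pmf_replicate_pmf)
  also have "pmf (pmf_of_set {..<k}) i = 1 / real k"
    using k by (subst pmf_of_set) auto
  finally show ?thesis using k by (simp add: ts0_def k_def)
qed

text \<open>Along the spine the marked tree has the same weights as the Galton--Watson tree, and the probability
  \<open>1 - mean \<xi>\<close> of stopping stands in place of the offspring probability of the grafted vertex.\<close>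

lemma pmf_gw_graft:
  "marked_leaf v T \<Longrightarrow> pmf gw (graft v T ts) * (1 - mean \<xi>)
     = pmf \<xi> (length ts) * (pmf bullet (T, v) * prod_list (map (pmf gw) ts))"
proof (induction v arbitrary: T)
  case Nil
  then show ?case by (simp add: marked_leaf_Nil pmf_gw_Node pmf_bul_Nil)
next
  case (Cons i v)
  obtain ss where T: "T = Node ss" by (cases T)
  from Cons.prems have i: "i < length ss" "marked_leaf v (ss ! i)" by (auto simp: marked_leaf_Cons T)
  have "pmf gw (graft (i # v) T ts) * (1 - mean \<xi>)
     = pmf \<xi> (length ss) * prod_list (map (pmf gw) (take i ss @ drop (Suc i) ss)) *
        (pmf gw (graft v (ss ! i) ts) * (1 - mean \<xi>))"
  proof -
    let ?G = "graft v (ss ! i) ts"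
    have "pmf gw (graft (i # v) T ts) = pmf \<xi> (length ss) * prod_list (map (pmf gw) (ss[i := ?G]))"
      by (simp add: T pmf_gw_Node)
    also have "prod_list (map (pmf gw) (ss[i := ?G])) = prod_list (map (pmf gw) (take i ss @ drop (Suc i) ss)) * pmf gw ?G"
      using i by (simp add: upd_conv_take_nth_drop)
    finally show ?thesis by simp
  qed
  also have "\<dots> = pmf \<xi> (length ts) * (pmf bullet (T, i # v) * prod_list (map (pmf gw) ts))"
    unfolding Cons.IH[OF i(2)] T pmf_bul_Cons[OF i(1)] by simp
  finally show ?case .
qed

text \<open>Expectations of trees satisfy recursions that only determine them among finite values. Restricted to
  trees with at most \<open>k\<close> vertices they can be bounded by induction on \<open>k\<close>.\<close>

lemma nn_integral_gw_leI:
  fixes \<phi> :: "ptree \<Rightarrow> ennreal"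
  assumes "\<And>k. (\<integral>\<^sup>+T. \<phi> T * indicator {T. num_vertices T \<le> k} T \<partial>gw) \<le> c"
  shows "(\<integral>\<^sup>+T. \<phi> T \<partial>gw) \<le> c"
proof -
  have "(\<integral>\<^sup>+T. \<phi> T \<partial>gw) \<le> (\<integral>\<^sup>+T. (SUP k. \<phi> T * indicator {T. num_vertices T \<le> k} T) \<partial>gw)"
  proof (intro nn_integral_mono)
    fix T
    have "\<phi> T = \<phi> T * indicator {S. num_vertices S \<le> num_vertices T} T" by simp
    also have "\<dots> \<le> (SUP k. \<phi> T * indicator {S. num_vertices S \<le> k} T)"
      by (rule SUP_upper2[of "num_vertices T"]) auto
    finally show "\<phi> T \<le> (SUP k. \<phi> T * indicator {S. num_vertices S \<le> k} T)" .
  qed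
  also have "\<dots> = (SUP k. \<integral>\<^sup>+T. \<phi> T * indicator {T. num_vertices T \<le> k} T \<partial>gw)"
    by (rule nn_integral_monotone_convergence_SUP) (auto simp: incseq_def le_fun_def indicator_def)
  also have "\<dots> \<le> c" by (intro SUP_least assms)
  finally show ?thesis .
qed

lemma num_vertices_Node: "num_vertices (Node ts) = Suc (sum_list (map num_vertices ts))"
  by (simp add: num_vertices_eq_L L_Node cong: map_cong)

lemma num_vertices_child: "num_vertices (Node ts) \<le> Suc k \<Longrightarrow> t \<in> set ts \<Longrightarrow> num_vertices t \<le> k"
  using member_le_sum_list[of "num_vertices t" "map num_vertices ts"] by (simp add: num_vertices_Node)

lemma num_vertices_pos: "num_vertices T > 0"
  by (cases T) (simp add: num_vertices_Node)

lemma nn_integral_replicate_sum: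
  "(\<integral>\<^sup>+xs. sum_list (map \<phi> xs) \<partial>replicate_pmf d p) = of_nat d * (\<integral>\<^sup>+x. \<phi> x \<partial>p)" for \<phi> :: "'a \<Rightarrow> ennreal"
proof (induction d)
  case (Suc d)
  have "(\<integral>\<^sup>+xs. sum_list (map \<phi> xs) \<partial>replicate_pmf (Suc d) p)
     = (\<integral>\<^sup>+x. \<integral>\<^sup>+xs. \<phi> x + sum_list (map \<phi> xs) \<partial>replicate_pmf d p \<partial>p)"
    unfolding replicate_pmf_Suc_pair by (simp add: nn_integral_pair_pmf' case_prod_unfold)
  also have "\<dots> = of_nat (Suc d) * (\<integral>\<^sup>+x. \<phi> x \<partial>p)"
    by (simp add: nn_integral_add Suc algebra_simps)
  finally show ?case .
qed simp

text \<open>A root contributes \<open>P(\<xi> \<in> \<Omega>)\<close> and its subtrees contribute the mean offspring number times the same expectation.\<close>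

lemma nn_integral_L: "(\<integral>\<^sup>+T. of_nat (L \<Omega> T) \<partial>gw) \<le> ennreal (measure_pmf.prob \<xi> \<Omega> / (1 - mean \<xi>))"
proof (rule nn_integral_gw_leI)
  define c where "c = measure_pmf.prob \<xi> \<Omega> / (1 - mean \<xi>)"
  have c0: "c \<ge> 0" using mean_less_1 by (simp add: c_def)
  have cc: "measure_pmf.prob \<xi> \<Omega> + mean \<xi> * c = c"
    using mean_less_1 by (simp add: c_def field_simps)
  fix k
  show "(\<integral>\<^sup>+T. of_nat (L \<Omega> T) * indicator {T. num_vertices T \<le> k} T \<partial>gw) \<le> ennreal (measure_pmf.prob \<xi> \<Omega> / (1 - mean \<xi>))"
    unfolding c_def[symmetric]
  proof (induction k)
    case 0
    have "(\<integral>\<^sup>+T. of_nat (L \<Omega> T) * indicator {T. num_vertices T \<le> 0} T \<partial>gw) = (\<integral>\<^sup>+T. (0::ennreal) \<partial>gw)"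
    proof (rule nn_integral_cong)
      fix T show "of_nat (L \<Omega> T) * indicator {T. num_vertices T \<le> 0} T = (0::ennreal)"
        using num_vertices_pos[of T] by simp
    qed
    then show ?case by simp
  next
    case (Suc k)
    let ?\<phi> = "\<lambda>k T. of_nat (L \<Omega> T) * indicator {T. num_vertices T \<le> k} T :: ennreal"
    have le: "?\<phi> (Suc k) (Node ts) \<le> indicator \<Omega> (length ts) + sum_list (map (?\<phi> k) ts)" for ts
    proof (cases "num_vertices (Node ts) \<le> Suc k")
      case True
      have "sum_list (map (?\<phi> k) ts) = sum_list (map (\<lambda>t. of_nat (L \<Omega> t)) ts)"
        using num_vertices_child[OF True] by (intro arg_cong[of _ _ sum_list] map_cong) auto
      also have "\<dots> = of_nat (sum_list (map (L \<Omega>) ts))" by (induction ts) auto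
      finally show ?thesis using True by (simp add: L_Node indicator_def)
    qed simp
    have "(\<integral>\<^sup>+T. ?\<phi> (Suc k) T \<partial>gw)
       \<le> (\<integral>\<^sup>+x. \<integral>\<^sup>+ts. indicator \<Omega> (length ts) + sum_list (map (?\<phi> k) ts) \<partial>replicate_pmf x gw \<partial>\<xi>)"
      unfolding nn_integral_gw by (intro nn_integral_mono le)
    also have "\<dots> = (\<integral>\<^sup>+x. indicator \<Omega> x + of_nat x * (\<integral>\<^sup>+T. ?\<phi> k T \<partial>gw) \<partial>\<xi>)"
    proof (rule nn_integral_cong)
      fix x
      have "(\<integral>\<^sup>+ts. indicator \<Omega> (length ts) + sum_list (map (?\<phi> k) ts) \<partial>replicate_pmf x gw)
         = (\<integral>\<^sup>+ts. indicator \<Omega> x + sum_list (map (?\<phi> k) ts) \<partial>replicate_pmf x gw)"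
        by (intro nn_integral_cong_AE) (auto simp: AE_measure_pmf_iff length_replicate_pmf)
      then show "(\<integral>\<^sup>+ts. indicator \<Omega> (length ts) + sum_list (map (?\<phi> k) ts) \<partial>replicate_pmf x gw)
         = indicator \<Omega> x + of_nat x * (\<integral>\<^sup>+T. ?\<phi> k T \<partial>gw)"
        by (simp add: nn_integral_add nn_integral_replicate_sum)
    qed
    also have "\<dots> \<le> (\<integral>\<^sup>+x. indicator \<Omega> x + of_nat x * ennreal c \<partial>\<xi>)"
      by (intro nn_integral_mono add_left_mono mult_left_mono Suc) auto
    also have "\<dots> = emeasure \<xi> \<Omega> + (\<integral>\<^sup>+x. ennreal (real x) \<partial>\<xi>) * ennreal c"
      by (simp add: nn_integral_add nn_integral_multc ennreal_of_nat_eq_real_of_nat)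
    also have "(\<integral>\<^sup>+x. ennreal (real x) \<partial>\<xi>) = ennreal (mean \<xi>)"
      using integrable_\<xi> by (intro nn_integral_eq_integral) auto
    also have "emeasure \<xi> \<Omega> + ennreal (mean \<xi>) * ennreal c = ennreal c"
    proof -
      have "emeasure \<xi> \<Omega> + ennreal (mean \<xi>) * ennreal c = ennreal (measure_pmf.prob \<xi> \<Omega> + mean \<xi> * c)"
        using c0 by (simp add: measure_pmf.emeasure_eq_measure ennreal_mult)
      then show ?thesis by (simp only: cc)
    qed
    finally show ?case .
  qed
qed

lemma integrable_L: "integrable gw (\<lambda>T. real (L \<Omega> T))"
  using nn_integral_L[of \<Omega>]
  by (intro integrableI_bounded) (auto simp: ennreal_of_nat_eq_real_of_nat[symmetric] intro: le_less_trans)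

text \<open>The first moment method, applied to the number of vertices of outdegree at least \<open>d\<close>.\<close>

lemma prob_max_outdeg_ge:
  "measure_pmf.prob gw {T. max_outdeg T \<ge> d} \<le> measure_pmf.prob \<xi> {d..} / (1 - mean \<xi>)"
proof -
  have "emeasure gw {T. max_outdeg T \<ge> d} = (\<integral>\<^sup>+T. indicator {T. max_outdeg T \<ge> d} T \<partial>gw)" by simp
  also have "\<dots> \<le> (\<integral>\<^sup>+T. of_nat (L {d..} T) \<partial>gw)"
  proof (intro nn_integral_mono)
    fix T
    show "indicator {T. max_outdeg T \<ge> d} T \<le> (of_nat (L {d..} T) :: ennreal)"
    proof (cases "max_outdeg T \<ge> d")
      case True
      then have "1 \<le> L {d..} T" using max_outdeg_less_iff[of T d] by linarith
      then show ?thesis using True by (metis indicator_eq_1_iff mem_Collect_eq of_nat_1 of_nat_mono)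
    qed simp
  qed
  also have "\<dots> \<le> ennreal (measure_pmf.prob \<xi> {d..} / (1 - mean \<xi>))" by (rule nn_integral_L)
  finally show ?thesis
    using mean_less_1 by (simp add: measure_pmf.emeasure_eq_measure)
qed

text \<open>Giving the weight \<open>exp h\<close> to every vertex, counted or not, only increases the right side of the
  fixed point equation of the truncated generating function. Induction over the size of the tree keeps
  the latter below every supersolution of the enlarged equation.\<close>

lemma gw_generating_function_le:
  assumes sup: "(\<integral>\<^sup>+x. ennreal (exp h) * ennreal y ^ x * indicator {..M} x \<partial>\<xi>) \<le> ennreal y" and h: "h \<ge> 0"
  shows "(\<integral>\<^sup>+T. ennreal (exp (h * real (L \<Omega> T))) * indicator {T. max_outdeg T \<le> M} T \<partial>gw) \<le> ennreal y"
proof (rule nn_integral_gw_leI)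
  let ?\<psi> = "\<lambda>T. ennreal (exp (h * real (L \<Omega> T))) * indicator {T. max_outdeg T \<le> M} T"
  let ?\<phi> = "\<lambda>k T. ?\<psi> T * indicator {T. num_vertices T \<le> k} T"
  fix k
  show "(\<integral>\<^sup>+T. ?\<phi> k T \<partial>gw) \<le> ennreal y"
  proof (induction k)
    case 0
    have "(\<integral>\<^sup>+T. ?\<phi> 0 T \<partial>gw) = (\<integral>\<^sup>+T. (0::ennreal) \<partial>gw)"
    proof (rule nn_integral_cong)
      fix T show "?\<phi> 0 T = (0::ennreal)"
        using num_vertices_pos[of T] by simp
    qed
    then show ?case by simp
  next
    case (Suc k)
    have le: "?\<phi> (Suc k) (Node ts) \<le> ennreal (exp h) * indicator {..M} (length ts) * prod_list (map (?\<phi> k) ts)" for ts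
    proof (cases "num_vertices (Node ts) \<le> Suc k \<and> max_outdeg (Node ts) \<le> M")
      case True
      have "prod_list (map (?\<phi> k) ts) = prod_list (map (\<lambda>t. ennreal (exp (h * real (L \<Omega> t)))) ts)"
        using num_vertices_child[of ts k] True
        by (intro arg_cong[of _ _ prod_list] map_cong) (auto simp: max_outdeg_Node_le)
      also have "\<dots> = ennreal (exp (h * real (sum_list (map (L \<Omega>) ts))))"
        by (induction ts) (auto simp: distrib_left exp_add ennreal_mult)
      finally have p: "prod_list (map (?\<phi> k) ts) = ennreal (exp (h * real (sum_list (map (L \<Omega>) ts))))" .
      have "h * real (L \<Omega> (Node ts)) \<le> h * (1 + real (sum_list (map (L \<Omega>) ts)))"
        using h by (intro mult_left_mono) (auto simp: L_Node)
      then have "exp (h * real (L \<Omega> (Node ts))) \<le> exp h * exp (h * real (sum_list (map (L \<Omega>) ts)))"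
        unfolding exp_add[symmetric] by (simp add: algebra_simps)
      then have "ennreal (exp (h * real (L \<Omega> (Node ts)))) \<le> ennreal (exp h) * ennreal (exp (h * real (sum_list (map (L \<Omega>) ts))))"
        by (simp add: ennreal_mult[symmetric])
      then show ?thesis using True unfolding p by (simp add: max_outdeg_Node_le)
    qed (auto simp: indicator_def)
    have "(\<integral>\<^sup>+T. ?\<phi> (Suc k) T \<partial>gw)
       \<le> (\<integral>\<^sup>+x. \<integral>\<^sup>+ts. ennreal (exp h) * indicator {..M} (length ts) * prod_list (map (?\<phi> k) ts) \<partial>replicate_pmf x gw \<partial>\<xi>)"
      unfolding nn_integral_gw[of "?\<phi> (Suc k)"] by (intro nn_integral_mono le)
    also have "\<dots> = (\<integral>\<^sup>+x. ennreal (exp h) * indicator {..M} x * (\<integral>\<^sup>+T. ?\<phi> k T \<partial>gw) ^ x \<partial>\<xi>)"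
    proof (rule nn_integral_cong)
      fix x
      have "(\<integral>\<^sup>+ts. ennreal (exp h) * indicator {..M} (length ts) * prod_list (map (?\<phi> k) ts) \<partial>replicate_pmf x gw)
         = (\<integral>\<^sup>+ts. ennreal (exp h) * indicator {..M} x * prod_list (map (?\<phi> k) ts) \<partial>replicate_pmf x gw)"
        by (intro nn_integral_cong_AE) (auto simp: AE_measure_pmf_iff length_replicate_pmf)
      then show "(\<integral>\<^sup>+ts. ennreal (exp h) * indicator {..M} (length ts) * prod_list (map (?\<phi> k) ts) \<partial>replicate_pmf x gw)
         = ennreal (exp h) * indicator {..M} x * (\<integral>\<^sup>+T. ?\<phi> k T \<partial>gw) ^ x"
        by (simp add: nn_integral_cmult nn_integral_replicate_prod)
    qed
    also have "\<dots> \<le> (\<integral>\<^sup>+x. ennreal (exp h) * indicator {..M} x * ennreal y ^ x \<partial>\<xi>)"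
      by (intro nn_integral_mono mult_left_mono power_mono Suc) auto
    also have "\<dots> \<le> ennreal y" using sup by (simp add: mult_ac)
    finally show ?case .
  qed
qed

end

section \<open>Trees without a vertex of large outdegree\<close>

text \<open>The remainder keeps only the power \<open>1 + \<rho>\<close>, for which the offspring distribution has a finite moment.\<close>

lemma exp_le_power_remainder:
  fixes y :: real
  assumes y: "0 \<le> y" "y \<le> z" and \<rho>: "0 < \<rho>" "\<rho> \<le> 1"
  shows "exp y \<le> 1 + y + y powr (1 + \<rho>) * exp z"
proof (cases "y \<le> 1")
  case True
  have "exp y \<le> 1 + y + y\<^sup>2" using exp_bound[of y] y True by simp
  also have "y\<^sup>2 \<le> y powr (1 + \<rho>) * 1"
  proof (cases "y = 0")
    case False
    have "y powr 2 \<le> y powr (1 + \<rho>)" using True y \<rho> False by (intro powr_mono') auto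
    then show ?thesis using y False by (simp add: powr_numeral)
  qed simp
  also have "y powr (1 + \<rho>) * 1 \<le> y powr (1 + \<rho>) * exp z" using y by (intro mult_left_mono) auto
  finally show ?thesis by simp
next
  case False
  have "1 * exp y \<le> y powr (1 + \<rho>) * exp z"
    using False y \<rho> by (intro mult_mono ge_one_powr_ge_zero) auto
  then show ?thesis using y by simp
qed

lemma eventually_constant_membership:
  fixes \<Omega> :: "nat set"
  assumes "finite \<Omega> \<or> finite (- \<Omega>)"
  shows "\<exists>N. \<forall>k\<ge>N. (k \<in> \<Omega>) = (N \<in> \<Omega>)"
  using assms
proof
  assume "finite \<Omega>"
  then obtain N where "\<Omega> \<subseteq> {..<N}" by (auto simp: finite_nat_iff_bounded)
  then show ?thesis by (intro exI[of _ N]) auto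
next
  assume "finite (- \<Omega>)"
  then obtain N where "- \<Omega> \<subseteq> {..<N}" by (auto simp: finite_nat_iff_bounded)
  then show ?thesis by (intro exI[of _ N]) force
qed

context subcritical
begin

text \<open>An exponential Markov inequality for trees with the exponent \<open>h = K ln n / n\<close>, so that \<open>exp (- h n)\<close> is
  the desired power of \<open>n\<close>. With degrees at most \<open>\<delta> n\<close> and \<open>s\<close> of order \<open>h\<close>, the factor \<open>exp (s \<xi>)\<close> is at most
  a small power of \<open>n\<close>; hence \<open>exp s\<close> is a supersolution of the fixed point equation, since
  subcriticality beats the remainder of order \<open>s powr (1 + \<rho>)\<close>.\<close>

lemma prob_L_small_max_outdeg:
  assumes mom: "summable (\<lambda>k. pmf \<xi> k * real k powr (1 + \<rho>))" and \<rho>: "0 < \<rho>" "\<rho> \<le> 1" and K: "K > 0"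
  shows "\<exists>\<delta>>0. \<forall>\<^sub>F n in sequentially.
    measure_pmf.prob gw {T. L \<Omega> T = n \<and> real (max_outdeg T) \<le> \<delta> * real n} \<le> 2 * real n powr - K"
proof -
  define m where "m = (\<Sum>k. pmf \<xi> k * real k powr (1 + \<rho>))"
  have m0: "m \<ge> 0" unfolding m_def by (intro suminf_nonneg mom) auto
  have m: "(\<integral>\<^sup>+k. ennreal (real k powr (1 + \<rho>)) \<partial>\<xi>) = ennreal m"
  proof -
    have "(\<integral>\<^sup>+k. ennreal (real k powr (1 + \<rho>)) \<partial>\<xi>) = (\<Sum>k. ennreal (pmf \<xi> k * real k powr (1 + \<rho>)))"
      by (simp add: nn_integral_measure_pmf nn_integral_count_space_nat ennreal_mult')
    also have "\<dots> = ennreal m" unfolding m_def by (intro suminf_ennreal2 mom) auto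
    finally show ?thesis .
  qed
  define \<mu> where "\<mu> = mean \<xi>"
  have \<mu>: "0 \<le> \<mu>" "\<mu> < 1" using mean_less_1 by (auto simp: \<mu>_def intro!: Bochner_Integration.integral_nonneg)
  \<comment> \<open>half of the gap \<open>1 - \<mu>\<close> pays for \<open>exp h\<close>, the other half for the remainder\<close>
  define A where "A = 2 / (1 - \<mu>)"
  have A: "A > 0" using \<mu> by (simp add: A_def)
  define c where "c = A * K"
  have c: "c > 0" using A K by (simp add: c_def)
  \<comment> \<open>chosen so that \<open>exp (s M)\<close> is at most \<open>n powr (\<rho> / 2)\<close>\<close>
  define \<delta> where "\<delta> = \<rho> / (2 * c)"
  have \<delta>: "\<delta> > 0" using c \<rho> by (simp add: \<delta>_def)
  have "(\<lambda>n. (c * ln (real n) / real n) powr \<rho> * real n powr (\<rho>/2) * m) \<longlonglongrightarrow> 0"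
    using c \<rho> by real_asymp
  then have ev1: "\<forall>\<^sub>F n in sequentially. (c * ln (real n) / real n) powr \<rho> * real n powr (\<rho>/2) * m < (1 - \<mu>) / 2"
    using \<mu> by (intro order_tendstoD(2)) auto
  have "(\<lambda>n. exp (c * ln (real n) / real n)) \<longlonglongrightarrow> 1"
    using c by real_asymp
  then have ev2: "\<forall>\<^sub>F n in sequentially. exp (c * ln (real n) / real n) < 2"
    by (intro order_tendstoD(2)) auto
  have "\<forall>\<^sub>F n in sequentially.
    measure_pmf.prob gw {T. L \<Omega> T = n \<and> real (max_outdeg T) \<le> \<delta> * real n} \<le> 2 * real n powr - K"
    using ev1 ev2 eventually_ge_at_top[of 1]
  proof eventually_elim
    case (elim n)
    define h where "h = K * ln (real n) / real n"
    define s where "s = A * h"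
    define M where "M = nat \<lfloor>\<delta> * real n\<rfloor>"
    have n: "real n \<ge> 1" using elim by simp
    have h: "h \<ge> 0" using n K by (simp add: h_def)
    have s: "s \<ge> 0" and s_eq: "s = c * ln (real n) / real n"
      using mult_nonneg_nonneg[OF less_imp_le[OF A] h] by (simp_all add: s_def c_def) (simp add: h_def)
    have hs: "h = s * ((1 - \<mu>) / 2)" using \<mu> by (simp add: s_def A_def)
    have sM: "s * real M \<le> \<rho> / 2 * ln (real n)"
    proof -
      have "real M \<le> \<delta> * real n" using \<delta> by (simp add: M_def)
      then have "s * real M \<le> s * (\<delta> * real n)" using s by (intro mult_left_mono) auto
      also have "\<dots> = \<rho> / 2 * ln (real n)" using n c by (simp add: s_eq \<delta>_def field_simps)
      finally show ?thesis .
    qed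
    have esM: "exp (s * real M) \<le> real n powr (\<rho>/2)"
      using sM n by (simp add: powr_def)
    define r where "r = s powr (1 + \<rho>) * exp (s * real M) * m"
    have r0: "r \<ge> 0" using m0 by (simp add: r_def)
    have "r \<le> s * ((1 - \<mu>) / 2)"
    proof -
      have "r = s * (s powr \<rho> * exp (s * real M) * m)"
        using s by (cases "s = 0") (auto simp: r_def powr_add)
      also have "\<dots> \<le> s * (s powr \<rho> * real n powr (\<rho>/2) * m)"
        using s esM m0 by (intro mult_left_mono mult_right_mono) auto
      also have "\<dots> \<le> s * ((1 - \<mu>) / 2)"
      proof (intro mult_left_mono s less_imp_le)
        show "s powr \<rho> * real n powr (\<rho>/2) * m < (1 - \<mu>) / 2" using elim(1) by (simp only: s_eq)
      qed
      finally show ?thesis .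
    qed
    then have key: "h + (s * \<mu> + r) \<le> s" unfolding hs by (simp add: field_simps)
    have "(\<integral>\<^sup>+x. ennreal (exp h) * ennreal (exp s) ^ x * indicator {..M} x \<partial>\<xi>)
       \<le> (\<integral>\<^sup>+x. ennreal (exp h) * (1 + ennreal s * ennreal (real x) + ennreal (s powr (1 + \<rho>) * exp (s * real M)) * ennreal (real x powr (1 + \<rho>))) \<partial>\<xi>)"
    proof (intro nn_integral_mono)
      fix x
      show "ennreal (exp h) * ennreal (exp s) ^ x * indicator {..M} x
        \<le> ennreal (exp h) * (1 + ennreal s * ennreal (real x) + ennreal (s powr (1 + \<rho>) * exp (s * real M)) * ennreal (real x powr (1 + \<rho>)))"
      proof (cases "x \<le> M")
        case True
        have "exp (s * real x) \<le> 1 + s * real x + (s * real x) powr (1 + \<rho>) * exp (s * real M)"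
          using True s \<rho> by (intro exp_le_power_remainder mult_left_mono) auto
        also have "\<dots> = 1 + s * real x + (s powr (1 + \<rho>) * exp (s * real M)) * real x powr (1 + \<rho>)"
          using s by (simp add: powr_mult)
        finally have "ennreal (exp (s * real x)) \<le> ennreal (1 + s * real x + (s powr (1 + \<rho>) * exp (s * real M)) * real x powr (1 + \<rho>))"
          by (rule ennreal_leI)
        also have "\<dots> = 1 + ennreal s * ennreal (real x) + ennreal (s powr (1 + \<rho>) * exp (s * real M)) * ennreal (real x powr (1 + \<rho>))"
          using s by (simp add: ennreal_mult)
        also have "ennreal (exp (s * real x)) = ennreal (exp s) ^ x"
          by (simp add: ennreal_power exp_of_nat2_mult[symmetric])
        finally show ?thesis using True by (simp add: mult_left_mono)
      qed simp
    qed
    also have "\<dots> = ennreal (exp h) * (1 + ennreal s * ennreal \<mu> + ennreal (s powr (1 + \<rho>) * exp (s * real M)) * ennreal m)"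
    proof -
      have "(\<integral>\<^sup>+x. ennreal (real x) \<partial>\<xi>) = ennreal \<mu>"
        unfolding \<mu>_def using integrable_\<xi> by (intro nn_integral_eq_integral) auto
      then show ?thesis by (simp add: nn_integral_cmult nn_integral_add m)
    qed
    also have "\<dots> = ennreal (exp h * (1 + s * \<mu> + r))"
    proof -
      have sm: "s * \<mu> \<ge> 0" using s \<mu> by simp
      have "ennreal (exp h * (1 + s * \<mu> + r)) = ennreal (exp h) * (ennreal 1 + ennreal (s * \<mu>) + ennreal r)"
        using sm r0 by (simp add: ennreal_mult')
      moreover have "ennreal (s * \<mu>) = ennreal s * ennreal \<mu>" using s \<mu> by (intro ennreal_mult) auto
      moreover have "ennreal r = ennreal (s powr (1 + \<rho>) * exp (s * real M)) * ennreal m"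
        unfolding r_def using m0 by (intro ennreal_mult) auto
      ultimately show ?thesis by simp
    qed
    also have "\<dots> \<le> ennreal (exp s)"
    proof (rule ennreal_leI)
      have "exp h * (1 + s * \<mu> + r) \<le> exp h * exp (s * \<mu> + r)"
        using exp_ge_add_one_self[of "s * \<mu> + r"] by (intro mult_left_mono) (auto simp: add_ac)
      also have "\<dots> = exp (h + (s * \<mu> + r))" by (rule exp_add[symmetric])
      also have "\<dots> \<le> exp s" using key by simp
      finally show "exp h * (1 + s * \<mu> + r) \<le> exp s" .
    qed
    finally have "(\<integral>\<^sup>+T. ennreal (exp (h * real (L \<Omega> T))) * indicator {T. max_outdeg T \<le> M} T \<partial>gw) \<le> ennreal (exp s)"
      by (rule gw_generating_function_le[OF _ h])
    moreover have "ennreal (exp (h * real n)) * emeasure gw {T. L \<Omega> T = n \<and> real (max_outdeg T) \<le> \<delta> * real n}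
      \<le> (\<integral>\<^sup>+T. ennreal (exp (h * real (L \<Omega> T))) * indicator {T. max_outdeg T \<le> M} T \<partial>gw)"
    proof -
      have "ennreal (exp (h * real n)) * emeasure gw {T. L \<Omega> T = n \<and> real (max_outdeg T) \<le> \<delta> * real n}
        = (\<integral>\<^sup>+T. ennreal (exp (h * real n)) * indicator {T. L \<Omega> T = n \<and> real (max_outdeg T) \<le> \<delta> * real n} T \<partial>gw)"
        by (simp add: nn_integral_cmult)
      also have "\<dots> \<le> (\<integral>\<^sup>+T. ennreal (exp (h * real (L \<Omega> T))) * indicator {T. max_outdeg T \<le> M} T \<partial>gw)"
        by (intro nn_integral_mono) (auto simp: indicator_def M_def le_nat_iff le_floor_iff)
      finally show ?thesis .
    qed
    ultimately have "ennreal (exp (h * real n)) * emeasure gw {T. L \<Omega> T = n \<and> real (max_outdeg T) \<le> \<delta> * real n} \<le> ennreal (exp s)"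
      by (rule order_trans[rotated])
    then have "exp (h * real n) * measure_pmf.prob gw {T. L \<Omega> T = n \<and> real (max_outdeg T) \<le> \<delta> * real n} \<le> exp s"
      by (simp add: measure_pmf.emeasure_eq_measure ennreal_mult[symmetric])
    also have "exp s \<le> 2" using elim s_eq by simp
    also have "exp (h * real n) = real n powr K" using n by (simp add: h_def powr_def)
    finally show ?case using n by (simp add: powr_minus field_simps)
  qed
  with \<delta> show ?thesis by blast
qed

text \<open>Stars suffice as witnesses. If leaves are counted, two stars of large consecutive sizes differ by one,
  because membership of their root degree in \<open>\<Omega>\<close> no longer changes. If leaves are not counted, take the single
  vertex and a star whose root degree lies in \<open>\<Omega>\<close>.\<close>

lemma L_adjacent_values:
  assumes p0: "pmf \<xi> 0 > 0" and ev: "\<forall>\<^sub>F k in sequentially. pmf \<xi> k > 0"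
    and \<Omega>: "measure_pmf.prob \<xi> \<Omega> > 0" "finite \<Omega> \<or> finite (- \<Omega>)"
  shows "\<exists>a. measure_pmf.prob gw {T. L \<Omega> T = a} > 0 \<and> measure_pmf.prob gw {T. L \<Omega> T = a + 1} > 0"
proof -
  define star where "star k = Node (replicate k (Node []))" for k
  have Lstar: "L \<Omega> (star k) = of_bool (k \<in> \<Omega>) + k * of_bool (0 \<in> \<Omega>)" for k
    by (simp add: star_def L_Node sum_list_replicate)
  have pos: "measure_pmf.prob gw {T. L \<Omega> T = L \<Omega> (star k)} > 0" if "pmf \<xi> k > 0" for k
  proof -
    have "pmf gw (star k) = pmf \<xi> k * pmf \<xi> 0 ^ k" by (simp add: star_def pmf_gw_Node prod_list_replicate)
    then have "0 < pmf gw (star k)" using that p0 by simp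
    also have "\<dots> = measure_pmf.prob gw {star k}" by (simp add: measure_pmf_single)
    also have "\<dots> \<le> measure_pmf.prob gw {T. L \<Omega> T = L \<Omega> (star k)}"
      by (intro measure_pmf.finite_measure_mono) auto
    finally show ?thesis .
  qed
  show ?thesis
  proof (cases "0 \<in> \<Omega>")
    case True
    obtain N where N: "\<And>k. k \<ge> N \<Longrightarrow> (k \<in> \<Omega>) = (N \<in> \<Omega>)"
      using eventually_constant_membership[OF \<Omega>(2)] by blast
    obtain N' where N': "\<And>k. k \<ge> N' \<Longrightarrow> pmf \<xi> k > 0" using ev by (auto simp: eventually_at_top_linorder)
    define k where "k = max N N'"
    have "(k \<in> \<Omega>) = (N \<in> \<Omega>)" "(k + 1 \<in> \<Omega>) = (N \<in> \<Omega>)" by (rule N; simp add: k_def)+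
    then have "L \<Omega> (star (k + 1)) = L \<Omega> (star k) + 1" using True by (simp add: Lstar)
    moreover have "pmf \<xi> k > 0" "pmf \<xi> (k + 1) > 0" by (rule N'; simp add: k_def)+
    ultimately show ?thesis using pos[of k] pos[of "k + 1"] by (intro exI[of _ "L \<Omega> (star k)"]) simp
  next
    case False
    have "set_pmf \<xi> \<inter> \<Omega> \<noteq> {}" using \<Omega>(1) by (metis less_irrefl measure_pmf_zero_iff)
    then obtain k where "k \<in> \<Omega>" "pmf \<xi> k > 0" by (auto simp: set_pmf_iff pmf_nonneg less_le)
    then show ?thesis using pos[of 0] pos[of k] p0 False by (intro exI[of _ 0]) (auto simp: Lstar)
  qed
qed

text \<open>The transfer between events for trees and events for marked forests.\<close>

lemma prob_graft_image:
  assumes S: "\<And>T v ts. ((T, v), ts) \<in> S \<Longrightarrow> marked_leaf v T \<and> length ts = d"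
    and inj: "inj_on (\<lambda>((T, v), ts). graft v T ts) S"
  shows "measure_pmf.prob gw ((\<lambda>((T, v), ts). graft v T ts) ` S)
    = pmf \<xi> d / (1 - mean \<xi>) * measure_pmf.prob (pair_pmf bullet (replicate_pmf d gw)) S"
proof -
  let ?g = "\<lambda>((T, v), ts). graft v T ts"
  have pm: "pmf gw (?g z) = pmf \<xi> d / (1 - mean \<xi>) * pmf (pair_pmf bullet (replicate_pmf d gw)) z" if "z \<in> S" for z
  proof -
    obtain T v ts where z: "z = ((T, v), ts)" by (metis prod.exhaust)
    from S[of T v ts] that have "marked_leaf v T" "length ts = d" by (auto simp: z)
    then show ?thesis
      using pmf_gw_graft[of v T ts] mean_less_1 by (simp add: z pmf_pair pmf_replicate_pmf field_simps)
  qed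
  have "emeasure gw (?g ` S) = (\<integral>\<^sup>+T. ennreal (pmf gw T) \<partial>count_space (?g ` S))"
    by (rule nn_integral_pmf[symmetric])
  also have "\<dots> = (\<integral>\<^sup>+z. ennreal (pmf gw (?g z)) \<partial>count_space S)"
    by (rule nn_integral_bij_count_space[symmetric]) (use inj in \<open>auto simp: bij_betw_def\<close>)
  also have "\<dots> = (\<integral>\<^sup>+z. ennreal (pmf \<xi> d / (1 - mean \<xi>)) * ennreal (pmf (pair_pmf bullet (replicate_pmf d gw)) z) \<partial>count_space S)"
    using mean_less_1 by (intro nn_integral_cong) (auto simp: pm ennreal_mult[symmetric] space_count_space)
  also have "\<dots> = ennreal (pmf \<xi> d / (1 - mean \<xi>)) * emeasure (pair_pmf bullet (replicate_pmf d gw)) S"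
    by (simp add: nn_integral_cmult nn_integral_pmf)
  finally show ?thesis
    using mean_less_1 by (simp add: measure_pmf.emeasure_eq_measure ennreal_mult[symmetric])
qed

end

section \<open>The two laws\<close>

declare replicate_pmf.simps(2) [simp del]

context subcritical
begin

abbreviation forest :: "nat \<Rightarrow> (mtree \<times> ptree list) pmf" where
  "forest d \<equiv> pair_pmf bullet (replicate_pmf d gw)"

text \<open>The part of the limit model that determines all events below: the marked tree and the first \<open>K\<close> trees.\<close>

definition prefix_map :: "nat \<Rightarrow> mtree \<times> (nat \<Rightarrow> ptree) \<Rightarrow> mtree \<times> ptree list" where
  "prefix_map K = (\<lambda>(T, T'). (T, map T' [1..<Suc K]))"

lemma limit_space_eq: "limit_space \<xi> = measure_pmf bullet \<Otimes>\<^sub>M (\<Pi>\<^sub>M i\<in>{1..}. measure_pmf gw)"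
  by (simp add: limit_space_def GW_eq GW_bullet_eq)

sublocale trees: product_prob_space "\<lambda>_. measure_pmf gw" "{1..} :: nat set"
  by unfold_locales

lemma prob_space_limit_space: "prob_space (limit_space \<xi>)"
proof -
  interpret pair_prob_space "measure_pmf bullet" "\<Pi>\<^sub>M i\<in>{1::nat..}. measure_pmf gw" ..
  show ?thesis unfolding limit_space_eq by unfold_locales
qed

lemma prefix_map_vimage:
  "prefix_map K -` {(T, xs)} \<inter> space (limit_space \<xi>) =
    (if length xs = K then {T} \<times> prod_emb {1..} (\<lambda>_. measure_pmf gw) {1..K} (\<Pi>\<^sub>E i\<in>{1..K}. {xs ! (i - 1)}) else {})"
proof (cases "length xs = K")
  case True
  have "map T' [1..<Suc K] = xs \<longleftrightarrow> (\<forall>i\<in>{1..K}. T' i = xs ! (i - 1))" for T' :: "nat \<Rightarrow> ptree"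
  proof -
    have "map T' [1..<Suc K] = xs \<longleftrightarrow> (\<forall>j<K. T' (Suc j) = xs ! j)"
      using True by (auto simp: list_eq_iff_nth_eq simp del: upt_Suc)
    also have "\<dots> \<longleftrightarrow> (\<forall>i\<in>{1..K}. T' i = xs ! (i - 1))"
      by (auto simp: Suc_le_eq) (metis Suc_pred less_eq_Suc_le)
    finally show ?thesis .
  qed
  then show ?thesis using True
    by (auto simp: prefix_map_def limit_space_eq space_pair_measure space_PiM prod_emb_def PiE_iff restrict_def extensional_def
        simp del: upt_Suc)
next
  case False
  then show ?thesis by (auto simp: prefix_map_def simp del: upt_Suc)
qed

lemma measurable_prefix_map [measurable]: "prefix_map K \<in> limit_space \<xi> \<rightarrow>\<^sub>M count_space UNIV"
proof (rule measurable_count_space_eq2_countable[THEN iffD2], safe)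
  fix T v xs
  show "prefix_map K -` {((T, v), xs)} \<inter> space (limit_space \<xi>) \<in> sets (limit_space \<xi>)"
    unfolding prefix_map_vimage unfolding limit_space_eq
    by (auto intro!: pair_measureI sets_PiM_I)
qed auto

text \<open>The infinite product is needed only through its finite marginals, which live on a countable space.\<close>

lemma distr_prefix_map: "distr (limit_space \<xi>) (count_space UNIV) (prefix_map K) = measure_pmf (forest K)"
proof (rule measure_eqI_countable[where A = UNIV])
  fix z :: "mtree \<times> ptree list"
  obtain T xs where z: "z = (T, xs)" by (cases z)
  have "emeasure (distr (limit_space \<xi>) (count_space UNIV) (prefix_map K)) {z}
     = emeasure (limit_space \<xi>) (prefix_map K -` {(T, xs)} \<inter> space (limit_space \<xi>))"
    by (subst emeasure_distr) (auto simp: z)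
  also have "\<dots> = emeasure (forest K) {z}"
  proof (cases "length xs = K")
    case True
    have "emeasure (limit_space \<xi>) (prefix_map K -` {(T, xs)} \<inter> space (limit_space \<xi>))
      = emeasure bullet {T} * emeasure (\<Pi>\<^sub>M i\<in>{1..}. measure_pmf gw)
          (prod_emb {1..} (\<lambda>_. measure_pmf gw) {1..K} (\<Pi>\<^sub>E i\<in>{1..K}. {xs ! (i - 1)}))"
    proof -
      show ?thesis
        unfolding prefix_map_vimage if_P[OF True] unfolding limit_space_eq
        by (rule trees.P.emeasure_pair_measure_Times) (auto intro!: sets_PiM_I)
    qed
    also have "\<dots> = emeasure bullet {T} * (\<Prod>i\<in>{1..K}. emeasure gw {xs ! (i - 1)})"
      by (subst trees.emeasure_PiM_emb) auto
    also have "\<dots> = ennreal (pmf bullet T) * ennreal (\<Prod>i\<in>{1..K}. pmf gw (xs ! (i - 1)))"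
      by (simp add: emeasure_pmf_single prod_ennreal)
    also have "(\<Prod>i\<in>{1..K}. pmf gw (xs ! (i - 1))) = (\<Prod>i<K. pmf gw (xs ! i))"
      by (simp add: prod.atLeast1_atMost_eq)
    also have "\<dots> = prod_list (map (pmf gw) xs)"
      using True by (simp add: prod.list_conv_set_nth atLeast0LessThan)
    also have "ennreal (pmf bullet T) * ennreal (prod_list (map (pmf gw) xs)) = emeasure (forest K) {z}"
      using True by (simp add: emeasure_pmf_single z pmf_pair pmf_replicate_pmf ennreal_mult')
    finally show ?thesis .
  next
    case False
    then have "pmf (forest K) z = 0" by (simp add: z pmf_pair pmf_replicate_pmf)
    then show ?thesis unfolding prefix_map_vimage using False by (simp add: emeasure_pmf_single)
  qed
  finally show "emeasure (distr (limit_space \<xi>) (count_space UNIV) (prefix_map K)) {z} = emeasure (forest K) {z}" .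
qed auto

lemma measure_prefix_map:
  "measure (limit_space \<xi>) {\<omega> \<in> space (limit_space \<xi>). P (prefix_map K \<omega>)} = measure_pmf.prob (forest K) {z. P z}"
proof -
  have "measure_pmf.prob (forest K) {z. P z} = measure (distr (limit_space \<xi>) (count_space UNIV) (prefix_map K)) {z. P z}"
    by (simp only: distr_prefix_map)
  also have "\<dots> = measure (limit_space \<xi>) {\<omega> \<in> space (limit_space \<xi>). P (prefix_map K \<omega>)}"
    by (subst measure_distr) (auto intro!: arg_cong[of _ _ "measure (limit_space \<xi>)"])
  finally show ?thesis by simp
qed

definition total_L :: "nat set \<Rightarrow> mtree \<times> ptree list \<Rightarrow> nat" where
  "total_L \<Omega> = (\<lambda>(T, ts). L \<Omega> (fst T) + sum_list (map (L \<Omega>) ts))"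

lemma total_L_prefix_map: "total_L \<Omega> (prefix_map d (T, T')) = L \<Omega> (fst T) + (\<Sum>i=1..d. L \<Omega> (T' i))"
proof -
  have "sum_list (map (L \<Omega>) (map T' [1..<Suc d])) = (\<Sum>i\<in>set [1..<Suc d]. L \<Omega> (T' i))"
    using interv_sum_list_conv_sum_set_nat[of "\<lambda>i. L \<Omega> (T' i)" 1 "Suc d"] by (simp add: o_def del: upt_Suc)
  also have "set [1..<Suc d] = {1..d}" by auto
  finally show ?thesis by (simp add: total_L_def prefix_map_def del: upt_Suc)
qed

lemma Delta_n_alt: "Delta_n \<Omega> n T T' = Sup {d. d \<ge> 1 \<and> total_L \<Omega> (prefix_map d (T, T')) \<le> n}"
  by (simp add: Delta_n_def total_L_prefix_map)

lemma measurable_Delta_n: "(\<lambda>\<omega>. Delta_n \<Omega> n (fst \<omega>) (snd \<omega>)) \<in> limit_space \<xi> \<rightarrow>\<^sub>M count_space UNIV"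
  unfolding Delta_n_alt
proof (rule measurable_Sup_nat)
  fix d :: nat
  have "(\<lambda>z. 1 \<le> d \<and> total_L \<Omega> z \<le> n) \<in> count_space UNIV \<rightarrow>\<^sub>M count_space UNIV" by simp
  from measurable_compose[OF measurable_prefix_map this]
  show "Measurable.pred (limit_space \<xi>) (\<lambda>x. d \<in> {d. 1 \<le> d \<and> total_L \<Omega> (prefix_map d (fst x, snd x)) \<le> n})"
    by simp
qed

lemma Delta_n_eqI:
  assumes "d \<ge> 1" "total_L \<Omega> (prefix_map d (T, T')) \<le> n" "n < total_L \<Omega> (prefix_map (Suc d) (T, T'))"
  shows "Delta_n \<Omega> n T T' = d"
  unfolding Delta_n_alt
proof (rule cSup_eq_maximum)
  show "d \<in> {d. 1 \<le> d \<and> total_L \<Omega> (prefix_map d (T, T')) \<le> n}" using assms by auto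
  fix e assume e: "e \<in> {d. 1 \<le> d \<and> total_L \<Omega> (prefix_map d (T, T')) \<le> n}"
  show "e \<le> d"
  proof (rule ccontr)
    assume "\<not> e \<le> d"
    then have "(\<Sum>i=1..Suc d. L \<Omega> (T' i)) \<le> (\<Sum>i=1..e. L \<Omega> (T' i))" by (intro sum_mono2) auto
    then have "total_L \<Omega> (prefix_map (Suc d) (T, T')) \<le> total_L \<Omega> (prefix_map e (T, T'))" unfolding total_L_prefix_map by simp
    with assms e show False by auto
  qed
qed

text \<open>The random element whose law is the limit law, with a natural number as cutoff.\<close>

definition limit_map :: "nat set \<Rightarrow> nat \<Rightarrow> nat \<Rightarrow> mtree \<times> (nat \<Rightarrow> ptree) \<Rightarrow> mtree \<times> ptree list \<times> nat" where
  "limit_map \<Omega> n t = (\<lambda>(T, T'). (T, map T' [1..<Suc (Delta_n \<Omega> n T T' - t)], 0))"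

lemma law_limit_eq: "law_limit \<xi> \<Omega> n (int t) = distr (limit_space \<xi>) (count_space UNIV) (limit_map \<Omega> n t)"
  unfolding law_limit_def limit_map_def Let_def by (simp add: nat_minus_as_int del: upt_Suc)

lemma measurable_limit_map [measurable]: "limit_map \<Omega> n t \<in> limit_space \<xi> \<rightarrow>\<^sub>M count_space UNIV"
proof -
  have "(\<lambda>\<omega>. (\<lambda>k \<omega>. (\<lambda>(T, xs). (T, xs, 0::nat)) (prefix_map (k - t) \<omega>)) (Delta_n \<Omega> n (fst \<omega>) (snd \<omega>)) \<omega>)
      \<in> limit_space \<xi> \<rightarrow>\<^sub>M count_space UNIV"
    by (rule measurable_compose_countable[OF _ measurable_Delta_n])
       (rule measurable_compose[OF measurable_prefix_map], simp)
  also have "(\<lambda>\<omega>. (\<lambda>k \<omega>. (\<lambda>(T, xs). (T, xs, 0::nat)) (prefix_map (k - t) \<omega>)) (Delta_n \<Omega> n (fst \<omega>) (snd \<omega>)) \<omega>) = limit_map \<Omega> n t"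
    by (auto simp: limit_map_def prefix_map_def fun_eq_iff simp del: upt_Suc)
  finally show ?thesis .
qed

lemma prob_space_law_limit: "prob_space (law_limit \<xi> \<Omega> n (int t))"
proof -
  interpret prob_space "limit_space \<xi>" by (rule prob_space_limit_space)
  show ?thesis unfolding law_limit_eq by (rule prob_space_distr) measurable
qed

text \<open>Outside the two exceptional events the time \<open>Delta_n\<close> lies in \<open>{D1..D2}\<close>, and the event that it equals \<open>d\<close> depends on
  the first \<open>d + 1\<close> trees only. Thus the limit law is controlled by finite forests.\<close>

lemma measure_law_limit_le:
  assumes D1: "D1 \<ge> 1" "D1 \<le> D2"
  shows "measure (law_limit \<xi> \<Omega> n (int t)) A \<le>
    (\<Sum>d\<in>{D1..D2}. measure_pmf.prob (forest (Suc d))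
        {(T, ts). total_L \<Omega> (T, take d ts) \<le> n \<and> n < total_L \<Omega> (T, ts) \<and> (T, take (d - t) ts, 0) \<in> A})
    + measure_pmf.prob (forest D1) {z. n < total_L \<Omega> z} + measure_pmf.prob (forest (Suc D2)) {z. total_L \<Omega> z \<le> n}"
proof -
  interpret prob_space "limit_space \<xi>" by (rule prob_space_limit_space)
  let ?M = "limit_space \<xi>"
  define E where "E d = {\<omega> \<in> space ?M. (\<lambda>(T, ts). total_L \<Omega> (T, take d ts) \<le> n \<and> n < total_L \<Omega> (T, ts) \<and> (T, take (d - t) ts, 0) \<in> A)
     (prefix_map (Suc d) \<omega>)}" for d
  define B1 where "B1 = {\<omega> \<in> space ?M. n < total_L \<Omega> (prefix_map D1 \<omega>)}"
  define B2 where "B2 = {\<omega> \<in> space ?M. total_L \<Omega> (prefix_map (Suc D2) \<omega>) \<le> n}"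
  have ev: "{\<omega> \<in> space ?M. P (prefix_map K \<omega>)} \<in> sets ?M" for P K
  proof -
    have "prefix_map K -` {z. P z} \<inter> space ?M \<in> sets ?M"
      by (rule measurable_sets[OF measurable_prefix_map]) simp
    also have "prefix_map K -` {z. P z} \<inter> space ?M = {\<omega> \<in> space ?M. P (prefix_map K \<omega>)}" by auto
    finally show ?thesis .
  qed
  have sets: "E d \<in> sets ?M" "B1 \<in> sets ?M" "B2 \<in> sets ?M" for d
    unfolding E_def B1_def B2_def by (rule ev)+
  have take_prefix: "take d (map T' [1..<Suc e]) = map T' [1..<Suc d]" if "d \<le> e" for d e and T' :: "nat \<Rightarrow> ptree"
    using that by (simp add: take_map take_upt del: upt_Suc)
  have "measure (law_limit \<xi> \<Omega> n (int t)) A = measure ?M (limit_map \<Omega> n t -` A \<inter> space ?M)"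
    unfolding law_limit_eq by (rule measure_distr) auto
  also have "\<dots> \<le> measure ?M ((\<Union>d\<in>{D1..D2}. E d) \<union> B1 \<union> B2)"
  proof (rule finite_measure_mono)
    show "limit_map \<Omega> n t -` A \<inter> space ?M \<subseteq> (\<Union>d\<in>{D1..D2}. E d) \<union> B1 \<union> B2"
    proof
      fix \<omega> assume \<omega>: "\<omega> \<in> limit_map \<Omega> n t -` A \<inter> space ?M"
      obtain T T' where w: "\<omega> = (T, T')" by (cases \<omega>)
      define S where "S d = total_L \<Omega> (prefix_map d \<omega>)" for d
      show "\<omega> \<in> (\<Union>d\<in>{D1..D2}. E d) \<union> B1 \<union> B2"
      proof (cases "\<omega> \<in> B1 \<or> \<omega> \<in> B2")
        case False
        then have s: "S D1 \<le> n" "n < S (Suc D2)" using \<omega> by (auto simp: B1_def B2_def S_def)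
        \<comment> \<open>the first passage time; \<open>Delta_n\<close> is its predecessor\<close>
        define e where "e = (LEAST e. n < S e)"
        have e: "n < S e" unfolding e_def by (rule LeastI[of "\<lambda>e. n < S e", OF s(2)])
        have e_le: "e \<le> Suc D2" unfolding e_def by (rule Least_le[of "\<lambda>e. n < S e", OF s(2)])
        have e_min: "S d \<le> n" if "d < e" for d using not_less_Least[of d "\<lambda>e. n < S e"] that by (auto simp: e_def)
        have mono: "S a \<le> S b" if "a \<le> b" for a b
        proof -
          have "(\<Sum>i=1..a. L \<Omega> (T' i)) \<le> (\<Sum>i=1..b. L \<Omega> (T' i))" using that by (intro sum_mono2) auto
          then show ?thesis by (simp add: S_def w total_L_prefix_map)
        qed
        have "e > D1" using mono[of e D1] s e by (cases "e \<le> D1") auto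
        then obtain d where d: "e = Suc d" "D1 \<le> d" by (cases e) auto
        have dd: "S d \<le> n" "n < S (Suc d)" "d \<le> D2" using e e_min[of d] e_le d by auto
        have Del: "Delta_n \<Omega> n T T' = d"
          using dd d D1 by (intro Delta_n_eqI) (auto simp: S_def w)
        have "take d (map T' [1..<Suc (Suc d)]) = map T' [1..<Suc d]"
          "take (d - t) (map T' [1..<Suc (Suc d)]) = map T' [1..<Suc (d - t)]"
          by (rule take_prefix; simp)+
        then have "\<omega> \<in> E d"
          using \<omega> dd unfolding E_def S_def
          by (auto simp: w prefix_map_def limit_map_def Del simp del: upt_Suc)
        then show ?thesis using d dd by auto
      qed auto
    qed
    show "(\<Union>d\<in>{D1..D2}. E d) \<union> B1 \<union> B2 \<in> sets ?M" using sets by (intro sets.Un sets.finite_UN) auto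
  qed
  also have "\<dots> \<le> measure ?M ((\<Union>d\<in>{D1..D2}. E d) \<union> B1) + measure ?M B2"
    using sets by (intro measure_Un_le) auto
  also have "measure ?M ((\<Union>d\<in>{D1..D2}. E d) \<union> B1) \<le> measure ?M (\<Union>d\<in>{D1..D2}. E d) + measure ?M B1"
    using sets by (intro measure_Un_le) auto
  also have "measure ?M (\<Union>d\<in>{D1..D2}. E d) \<le> (\<Sum>d\<in>{D1..D2}. measure ?M (E d))"
    using sets by (intro measure_UNION_le) auto
  finally show ?thesis
    unfolding E_def B1_def B2_def measure_prefix_map[where P = "\<lambda>z. n < total_L \<Omega> z"]
      measure_prefix_map[where P = "\<lambda>z. total_L \<Omega> z \<le> n"]
      measure_prefix_map[where P = "\<lambda>(T, ts). total_L \<Omega> (T, take d ts) \<le> n \<and> n < total_L \<Omega> (T, ts) \<and> (T, take (d - t) ts, 0) \<in> A" for d]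
    by simp
qed

text \<open>The random element whose conditional law is studied, with a natural number as cutoff.\<close>

definition cond_map :: "real \<Rightarrow> nat \<Rightarrow> ptree \<Rightarrow> mtree \<times> ptree list \<times> nat" where
  "cond_map C t T = (F0 T, take (max_outdeg T - t) (Fs T),
         of_bool (real (\<Sum>i=max_outdeg T - t..max_outdeg T. F_size i T) \<ge> C * real t))"

lemma law_cond_eq:
  assumes pos: "measure_pmf.prob gw {T. L \<Omega> T = n} > 0"
  shows "sets (law_cond \<xi> \<Omega> C n (int t)) = UNIV" and "prob_space (law_cond \<xi> \<Omega> C n (int t))"
    and "measure (law_cond \<xi> \<Omega> C n (int t)) A
       = measure_pmf.prob gw {T. L \<Omega> T = n \<and> cond_map C t T \<in> A} / measure_pmf.prob gw {T. L \<Omega> T = n}"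
proof -
  let ?S = "{T. L \<Omega> T = n}"
  have ne: "set_pmf gw \<inter> ?S \<noteq> {}" using pos by (metis less_irrefl measure_pmf_zero_iff)
  have "GW_cond \<xi> \<Omega> n = spmf_of_pmf (cond_pmf gw ?S)"
    unfolding GW_cond_def GW_eq by (rule spmf_eqI) (simp add: pmf_cond[OF ne])
  then have law: "law_cond \<xi> \<Omega> C n (int t) = measure_pmf (map_pmf (cond_map C t) (cond_pmf gw ?S))"
    unfolding law_cond_def by (simp add: cond_map_def[abs_def] Let_def nat_minus_as_int)
  show "sets (law_cond \<xi> \<Omega> C n (int t)) = UNIV" unfolding law by simp
  show "prob_space (law_cond \<xi> \<Omega> C n (int t))" unfolding law by (rule prob_space_measure_pmf)
  have "measure (law_cond \<xi> \<Omega> C n (int t)) A = measure (cond_pmf gw ?S) (cond_map C t -` A)"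
    unfolding law by simp
  also have "\<dots> = measure_pmf.prob gw (?S \<inter> cond_map C t -` A) / measure_pmf.prob gw ?S"
    unfolding cond_pmf.rep_eq[OF ne] using pos
    by (subst measure_uniform_measure) (auto simp: measure_pmf.emeasure_eq_measure)
  finally show "measure (law_cond \<xi> \<Omega> C n (int t)) A
       = measure_pmf.prob gw {T. L \<Omega> T = n \<and> cond_map C t T \<in> A} / measure_pmf.prob gw {T. L \<Omega> T = n}"
    by (simp add: Int_def)
qed

end

text \<open>For probability measures a one-sided bound for all events is two-sided, by passing to complements.\<close>

lemma tv_dist_le:
  assumes P: "prob_space M" "sets M = UNIV" and Q: "prob_space N" "sets N = UNIV"
    and le: "\<And>A. measure N A \<le> measure M A + \<epsilon>"
  shows "0 \<le> tv_dist M N" "tv_dist M N \<le> \<epsilon>"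
proof -
  interpret M: prob_space M by fact
  interpret N: prob_space N by fact
  have sp: "space M = UNIV" "space N = UNIV"
    using sets.sets_into_space[of UNIV M] sets.sets_into_space[of UNIV N] P Q by auto
  have b: "\<bar>measure M A - measure N A\<bar> \<le> \<epsilon>" for A
  proof -
    have "measure M (- A) = 1 - measure M A" "measure N (- A) = 1 - measure N A"
      using M.prob_compl[of A] N.prob_compl[of A] P Q sp by (auto simp: Compl_eq_Diff_UNIV)
    with le[of A] le[of "- A"] show ?thesis by linarith
  qed
  show "tv_dist M N \<le> \<epsilon>"
    unfolding tv_dist_def using P b by (intro cSUP_least) auto
  have "0 \<le> \<bar>measure M {} - measure N {}\<bar>" by simp
  also have "\<dots> \<le> tv_dist M N"
    unfolding tv_dist_def using P b by (intro cSUP_upper) (auto intro!: bdd_aboveI)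
  finally show "0 \<le> tv_dist M N" .
qed

section \<open>Exact hitting versus first passage\<close>

lemma prob_ge_tendsto_0:
  fixes f :: "'a \<Rightarrow> nat"
  assumes "\<gamma> > 0"
  shows "(\<lambda>n. measure_pmf.prob p {x. real (f x) \<ge> \<gamma> * real n}) \<longlonglongrightarrow> 0"
proof -
  have "(\<lambda>n. measure_pmf.prob p {x. real (f x) \<ge> \<gamma> * real n})
      \<longlonglongrightarrow> measure_pmf.prob p (\<Inter>n. {x. real (f x) \<ge> \<gamma> * real n})"
  proof (rule measure_pmf.finite_Lim_measure_decseq)
    show "decseq (\<lambda>n. {x. real (f x) \<ge> \<gamma> * real n})"
    proof (intro decseq_SucI subsetI)
      fix n x assume "x \<in> {x. real (f x) \<ge> \<gamma> * real (Suc n)}"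
      moreover have "\<gamma> * real n \<le> \<gamma> * real (Suc n)" using assms by (intro mult_left_mono) auto
      ultimately show "x \<in> {x. real (f x) \<ge> \<gamma> * real n}" by simp
    qed
  qed auto
  also have "(\<Inter>n. {x. real (f x) \<ge> \<gamma> * real n}) = {}"
  proof -
    have "\<exists>n. \<not> real (f x) \<ge> \<gamma> * real n" for x
    proof -
      obtain n :: nat where "real n > real (f x) / \<gamma>" using reals_Archimedean2 by blast
      then show ?thesis using assms by (intro exI[of _ n]) (simp add: field_simps)
    qed
    then show ?thesis by blast
  qed
  finally show ?thesis by simp
qed

lemma tail_times_index_tendsto_0:
  fixes p :: "nat pmf"
  assumes "integrable p real"
  shows "(\<lambda>d. real d * measure_pmf.prob p {d..}) \<longlonglongrightarrow> 0"
proof -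
  have lim: "(\<lambda>d. measure_pmf.expectation p (\<lambda>x. real x * indicator {d..} x)) \<longlonglongrightarrow> measure_pmf.expectation p (\<lambda>x. 0)"
  proof (rule integral_dominated_convergence[where w = real])
    show "AE x in p. (\<lambda>d. real x * indicator {d..} x) \<longlonglongrightarrow> 0"
    proof (rule AE_I2)
      fix x
      have "\<forall>\<^sub>F d in sequentially. real x * indicator {d..} x = 0"
        using eventually_gt_at_top[of x] by eventually_elim simp
      then show "(\<lambda>d. real x * indicator {d..} x) \<longlonglongrightarrow> 0" by (rule tendsto_eventually)
    qed
  qed (use assms in \<open>auto simp: indicator_def\<close>)
  show ?thesis
  proof (rule tendsto_sandwich[OF _ _ tendsto_const])
    show "\<forall>\<^sub>F d in sequentially. real d * measure_pmf.prob p {d..} \<le> measure_pmf.expectation p (\<lambda>x. real x * indicator {d..} x)"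
    proof (intro always_eventually allI)
      fix d
      have "real d * measure_pmf.prob p {d..} = measure_pmf.expectation p (\<lambda>x. real d * indicator {d..} x)" by simp
      also have "\<dots> \<le> measure_pmf.expectation p (\<lambda>x. real x * indicator {d..} x)"
      proof (intro integral_mono)
        show "integrable p (\<lambda>x. real d * indicator {d..} x)"
          by (rule measure_pmf.integrable_const_bound[where B = "real d"]) (auto simp: indicator_def)
        show "integrable p (\<lambda>x. real x * indicator {d..} x)"
          by (rule Bochner_Integration.integrable_bound[OF assms]) (auto simp: indicator_def)
      qed (auto simp: indicator_def)
      finally show "real d * measure_pmf.prob p {d..} \<le> measure_pmf.expectation p (\<lambda>x. real x * indicator {d..} x)" .
    qed
    show "(\<lambda>d. measure_pmf.expectation p (\<lambda>x. real x * indicator {d..} x)) \<longlonglongrightarrow> 0" using lim by simp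
  qed (auto intro!: always_eventually)
qed

text \<open>Summing over the value of \<open>f\<close> at the moment before \<open>n\<close> is exceeded.\<close>

lemma gf_pair_overshoot:
  "measure_pmf.prob (pair_pmf p q) {(x, y). P x \<and> f x \<le> n \<and> n < f x + g y}
    = fps_nth (gf p P f * Abs_fps (\<lambda>j. measure_pmf.prob q {y. j < g y})) n"
proof -
  have eq: "{(x, y). P x \<and> f x \<le> n \<and> n < f x + g y}
     = (\<Union>i\<le>n. {x. P x \<and> f x = i} \<times> {y. n - i < g y})"
    by auto
  show ?thesis
    unfolding fps_mult_nth eq atLeast0AtMost gf_nth
    by (subst measure_pmf.finite_measure_finite_Union) (auto simp: disjoint_family_on_def prob_pair_times gf_nth)
qed

lemma l1_le_gf_prob: "l1_le (gf p P f) (measure_pmf.prob p {x. P x})"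
  unfolding l1_le_def by (auto simp: sum_gf_nth abs_of_nonneg intro!: measure_pmf.finite_measure_mono)

text \<open>The standing assumptions. The series \<open>gf_L\<close> describes the steps of the random walk of vertex counts, \<open>gf_L_bullet\<close> its
  starting point, and \<open>mean_L\<close> is its drift.\<close>

locale condensation_tree = subcritical \<xi> + regularly_varying_seq "pmf \<xi>" f \<alpha>
  for \<xi> :: "nat pmf" and f :: "real \<Rightarrow> real" and \<alpha> :: real +
  fixes \<Omega> :: "nat set"
  assumes p0_pos: "pmf \<xi> 0 > 0" and \<Omega>_pos: "measure_pmf.prob \<xi> \<Omega> > 0"
    and \<Omega>_finite: "finite \<Omega> \<or> finite (- \<Omega>)"
begin

definition gf_L :: "real fps" where "gf_L = gf gw (\<lambda>_. True) (L \<Omega>)"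
definition gf_L_bullet :: "real fps" where "gf_L_bullet = gf bullet (\<lambda>_. True) (\<lambda>T. L \<Omega> (fst T))"
text \<open>A bound, uniform in the point, for the expected number of visits of the walk to a point.\<close>

definition renewal_bound :: real where "renewal_bound = 1 / (1 - fps_nth gf_L 0)"
definition mean_L :: real where "mean_L = measure_pmf.expectation gw (\<lambda>T. real (L \<Omega> T))"
definition gf_tail :: "real fps" where "gf_tail = Abs_fps (\<lambda>j. measure_pmf.prob gw {T. j < L \<Omega> T})"

lemma gf_L_nonneg [simp]: "fps_nth gf_L k \<ge> 0" by (simp add: gf_L_def)
lemma gf_L_bullet_nonneg [simp]: "fps_nth gf_L_bullet k \<ge> 0" by (simp add: gf_L_bullet_def)
lemma l1_le_gf_L: "l1_le gf_L 1" unfolding gf_L_def by (rule l1_le_gf)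
lemma l1_le_gf_L_bullet: "l1_le gf_L_bullet 1" unfolding gf_L_bullet_def by (rule l1_le_gf)

lemma adjacent: "\<exists>a. fps_nth gf_L a > 0 \<and> fps_nth gf_L (a + 1) > 0"
  using L_adjacent_values[OF p0_pos eventually_p_pos \<Omega>_pos \<Omega>_finite] by (simp add: gf_L_def gf_nth)

lemma gf_L_0_less_1: "fps_nth gf_L 0 < 1"
proof -
  obtain a where a: "fps_nth gf_L (a + 1) > 0" using adjacent by blast
  have "fps_nth gf_L 0 + fps_nth gf_L (a + 1) = (\<Sum>k\<in>{0, a + 1}. \<bar>fps_nth gf_L k\<bar>)" by simp
  also have "\<dots> \<le> (\<Sum>k\<le>a + 1. \<bar>fps_nth gf_L k\<bar>)" by (intro sum_mono2) auto
  also have "\<dots> \<le> 1" by (rule l1_leD[OF l1_le_gf_L])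
  finally show ?thesis using a by simp
qed

lemma renewal_bound_pos: "renewal_bound > 0" using gf_L_0_less_1 by (simp add: renewal_bound_def)

lemma gf_tail_sums: "(\<lambda>j. measure_pmf.prob gw {T. j < L \<Omega> T}) sums mean_L"
proof -
  let ?f = "\<lambda>j. measure_pmf.prob gw {T. j < L \<Omega> T}"
  have "ennreal mean_L = (\<integral>\<^sup>+T. ennreal (real (L \<Omega> T)) \<partial>gw)"
    unfolding mean_L_def by (intro nn_integral_eq_integral[symmetric] integrable_L) auto
  also have "\<dots> = (\<integral>\<^sup>+T. of_nat (L \<Omega> T) \<partial>gw)"
    by (simp only: ennreal_of_nat_eq_real_of_nat)
  also have "\<dots> = (\<Sum>j. emeasure gw {T \<in> space gw. j < L \<Omega> T})"
    by (rule nn_integral_nat_function) simp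
  also have "\<dots> = (\<Sum>j. ennreal (?f j))"
    by (simp only: measure_pmf.emeasure_eq_measure space_measure_pmf UNIV_I simp_thms)
  finally have *: "(\<Sum>j. ennreal (?f j)) = ennreal mean_L" by (rule sym)
  have s: "summable ?f"
    by (rule summable_suminf_not_top) (simp_all only: * measure_nonneg ennreal_neq_top not_False_eq_True)
  have "(\<Sum>j. ennreal (?f j)) = ennreal (\<Sum>j. ?f j)"
    by (rule suminf_ennreal2[OF _ s]) (rule measure_nonneg)
  from trans[OF this[symmetric] *] have e: "ennreal (\<Sum>j. ?f j) = ennreal mean_L" .
  have "(\<Sum>j. ?f j) = mean_L"
  proof (rule ennreal_inj[THEN iffD1, OF _ _ e])
    show "0 \<le> (\<Sum>j. ?f j)" by (rule suminf_nonneg[OF s]) (rule measure_nonneg)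
    show "0 \<le> mean_L" unfolding mean_L_def by (intro Bochner_Integration.integral_nonneg) auto
  qed
  with summable_sums[OF s] show ?thesis by simp
qed

lemma mean_L_pos: "mean_L > 0"
proof -
  have "1 - fps_nth gf_L 0 \<le> mean_L"
  proof -
    have "1 - fps_nth gf_L 0 = measure_pmf.prob gw {T. 0 < L \<Omega> T}"
      using measure_pmf.prob_compl[of "{T. L \<Omega> T = 0}" gw]
      by (simp add: gf_L_def gf_nth Compl_eq_Diff_UNIV[symmetric] Collect_neg_eq[symmetric])
    also have "\<dots> = (\<Sum>j<1. measure_pmf.prob gw {T. j < L \<Omega> T})" by simp
    also have "\<dots> \<le> (\<Sum>j. measure_pmf.prob gw {T. j < L \<Omega> T})"
      using gf_tail_sums by (intro sum_le_suminf) (auto simp: sums_iff)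
    also have "\<dots> = mean_L" using gf_tail_sums by (simp add: sums_iff)
    finally show ?thesis .
  qed
  then show ?thesis using gf_L_0_less_1 by simp
qed

text \<open>Thus the series \<open>gf_L ^ d * gf_tail\<close> telescope when summed over \<open>d\<close>.\<close>

lemma gf_tail_eq: "gf_tail = (1 - gf_L) * Abs_fps (\<lambda>_. 1)"
proof (rule fps_ext)
  fix j
  have "measure_pmf.prob gw {T. j < L \<Omega> T} = 1 - measure_pmf.prob gw {T. L \<Omega> T \<le> j}"
    using measure_pmf.prob_compl[of "{T. L \<Omega> T \<le> j}" gw]
    by (simp add: Compl_eq_Diff_UNIV[symmetric] Collect_neg_eq[symmetric] not_le)
  also have "measure_pmf.prob gw {T. L \<Omega> T \<le> j} = (\<Sum>i\<le>j. fps_nth gf_L i)"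
    by (simp add: gf_L_def sum_gf_nth)
  finally show "fps_nth gf_tail j = fps_nth ((1 - gf_L) * Abs_fps (\<lambda>_. 1)) j"
    unfolding gf_tail_def left_diff_distrib fps_sub_nth fps_mult_ones_nth[of gf_L] by simp
qed

text \<open>Every starting law, even a defective one, can be put in front of the walk.\<close>

lemma renewal_le:
  assumes "\<And>k. fps_nth F k \<ge> 0" "l1_le F c" "finite I" "inj_on g I"
  shows "(\<Sum>d\<in>I. fps_nth (F * gf_L ^ g d) k) \<le> c * renewal_bound"
proof -
  have "(\<Sum>d\<in>I. fps_nth (F * gf_L ^ g d) k) = (\<Sum>i\<le>k. fps_nth F i * (\<Sum>d\<in>I. fps_nth (gf_L ^ g d) (k - i)))"
    unfolding fps_mult_nth atLeast0AtMost by (subst sum.swap) (simp add: sum_distrib_left)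
  also have "\<dots> \<le> (\<Sum>i\<le>k. fps_nth F i * renewal_bound)"
  proof (intro sum_mono mult_left_mono assms)
    fix i
    have "(\<Sum>d\<in>I. fps_nth (gf_L ^ g d) (k - i)) = (\<Sum>d\<in>g ` I. fps_nth (gf_L ^ d) (k - i))"
      using assms by (simp add: sum.reindex)
    also have "\<dots> \<le> renewal_bound" unfolding renewal_bound_def using assms
      by (intro renewal_sum_le l1_le_gf_L gf_L_0_less_1) auto
    finally show "(\<Sum>d\<in>I. fps_nth (gf_L ^ g d) (k - i)) \<le> renewal_bound" .
  qed
  also have "\<dots> = (\<Sum>i\<le>k. \<bar>fps_nth F i\<bar>) * renewal_bound" using assms by (simp add: sum_distrib_right)
  also have "\<dots> \<le> c * renewal_bound" using l1_leD[OF assms(2)] renewal_bound_pos by (intro mult_right_mono) auto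
  finally show ?thesis .
qed

lemma forest_add:
  "forest (m + k) = map_pmf (\<lambda>((T, xs), ys). (T, xs @ ys)) (pair_pmf (forest m) (replicate_pmf k gw))"
  unfolding replicate_pmf_add_pair
  by (simp add: pair_pmf_def map_pmf_def bind_assoc_pmf bind_return_pmf)

lemma total_L_append: "total_L \<Omega> (T, xs @ ys) = total_L \<Omega> (T, xs) + sum_list (map (L \<Omega>) ys)"
  by (simp add: total_L_def)

lemma gf_forest_add:
  "gf (forest (m + k)) (\<lambda>(T, ts). P (T, take m ts) \<and> Q (drop m ts)) (total_L \<Omega>)
    = gf (forest m) P (total_L \<Omega>) * gf (replicate_pmf k gw) Q (\<lambda>ts. sum_list (map (L \<Omega>) ts))"
proof -
  have "gf (forest (m + k)) (\<lambda>(T, ts). P (T, take m ts) \<and> Q (drop m ts)) (total_L \<Omega>)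
     = gf (pair_pmf (forest m) (replicate_pmf k gw)) (\<lambda>(x, y). P x \<and> Q y) (\<lambda>(x, y). total_L \<Omega> x + sum_list (map (L \<Omega>) y))"
    unfolding forest_add gf_map_pmf
  proof (rule gf_cong)
    fix z assume z: "z \<in> set_pmf (pair_pmf (forest m) (replicate_pmf k gw))"
    obtain T xs ys where zz: "z = ((T, xs), ys)" by (metis prod.exhaust)
    have "length xs = m" using z unfolding zz by (auto dest: length_replicate_pmf)
    then show "(case case z of (x, xa) \<Rightarrow> (case x of (T, xs) \<Rightarrow> \<lambda>ys. (T, xs @ ys)) xa of (T, ts) \<Rightarrow> P (T, take m ts) \<and> Q (drop m ts)) =
         (case z of (x, y) \<Rightarrow> P x \<and> Q y)"
      by (simp add: zz)
  qed (auto simp: total_L_append)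
  then show ?thesis by (simp only: gf_pair)
qed

lemma gf_forest_bul:
  "gf (forest d) (\<lambda>(T, ts). P T \<and> Q ts) (total_L \<Omega>)
    = gf bullet P (\<lambda>T. L \<Omega> (fst T)) * gf (replicate_pmf d gw) Q (\<lambda>ts. sum_list (map (L \<Omega>) ts))"
  unfolding gf_pair[symmetric] by (rule gf_cong) (auto simp: total_L_def)

lemma gf_replicate_L: "gf (replicate_pmf d gw) (\<lambda>_. True) (\<lambda>ts. sum_list (map (L \<Omega>) ts)) = gf_L ^ d"
  unfolding gf_L_def by (rule gf_replicate)

lemma gf_forest: "gf (forest d) (\<lambda>_. True) (total_L \<Omega>) = gf_L_bullet * gf_L ^ d"
  using gf_forest_bul[of d "\<lambda>_. True" "\<lambda>_. True"] by (simp add: gf_replicate_L gf_L_bullet_def split_def)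

lemma prob_forest: "measure_pmf.prob (forest d) {z. total_L \<Omega> z = k} = fps_nth (gf_L_bullet * gf_L ^ d) k"
  unfolding gf_forest[symmetric] by (simp add: gf_nth)

lemma prob_forest_le: "measure_pmf.prob (forest d) {z. total_L \<Omega> z \<le> k} = (\<Sum>i\<le>k. fps_nth (gf_L_bullet * gf_L ^ d) i)"
  unfolding gf_forest[symmetric] by (simp add: sum_gf_nth)

lemma sum_forest_le_above:
  assumes "finite I" "\<And>d. d \<in> I \<Longrightarrow> D \<le> d"
  shows "(\<Sum>d\<in>I. measure_pmf.prob (forest d) {z. total_L \<Omega> z = k}) \<le> renewal_bound * measure_pmf.prob (forest D) {z. total_L \<Omega> z \<le> k}"
proof -
  have "(\<Sum>d\<in>I. measure_pmf.prob (forest d) {z. total_L \<Omega> z = k})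
      = (\<Sum>i\<le>k. fps_nth gf_L_bullet i * (\<Sum>d\<in>I. fps_nth (gf_L ^ d) (k - i)))"
    unfolding prob_forest fps_mult_nth atLeast0AtMost by (subst sum.swap) (simp add: sum_distrib_left)
  also have "\<dots> \<le> (\<Sum>i\<le>k. fps_nth gf_L_bullet i * (renewal_bound * (\<Sum>j\<le>k - i. fps_nth (gf_L ^ D) j)))"
    unfolding renewal_bound_def by (intro sum_mono mult_left_mono renewal_tail_sum_le l1_le_gf_L gf_L_0_less_1 assms) auto
  also have "\<dots> = renewal_bound * (\<Sum>i\<le>k. fps_nth gf_L_bullet i * (\<Sum>j\<le>k - i. fps_nth (gf_L ^ D) j))"
    by (simp add: sum_distrib_left mult_ac)
  also have "(\<Sum>i\<le>k. fps_nth gf_L_bullet i * (\<Sum>j\<le>k - i. fps_nth (gf_L ^ D) j)) = fps_nth (gf_L_bullet * (gf_L ^ D * Abs_fps (\<lambda>_. 1))) k"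
    by (subst fps_mult_nth) (simp add: fps_mult_ones_nth atLeast0AtMost)
  also have "\<dots> = measure_pmf.prob (forest D) {z. total_L \<Omega> z \<le> k}"
    by (simp only: mult.assoc[symmetric] fps_mult_ones_nth prob_forest_le)
  finally show ?thesis .
qed

lemma sum_forest_le_below:
  assumes "finite I" "\<And>d. d \<in> I \<Longrightarrow> d \<le> D"
  shows "(\<Sum>d\<in>I. measure_pmf.prob (forest d) {z. total_L \<Omega> z = k}) \<le> renewal_bound * measure_pmf.prob (forest D) {z. k \<le> total_L \<Omega> z}"
proof -
  have "(\<Sum>d\<in>I. measure_pmf.prob (forest d) {z. total_L \<Omega> z = k})
      \<le> (\<Sum>d\<le>D. measure_pmf.prob (forest d) {z. total_L \<Omega> z = k})"
    using assms by (intro sum_mono2) auto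
  also have "\<dots> = (\<Sum>i\<le>k. fps_nth gf_L_bullet i * (\<Sum>d\<le>D. fps_nth (gf_L ^ d) (k - i)))"
    unfolding prob_forest fps_mult_nth atLeast0AtMost by (subst sum.swap) (simp add: sum_distrib_left)
  also have "\<dots> \<le> (\<Sum>i\<le>k. fps_nth gf_L_bullet i * (renewal_bound * (1 - (\<Sum>j<k - i. fps_nth (gf_L ^ D) j))))"
    unfolding renewal_bound_def by (intro sum_mono mult_left_mono renewal_partial_sum_le l1_le_gf_L gf_L_0_less_1) auto
  also have "\<dots> = renewal_bound * ((\<Sum>i\<le>k. fps_nth gf_L_bullet i) - (\<Sum>i\<le>k. fps_nth gf_L_bullet i * (\<Sum>j<k - i. fps_nth (gf_L ^ D) j)))"
    by (simp add: sum_distrib_left sum_subtractf[symmetric] algebra_simps)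
  also have "(\<Sum>i\<le>k. fps_nth gf_L_bullet i * (\<Sum>j<k - i. fps_nth (gf_L ^ D) j)) = fps_nth (gf_L_bullet * (gf_L ^ D * fps_X * Abs_fps (\<lambda>_. 1))) k"
    by (subst fps_mult_nth) (simp only: fps_mult_X_ones_nth atLeast0AtMost)
  also have "\<dots> = (\<Sum>i<k. fps_nth (gf_L_bullet * gf_L ^ D) i)"
    by (simp only: mult.assoc[symmetric] fps_mult_X_ones_nth)
  also have "(\<Sum>i\<le>k. fps_nth gf_L_bullet i) \<le> 1" using l1_leD[OF l1_le_gf_L_bullet, of k] by simp
  also have "1 - (\<Sum>i<k. fps_nth (gf_L_bullet * gf_L ^ D) i) = measure_pmf.prob (forest D) {z. k \<le> total_L \<Omega> z}"
  proof -
    have "(\<Sum>i<k. fps_nth (gf_L_bullet * gf_L ^ D) i) = measure_pmf.prob (forest D) {z. total_L \<Omega> z < k}"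
      unfolding gf_forest[symmetric] by (simp add: sum_gf_nth)
    then show ?thesis
      using measure_pmf.prob_compl[of "{z. total_L \<Omega> z < k}" "forest D"]
      by (simp add: Compl_eq_Diff_UNIV[symmetric] Collect_neg_eq[symmetric] not_less)
  qed
  finally show ?thesis using renewal_bound_pos by simp
qed

text \<open>The probability that \<open>Delta_n\<close> equals \<open>d\<close> and the observed part of the limit model satisfies \<open>P\<close>,
  expressed through a finite forest.\<close>

definition overshoot_prob :: "(mtree \<times> ptree list \<Rightarrow> bool) \<Rightarrow> nat \<Rightarrow> nat \<Rightarrow> nat \<Rightarrow> real" where
  "overshoot_prob P d t n = measure_pmf.prob (forest (Suc d))
     {(T, ts). total_L \<Omega> (T, take d ts) \<le> n \<and> n < total_L \<Omega> (T, ts) \<and> P (T, take (d - t) ts)}"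

lemma overshoot_prob_eq:
  assumes "t \<le> d"
  shows "overshoot_prob P d t n = fps_nth (gf (forest (d - t)) P (total_L \<Omega>) * gf_L ^ t * gf_tail) n"
proof -
  have f1: "forest (Suc d) = map_pmf (\<lambda>((T, xs), ys). (T, xs @ ys)) (pair_pmf (forest d) (replicate_pmf 1 gw))"
    using forest_add[of d 1] by simp
  have r1: "replicate_pmf 1 gw = map_pmf (\<lambda>x. [x]) gw" by (rule replicate_pmf_1)
  have "pair_pmf (forest d) (map_pmf (\<lambda>x. [x]) gw) = map_pmf (\<lambda>(z, x). (z, [x])) (pair_pmf (forest d) gw)"
    by (simp add: pair_map_pmf2 apsnd_def map_prod_def)
  then have f2: "forest (Suc d) = map_pmf (\<lambda>((T, xs), x). (T, xs @ [x])) (pair_pmf (forest d) gw)"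
    unfolding f1 r1 by (simp add: map_pmf_comp o_def case_prod_unfold)
  have "overshoot_prob P d t n = measure_pmf.prob (pair_pmf (forest d) gw)
      {(z, y). (case z of (T, ts) \<Rightarrow> P (T, take (d - t) ts)) \<and> total_L \<Omega> z \<le> n \<and> n < total_L \<Omega> z + L \<Omega> y}"
    unfolding overshoot_prob_def f2 measure_map_pmf
  proof (rule measure_pmf.finite_measure_eq_AE)
    show "AE x in pair_pmf (forest d) gw.
       (x \<in> (\<lambda>((T, xs), x). (T, xs @ [x])) -`
             {(T, ts). total_L \<Omega> (T, take d ts) \<le> n \<and> n < total_L \<Omega> (T, ts) \<and> P (T, take (d - t) ts)}) =
       (x \<in> {(z, y). (case z of (T, ts) \<Rightarrow> P (T, take (d - t) ts)) \<and> total_L \<Omega> z \<le> n \<and> n < total_L \<Omega> z + L \<Omega> y})"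
      unfolding AE_measure_pmf_iff
    proof
      fix x assume x: "x \<in> set_pmf (pair_pmf (forest d) gw)"
      obtain T xs y where xx: "x = ((T, xs), y)" by (metis prod.exhaust)
      have "length xs = d" using x unfolding xx by (auto dest: length_replicate_pmf)
      then show "(x \<in> (\<lambda>((T, xs), x). (T, xs @ [x])) -`
             {(T, ts). total_L \<Omega> (T, take d ts) \<le> n \<and> n < total_L \<Omega> (T, ts) \<and> P (T, take (d - t) ts)}) =
       (x \<in> {(z, y). (case z of (T, ts) \<Rightarrow> P (T, take (d - t) ts)) \<and> total_L \<Omega> z \<le> n \<and> n < total_L \<Omega> z + L \<Omega> y})"
        by (auto simp: xx total_L_append)
    qed
  qed auto
  also have "\<dots> = fps_nth (gf (forest d) (\<lambda>(T, ts). P (T, take (d - t) ts)) (total_L \<Omega>) * gf_tail) n"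
    unfolding gf_tail_def by (rule gf_pair_overshoot)
  also have "gf (forest d) (\<lambda>(T, ts). P (T, take (d - t) ts)) (total_L \<Omega>) = gf (forest (d - t)) P (total_L \<Omega>) * gf_L ^ t"
    using gf_forest_add[of "d - t" t P "\<lambda>_. True"] assms by (simp add: gf_replicate_L)
  finally show ?thesis .
qed

text \<open>The walk passes \<open>n\<close> at most once.\<close>

lemma sum_overshoot_prob_le_1:
  assumes "D1 \<le> D2"
  shows "(\<Sum>d\<in>{D1..D2}. overshoot_prob (\<lambda>_. True) d 0 n) \<le> 1"
proof -
  have "(\<Sum>d\<in>{D1..D2}. overshoot_prob (\<lambda>_. True) d 0 n) = fps_nth (\<Sum>d\<in>{D1..D2}. gf_L_bullet * gf_L ^ d * gf_tail) n"
    by (simp add: overshoot_prob_eq gf_forest fps_sum_nth)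
  also have "(\<Sum>d\<in>{D1..D2}. gf_L_bullet * gf_L ^ d * gf_tail) = (gf_L_bullet * gf_L ^ D1 - gf_L_bullet * gf_L ^ Suc D2) * Abs_fps (\<lambda>_. 1)"
  proof -
    have "(\<Sum>d\<in>{D1..D2}. gf_L_bullet * gf_L ^ d * gf_tail) = (\<Sum>d\<in>{D1..D2}. gf_L_bullet * gf_L ^ d * Abs_fps (\<lambda>_. 1) - gf_L_bullet * gf_L ^ Suc d * Abs_fps (\<lambda>_. 1))"
      unfolding gf_tail_eq by (intro sum.cong refl) (simp add: algebra_simps)
    also have "\<dots> = gf_L_bullet * gf_L ^ D1 * Abs_fps (\<lambda>_. 1) - gf_L_bullet * gf_L ^ Suc D2 * Abs_fps (\<lambda>_. 1)"
      using sum_natinterval_diff[of "\<lambda>d. gf_L_bullet * gf_L ^ d * Abs_fps (\<lambda>_. 1)" D1 D2] assms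
      by (simp only: Suc_eq_plus1 if_True)
    finally show ?thesis by (simp only: left_diff_distrib)
  qed
  also have "fps_nth \<dots> n = measure_pmf.prob (forest D1) {z. total_L \<Omega> z \<le> n} - measure_pmf.prob (forest (Suc D2)) {z. total_L \<Omega> z \<le> n}"
    unfolding left_diff_distrib fps_sub_nth fps_mult_ones_nth prob_forest_le ..
  also have "\<dots> \<le> 1" by (simp add: add_increasing2 measure_pmf.prob_le_1 diff_le_eq)
  finally show ?thesis .
qed

text \<open>The counterpart of \<open>overshoot_prob\<close> for the conditioned tree. The parameter corrects the count for the replaced
  leaf; with \<open>Suc n\<close> on the right it can be a natural number although the correction may have either sign.\<close>

definition hit_prob :: "nat \<Rightarrow> (mtree \<times> ptree list \<Rightarrow> bool) \<Rightarrow> nat \<Rightarrow> nat \<Rightarrow> nat \<Rightarrow> real" where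
  "hit_prob offset P d t n = measure_pmf.prob (forest d) {(T, ts). total_L \<Omega> (T, ts) + offset = Suc n \<and> P (T, take (d - t) ts)}"

lemma hit_prob_eq:
  assumes "t \<le> d"
  shows "hit_prob offset P d t n = fps_nth (gf (forest (d - t)) P (total_L \<Omega>) * gf_L ^ t * fps_X ^ offset) (Suc n)"
proof -
  have "gf (forest d) (\<lambda>(T, ts). P (T, take (d - t) ts)) (total_L \<Omega>) = gf (forest (d - t)) P (total_L \<Omega>) * gf_L ^ t"
    using gf_forest_add[of "d - t" t P "\<lambda>_. True"] assms by (simp add: gf_replicate_L)
  note e = this
  have "fps_nth (gf (forest (d - t)) P (total_L \<Omega>) * gf_L ^ t * fps_X ^ offset) (Suc n) =
     (if offset \<le> Suc n then measure_pmf.prob (forest d) {z. (\<lambda>(T, ts). P (T, take (d - t) ts)) z \<and> total_L \<Omega> z = Suc n - offset} else 0)"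
    unfolding e[symmetric] by (auto simp: fps_X_power_mult_right_nth gf_nth)
  also have "\<dots> = hit_prob offset P d t n"
    unfolding hit_prob_def by (auto intro!: arg_cong[of _ _ "measure_pmf.prob (forest d)"])
  finally show ?thesis by simp
qed

text \<open>Splitting off the last \<open>t\<close> trees exhibits both probabilities as coefficients of a common
  series, describing the observed part, times \<open>gf_L ^ t * fps_X ^ offset\<close> and \<open>gf_L ^ t * fps_X * gf_tail\<close> respectively. The
  difference of these, with the factor \<open>mean_L\<close>, is small in the sum norm, and the observed parts for
  different \<open>d\<close> together visit each point a bounded number of times.\<close>

lemma hit_overshoot_compare:
  assumes I: "finite I" "\<And>d. d \<in> I \<Longrightarrow> t \<le> d"
    and l1: "l1_le (gf_L ^ t * (fps_const mean_L * fps_X ^ offset - fps_X * gf_tail)) e"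
  shows "\<bar>mean_L * (\<Sum>d\<in>I. hit_prob offset (P d) d t n) - (\<Sum>d\<in>I. overshoot_prob (P d) d t n)\<bar> \<le> renewal_bound * e"
proof -
  define E where "E = gf_L ^ t * (fps_const mean_L * fps_X ^ offset - fps_X * gf_tail)"
  define B where "B d = gf (forest (d - t)) (P d) (total_L \<Omega>)" for d
  have eq: "mean_L * hit_prob offset (P d) d t n - overshoot_prob (P d) d t n = fps_nth (B d * E) (Suc n)" if "d \<in> I" for d
  proof -
    have "B d * E = fps_const mean_L * (B d * gf_L ^ t * fps_X ^ offset) - fps_X * (B d * gf_L ^ t * gf_tail)"
      by (simp add: E_def algebra_simps)
    then show ?thesis
      unfolding hit_prob_eq[OF I(2)[OF that]] overshoot_prob_eq[OF I(2)[OF that]] B_def[symmetric]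
      by (simp only: fps_sub_nth fps_mult_left_const_nth fps_X_mult_nth nat.distinct if_False diff_Suc_1)
  qed
  have "\<bar>mean_L * (\<Sum>d\<in>I. hit_prob offset (P d) d t n) - (\<Sum>d\<in>I. overshoot_prob (P d) d t n)\<bar>
     = \<bar>\<Sum>d\<in>I. fps_nth (B d * E) (Suc n)\<bar>"
    by (simp add: eq[symmetric] sum_subtractf sum_distrib_left)
  also have "\<dots> \<le> (\<Sum>d\<in>I. \<bar>fps_nth (B d * E) (Suc n)\<bar>)" by (rule sum_abs)
  also have "\<dots> \<le> (\<Sum>d\<in>I. \<Sum>i\<le>Suc n. \<bar>fps_nth E i\<bar> * fps_nth (gf_L_bullet * gf_L ^ (d - t)) (Suc n - i))"
  proof (intro sum_mono)
    fix d assume d: "d \<in> I"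
    have "\<bar>fps_nth (B d * E) (Suc n)\<bar> = \<bar>fps_nth (E * B d) (Suc n)\<bar>" by (simp only: mult.commute)
    also have "\<dots> \<le> (\<Sum>i\<le>Suc n. \<bar>fps_nth E i * fps_nth (B d) (Suc n - i)\<bar>)"
      unfolding fps_mult_nth atLeast0AtMost by (rule sum_abs)
    also have "\<dots> \<le> (\<Sum>i\<le>Suc n. \<bar>fps_nth E i\<bar> * fps_nth (gf_L_bullet * gf_L ^ (d - t)) (Suc n - i))"
      unfolding gf_forest[symmetric] B_def
      by (intro sum_mono) (auto simp: abs_mult abs_of_nonneg intro!: mult_left_mono gf_mono)
    finally show "\<bar>fps_nth (B d * E) (Suc n)\<bar> \<le> (\<Sum>i\<le>Suc n. \<bar>fps_nth E i\<bar> * fps_nth (gf_L_bullet * gf_L ^ (d - t)) (Suc n - i))" .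
  qed
  also have "\<dots> = (\<Sum>i\<le>Suc n. \<bar>fps_nth E i\<bar> * (\<Sum>d\<in>I. fps_nth (gf_L_bullet * gf_L ^ (d - t)) (Suc n - i)))"
    by (subst sum.swap) (simp add: sum_distrib_left)
  also have "\<dots> \<le> (\<Sum>i\<le>Suc n. \<bar>fps_nth E i\<bar> * (1 * renewal_bound))"
  proof (intro sum_mono mult_left_mono renewal_le l1_le_gf_L_bullet I)
    show "inj_on (\<lambda>d. d - t) I" using I(2) by (rule inj_on_diff_nat)
  qed auto
  also have "\<dots> = (\<Sum>i\<le>Suc n. \<bar>fps_nth E i\<bar>) * renewal_bound" by (simp only: sum_distrib_right mult_1_left)
  also have "\<dots> \<le> e * renewal_bound" unfolding E_def using renewal_bound_pos by (intro mult_right_mono l1_leD[OF l1]) simp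
  finally show ?thesis by (simp only: mult.commute)
qed

lemma smoothing:
  assumes "e > 0"
  shows "\<forall>\<^sub>F t in sequentially. l1_le (gf_L ^ t * (fps_const mean_L * fps_X ^ offset - fps_X * gf_tail)) e"
proof -
  obtain a where "fps_nth gf_L a > 0" "fps_nth gf_L (a + 1) > 0" using adjacent by blast
  from power_shift_l1_tendsto_0[OF gf_L_nonneg l1_le_gf_L this] obtain \<sigma> where
    "\<sigma> \<longlonglongrightarrow> 0" "\<And>t. l1_le (gf_L ^ t * (1 - fps_X)) (\<sigma> t)" by blast
  from tail_smoothing_l1[OF this l1_le_gf_L _ gf_tail_sums assms] show ?thesis
    unfolding gf_tail_def by simp
qed

end

section \<open>From marked forests to trees\<close>

context condensation_tree
begin

text \<open>From \<open>deg0\<close> on, membership of degrees in \<open>\<Omega>\<close> is constant.\<close>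

definition deg0 :: nat where "deg0 = (SOME N. \<forall>k\<ge>N. (k \<in> \<Omega>) = (N \<in> \<Omega>))"
text \<open>Grafting \<open>d\<close> trees replaces a leaf by a vertex of large outdegree \<open>d\<close>, which changes the count by a constant in
  \<open>{-1, 0, 1}\<close>; adding one makes the correction a natural number.\<close>

definition offset :: nat where "offset = Suc (of_bool (deg0 \<in> \<Omega>)) - of_bool (0 \<in> \<Omega>)"

lemma deg0: "k \<ge> deg0 \<Longrightarrow> (k \<in> \<Omega>) = (deg0 \<in> \<Omega>)"
  using someI_ex[OF eventually_constant_membership[OF \<Omega>_finite]] unfolding deg0_def by blast

lemma offset_le_2: "offset \<le> 2" by (simp add: offset_def)

lemma L_graft_iff:
  assumes "marked_leaf v T" "length ts \<ge> deg0"
  shows "L \<Omega> (graft v T ts) = n \<longleftrightarrow> total_L \<Omega> ((T, v), ts) + offset = Suc n"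
  using L_graft[OF assms(1), of \<Omega> ts] deg0[OF assms(2)] by (auto simp: total_L_def offset_def)

text \<open>Cutting at the first vertex of maximal outdegree is injective, and dropping the maximality requirement gives an upper bound.\<close>

lemma prob_max_outdeg_eq_le:
  assumes "d \<ge> deg0"
  shows "measure_pmf.prob gw {T. L \<Omega> T = n \<and> max_outdeg T = d}
    \<le> pmf \<xi> d / (1 - mean \<xi>) * measure_pmf.prob (forest d) {z. total_L \<Omega> z + offset = Suc n}"
proof -
  let ?g = "\<lambda>((T, v), ts). graft v T ts"
  define X where "X = {T. L \<Omega> T = n \<and> max_outdeg T = d}"
  define S where "S = (\<lambda>T. (F0 T, Fs T)) ` X"
  have g: "?g (F0 T, Fs T) = T" for T
    using graft_F0_Fs[of T] by (cases "F0 T") auto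
  have gS: "?g ` S = X" unfolding S_def image_image g by simp
  have inj: "inj_on ?g S"
  proof (rule inj_on_inverseI[where g = "\<lambda>T. (F0 T, Fs T)"])
    fix z assume "z \<in> S"
    then obtain T where z: "z = (F0 T, Fs T)" unfolding S_def by blast
    show "(F0 (?g z), Fs (?g z)) = z" unfolding z g ..
  qed
  have S: "marked_leaf v T \<and> length ts = d \<and> L \<Omega> (graft v T ts) = n" if "((T, v), ts) \<in> S" for T v ts
  proof -
    from that obtain T0 where T0: "T0 \<in> X" "F0 T0 = (T, v)" "Fs T0 = ts" by (auto simp: S_def)
    then show ?thesis using marked_leaf_F0[of T0] length_Fs[of T0] graft_F0_Fs[of T0] by (auto simp: X_def)
  qed
  have "measure_pmf.prob gw X = pmf \<xi> d / (1 - mean \<xi>) * measure_pmf.prob (forest d) S"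
    unfolding gS[symmetric] using S inj by (intro prob_graft_image) auto
  also have "\<dots> \<le> pmf \<xi> d / (1 - mean \<xi>) * measure_pmf.prob (forest d) {z. total_L \<Omega> z + offset = Suc n}"
  proof (intro mult_left_mono measure_pmf.finite_measure_mono)
    show "S \<subseteq> {z. total_L \<Omega> z + offset = Suc n}"
    proof
      fix z assume z: "z \<in> S"
      obtain T v ts where zz: "z = ((T, v), ts)" by (metis prod.exhaust)
      show "z \<in> {z. total_L \<Omega> z + offset = Suc n}"
        using S[of T v ts] L_graft_iff[of v T ts n] z assms unfolding zz by auto
    qed
  qed (use mean_less_1 in auto)
  finally show ?thesis by (simp add: X_def)
qed

text \<open>Forests from which a tree with the right data can be grafted: no other vertex reaches the outdegree \<open>d\<close>, and the last \<open>t + 1\<close>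
  trees are not too large. The sum in the statement starts at the index \<open>d - t\<close>, hence drops \<open>d - t - 1\<close> trees.\<close>

definition good_set :: "nat \<Rightarrow> nat \<Rightarrow> nat \<Rightarrow> real \<Rightarrow> (mtree \<times> ptree list \<times> nat) set \<Rightarrow> (mtree \<times> ptree list) set" where
  "good_set d t n C S = {((T, v), ts). marked_leaf v T \<and> length ts = d \<and> max_outdeg T < d \<and>
     (\<forall>x\<in>set ts. max_outdeg x < d) \<and> total_L \<Omega> ((T, v), ts) + offset = Suc n \<and>
     real (sum_list (map num_vertices (drop (d - t - 1) ts))) < C * real t \<and> ((T, v), take (d - t) ts, 0) \<in> S}"

lemma good_set_props:
  assumes z: "((T, v), ts) \<in> good_set d t n C S" and d: "d \<ge> deg0" "d > t"
  shows "max_outdeg (graft v T ts) = d" "F0 (graft v T ts) = (T, v)" "Fs (graft v T ts) = ts"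
    "L \<Omega> (graft v T ts) = n" "cond_map C t (graft v T ts) \<in> S"
proof -
  have *: "marked_leaf v T" "length ts = d" "max_outdeg T < length ts" "\<forall>x\<in>set ts. max_outdeg x < length ts"
    "total_L \<Omega> ((T, v), ts) + offset = Suc n"
     "real (sum_list (map num_vertices (drop (d - t - 1) ts))) < C * real t" "((T, v), take (d - t) ts, 0) \<in> S"
    using z by (auto simp: good_set_def)
  note gm = graft_maximal[OF *(1,3,4)]
  show "max_outdeg (graft v T ts) = d" "F0 (graft v T ts) = (T, v)" "Fs (graft v T ts) = ts"
    using gm *(2) by auto
  show "L \<Omega> (graft v T ts) = n" using L_graft_iff[OF *(1)] *(2,5) d by simp
  have "(\<Sum>i=d - t..d. F_size i (graft v T ts)) = sum_list (map num_vertices (drop (d - t - 1) ts))"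
    using sum_F_size[of "d - t" "graft v T ts"] gm *(2) d by simp
  then show "cond_map C t (graft v T ts) \<in> S"
    using gm *(2,6,7) by (simp add: cond_map_def)
qed

lemma prob_cond_map_ge:
  assumes I: "finite I" "\<And>d. d \<in> I \<Longrightarrow> d \<ge> deg0 \<and> d > t"
  shows "(\<Sum>d\<in>I. pmf \<xi> d / (1 - mean \<xi>) * measure_pmf.prob (forest d) (good_set d t n C S))
    \<le> measure_pmf.prob gw {T. L \<Omega> T = n \<and> cond_map C t T \<in> S}"
proof -
  let ?g = "\<lambda>((T, v), ts). graft v T ts"
  have inj: "inj_on ?g (good_set d t n C S)" if "d \<in> I" for d
    using good_set_props(2,3)[of _ _ _ d t n C S] I(2)[OF that]
    by (intro inj_on_inverseI[where g = "\<lambda>T. (F0 T, Fs T)"]) auto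
  have "(\<Sum>d\<in>I. pmf \<xi> d / (1 - mean \<xi>) * measure_pmf.prob (forest d) (good_set d t n C S))
     = (\<Sum>d\<in>I. measure_pmf.prob gw (?g ` good_set d t n C S))"
    using inj by (intro sum.cong refl prob_graft_image[symmetric]) (auto simp: good_set_def)
  also have "\<dots> = measure_pmf.prob gw (\<Union>d\<in>I. ?g ` good_set d t n C S)"
  proof (rule measure_pmf.finite_measure_finite_Union[symmetric])
    have "max_outdeg T = d" if "T \<in> ?g ` good_set d t n C S" "d \<in> I" for T d
      using that good_set_props(1)[of _ _ _ d t n C S] I(2) by auto
    then show "disjoint_family_on (\<lambda>d. ?g ` good_set d t n C S) I"
      unfolding disjoint_family_on_def by blast
  qed (use I in auto)
  also have "\<dots> \<le> measure_pmf.prob gw {T. L \<Omega> T = n \<and> cond_map C t T \<in> S}"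
    using good_set_props(4,5)[of _ _ _ _ t n C S] I(2)
    by (intro measure_pmf.finite_measure_mono) auto
  finally show ?thesis .
qed

text \<open>The three error terms are a vertex of large outdegree in the marked tree, one in some of the \<open>d\<close> trees, and a
  large total size of the last \<open>t + 1\<close> trees. In each case the remaining factor is a power of \<open>gf_L\<close>, so that
  the sum over \<open>d\<close> costs no more than the factor \<open>renewal_bound\<close>.\<close>

lemma sum_hit_le_sum_good:
  assumes I: "finite I" "\<And>d. d \<in> I \<Longrightarrow> D1 \<le> d \<and> d \<le> D2 \<and> d > t"
  shows "(\<Sum>d\<in>I. hit_prob offset (\<lambda>(T, ts). (T, ts, 0) \<in> S) d t n)
    \<le> (\<Sum>d\<in>I. measure_pmf.prob (forest d) (good_set d t n C S))
      + renewal_bound * (measure_pmf.prob bullet {T. D1 \<le> max_outdeg (fst T)}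
        + real D2 * measure_pmf.prob gw {T. D1 \<le> max_outdeg T}
        + measure_pmf.prob (replicate_pmf (Suc t) gw) {ts. C * real t \<le> real (sum_list (map num_vertices ts))})"
proof -
  define k where "k = Suc n - offset"
  let ?SL = "\<lambda>ts. sum_list (map (L \<Omega>) ts)"
  define W1 where "W1 = gf bullet (\<lambda>T. D1 \<le> max_outdeg (fst T)) (\<lambda>T. L \<Omega> (fst T))"
  define W2 where "W2 = gf gw (\<lambda>T. D1 \<le> max_outdeg T) (L \<Omega>)"
  define W3 where "W3 = gf (replicate_pmf (Suc t) gw) (\<lambda>ts. C * real t \<le> real (sum_list (map num_vertices ts))) ?SL"
  have le: "hit_prob offset (\<lambda>(T, ts). (T, ts, 0) \<in> S) d t n \<le> measure_pmf.prob (forest d) (good_set d t n C S)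
      + fps_nth (W1 * gf_L ^ d) k + real D2 * fps_nth (gf_L_bullet * W2 * gf_L ^ (d - 1)) k + fps_nth (gf_L_bullet * W3 * gf_L ^ (d - t - 1)) k"
    if "d \<in> I" for d
  proof -
    have d: "D1 \<le> d" "d \<le> D2" "d > t" using I(2)[OF that] by auto
    define E1 where "E1 = {(T, ts :: ptree list). (D1 \<le> max_outdeg (fst T) \<and> True) \<and> total_L \<Omega> (T, ts) = k}"
    define E2 where "E2 = {(T :: mtree, ts). (True \<and> (\<exists>x\<in>set ts. D1 \<le> max_outdeg x)) \<and> total_L \<Omega> (T, ts) = k}"
    define E3 where "E3 = {(T :: mtree, ts). (True \<and> C * real t \<le> real (sum_list (map num_vertices (drop (d - t - 1) ts)))) \<and> total_L \<Omega> (T, ts) = k}"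
    have "measure_pmf.prob (forest d) E1 = fps_nth (gf (forest d) (\<lambda>(T, ts). D1 \<le> max_outdeg (fst T) \<and> True) (total_L \<Omega>)) k"
      unfolding gf_nth E1_def by (auto intro!: arg_cong[of _ _ "measure_pmf.prob (forest d)"])
    then have p1: "measure_pmf.prob (forest d) E1 = fps_nth (W1 * gf_L ^ d) k"
      using gf_forest_bul[of d "\<lambda>T. D1 \<le> max_outdeg (fst T)" "\<lambda>_. True"]
      by (simp only: W1_def gf_replicate_L)
    have "measure_pmf.prob (forest d) E2 = fps_nth (gf (forest d) (\<lambda>(T, ts). True \<and> (\<exists>x\<in>set ts. D1 \<le> max_outdeg x)) (total_L \<Omega>)) k"
      unfolding gf_nth E2_def by (auto intro!: arg_cong[of _ _ "measure_pmf.prob (forest d)"])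
    also have "\<dots> = fps_nth (gf_L_bullet * gf (replicate_pmf d gw) (\<lambda>ts. \<exists>x\<in>set ts. D1 \<le> max_outdeg x) ?SL) k"
      using gf_forest_bul[of d "\<lambda>_. True" "\<lambda>ts. \<exists>x\<in>set ts. D1 \<le> max_outdeg x"]
      by (simp only: gf_L_bullet_def)
    also have "\<dots> \<le> fps_nth (gf_L_bullet * (fps_const (real d) * (W2 * gf_L ^ (d - 1)))) k"
    proof (rule fps_mult_nth_mono)
      fix j
      show "fps_nth (gf (replicate_pmf d gw) (\<lambda>ts. \<exists>x\<in>set ts. D1 \<le> max_outdeg x) ?SL) j
        \<le> fps_nth (fps_const (real d) * (W2 * gf_L ^ (d - 1))) j"
        using gf_replicate_ex_le[of d gw "\<lambda>x. D1 \<le> max_outdeg x" "L \<Omega>" j] by (simp add: W2_def gf_L_def)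
    qed simp
    also have "\<dots> = real d * fps_nth (gf_L_bullet * W2 * gf_L ^ (d - 1)) k"
      by (simp only: mult.left_commute[of gf_L_bullet] fps_mult_left_const_nth mult.assoc)
    also have "\<dots> \<le> real D2 * fps_nth (gf_L_bullet * W2 * gf_L ^ (d - 1)) k"
      using d by (intro mult_right_mono) (auto simp: W2_def intro!: fps_mult_nth_nonneg fps_power_nth_nonneg)
    finally have p2: "measure_pmf.prob (forest d) E2 \<le> real D2 * fps_nth (gf_L_bullet * W2 * gf_L ^ (d - 1)) k" .
    have dd: "d - t - 1 + Suc t = d" using d by simp
    have p3: "measure_pmf.prob (forest d) E3 = fps_nth (gf_L_bullet * W3 * gf_L ^ (d - t - 1)) k"
    proof -
      have "gf (forest (d - t - 1 + Suc t)) (\<lambda>(T, ts). True \<and> C * real t \<le> real (sum_list (map num_vertices (drop (d - t - 1) ts)))) (total_L \<Omega>)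
         = gf (forest (d - t - 1)) (\<lambda>_. True) (total_L \<Omega>) * W3"
        unfolding W3_def
        by (rule gf_forest_add[of "d - t - 1" "Suc t" "\<lambda>_. True" "\<lambda>ts. C * real t \<le> real (sum_list (map num_vertices ts))"])
      then have "gf (forest d) (\<lambda>(T, ts). True \<and> C * real t \<le> real (sum_list (map num_vertices (drop (d - t - 1) ts)))) (total_L \<Omega>)
         = gf_L_bullet * gf_L ^ (d - t - 1) * W3"
        unfolding dd gf_forest .
      moreover have "measure_pmf.prob (forest d) E3
         = fps_nth (gf (forest d) (\<lambda>(T, ts). True \<and> C * real t \<le> real (sum_list (map num_vertices (drop (d - t - 1) ts)))) (total_L \<Omega>)) k"
        unfolding gf_nth E3_def by (auto intro!: arg_cong[of _ _ "measure_pmf.prob (forest d)"])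
      ultimately show ?thesis by (simp add: mult_ac)
    qed
    define H where "H = {(T, ts). total_L \<Omega> (T, ts) + offset = Suc n \<and> (T, take (d - t) ts, 0) \<in> S}"
    have "hit_prob offset (\<lambda>(T, ts). (T, ts, 0) \<in> S) d t n = measure_pmf.prob (forest d) H"
      unfolding hit_prob_def H_def by simp
    also have "\<dots> \<le> measure_pmf.prob (forest d) (good_set d t n C S \<union> E1 \<union> E2 \<union> E3)"
    proof (rule measure_pmf.finite_measure_mono_AE)
      show "AE z in forest d. z \<in> H \<longrightarrow> z \<in> good_set d t n C S \<union> E1 \<union> E2 \<union> E3"
        unfolding AE_measure_pmf_iff
      proof (intro ballI impI)
        fix z assume z: "z \<in> set_pmf (forest d)" "z \<in> H"
        obtain T v ts where zz: "z = ((T, v), ts)" by (metis prod.exhaust)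
        have ml: "marked_leaf v T" "length ts = d"
          using z unfolding zz by (auto intro: set_bul_marked_leaf dest: length_replicate_pmf)
        have Zk: "total_L \<Omega> ((T, v), ts) = k" "total_L \<Omega> ((T, v), ts) + offset = Suc n" using z by (auto simp: zz H_def k_def)
        show "z \<in> good_set d t n C S \<union> E1 \<union> E2 \<union> E3"
        proof (rule ccontr)
          assume n: "z \<notin> good_set d t n C S \<union> E1 \<union> E2 \<union> E3"
          then have "max_outdeg T < D1" "\<forall>x\<in>set ts. max_outdeg x < D1"
             "real (sum_list (map num_vertices (drop (d - t - 1) ts))) < C * real t"
            using Zk by (auto simp: zz E1_def E2_def E3_def not_le)
          then have "z \<in> good_set d t n C S"
            using ml Zk z d unfolding zz good_set_def H_def by auto
          with n show False by blast
        qed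
      qed
    qed auto
    also have "\<dots> \<le> measure_pmf.prob (forest d) (good_set d t n C S) + measure_pmf.prob (forest d) E1
       + measure_pmf.prob (forest d) E2 + measure_pmf.prob (forest d) E3"
      by (intro order_trans[OF measure_Un_le] add_right_mono) auto
    finally show ?thesis using p1 p2 p3 by linarith
  qed
  have W: "fps_nth W1 j \<ge> 0" "fps_nth (gf_L_bullet * W2) j \<ge> 0" "fps_nth (gf_L_bullet * W3) j \<ge> 0" for j
    by (auto simp: W1_def W2_def W3_def intro!: fps_mult_nth_nonneg)
  have s1: "(\<Sum>d\<in>I. fps_nth (W1 * gf_L ^ d) k) \<le> measure_pmf.prob bullet {T. D1 \<le> max_outdeg (fst T)} * renewal_bound"
    by (rule renewal_le[OF W(1)]) (auto simp: W1_def I l1_le_gf_prob)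
  have s2: "(\<Sum>d\<in>I. fps_nth (gf_L_bullet * W2 * gf_L ^ (d - 1)) k) \<le> (1 * measure_pmf.prob gw {T. D1 \<le> max_outdeg T}) * renewal_bound"
  proof (rule renewal_le[OF W(2)])
    show "inj_on (\<lambda>d. d - 1) I" by (rule inj_on_diff_nat) (use I(2) in force)
    show "l1_le (gf_L_bullet * W2) (1 * measure_pmf.prob gw {T. D1 \<le> max_outdeg T})"
      unfolding W2_def by (intro l1_le_mult l1_le_gf_L_bullet l1_le_gf_prob)
  qed (rule I)
  have s3: "(\<Sum>d\<in>I. fps_nth (gf_L_bullet * W3 * gf_L ^ (d - t - 1)) k)
      \<le> (1 * measure_pmf.prob (replicate_pmf (Suc t) gw) {ts. C * real t \<le> real (sum_list (map num_vertices ts))}) * renewal_bound"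
  proof (rule renewal_le[OF W(3)])
    have "inj_on (\<lambda>d. d - (t + 1)) I" by (rule inj_on_diff_nat) (use I(2) in force)
    then show "inj_on (\<lambda>d. d - t - 1) I" by simp
    show "l1_le (gf_L_bullet * W3) (1 * measure_pmf.prob (replicate_pmf (Suc t) gw) {ts. C * real t \<le> real (sum_list (map num_vertices ts))})"
      unfolding W3_def by (intro l1_le_mult l1_le_gf_L_bullet l1_le_gf_prob)
  qed (rule I)
  have "(\<Sum>d\<in>I. hit_prob offset (\<lambda>(T, ts). (T, ts, 0) \<in> S) d t n)
     \<le> (\<Sum>d\<in>I. measure_pmf.prob (forest d) (good_set d t n C S)
      + fps_nth (W1 * gf_L ^ d) k + real D2 * fps_nth (gf_L_bullet * W2 * gf_L ^ (d - 1)) k + fps_nth (gf_L_bullet * W3 * gf_L ^ (d - t - 1)) k)"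
    by (intro sum_mono le)
  also have "\<dots> = (\<Sum>d\<in>I. measure_pmf.prob (forest d) (good_set d t n C S))
     + (\<Sum>d\<in>I. fps_nth (W1 * gf_L ^ d) k) + real D2 * (\<Sum>d\<in>I. fps_nth (gf_L_bullet * W2 * gf_L ^ (d - 1)) k)
     + (\<Sum>d\<in>I. fps_nth (gf_L_bullet * W3 * gf_L ^ (d - t - 1)) k)"
    by (simp only: sum.distrib sum_distrib_left)
  also have "\<dots> \<le> (\<Sum>d\<in>I. measure_pmf.prob (forest d) (good_set d t n C S))
     + measure_pmf.prob bullet {T. D1 \<le> max_outdeg (fst T)} * renewal_bound
     + real D2 * ((1 * measure_pmf.prob gw {T. D1 \<le> max_outdeg T}) * renewal_bound)
     + (1 * measure_pmf.prob (replicate_pmf (Suc t) gw) {ts. C * real t \<le> real (sum_list (map num_vertices ts))}) * renewal_bound"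
    by (intro add_mono order_refl mult_left_mono s1 s2 s3) auto
  finally show ?thesis by (simp add: algebra_simps)
qed

lemma prob_replicate_L:
  "measure_pmf.prob (replicate_pmf d gw) {ts. Q (sum_list (map g ts))}
    = measure_pmf.prob (replicate_pmf d (map_pmf g gw)) {xs. Q (sum_list xs)}"
  by (simp add: replicate_map_pmf vimage_def)

text \<open>The weak law of large numbers with a starting point that is negligible on the scale \<open>n\<close>.\<close>

lemma concentration_below:
  assumes x: "0 < x" "x * mean_L < 1"
  shows "(\<lambda>n. measure_pmf.prob (forest (nat \<lfloor>x * real n\<rfloor>)) {z. n \<le> Suc (total_L \<Omega> z)}) \<longlonglongrightarrow> 0"
proof -
  \<comment> \<open>one third of the gap each for the starting point, for rounding and for the walk\<close>
  define \<gamma> where "\<gamma> = (1 - x * mean_L) / 3"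
  have "0 < (1 - y) / 3 \<and> y < 1 - 2 * ((1 - y) / 3) \<and> (1 - y) / 3 < 1/2" if "0 < y" "y < 1" for y :: real
    using that by (auto simp: field_simps)
  from this[of "x * mean_L"] x mean_L_pos have "0 < (1 - x * mean_L) / 3 \<and> x * mean_L < 1 - 2 * ((1 - x * mean_L) / 3) \<and> (1 - x * mean_L) / 3 < 1/2"
    by simp
  then have \<gamma>: "\<gamma> > 0" "x * mean_L < 1 - 2 * \<gamma>" "\<gamma> < 1/2"
    unfolding \<gamma>_def by blast+
  define a where "a = (1 - 2 * \<gamma>) / x"
  have a: "a > mean_L" using \<gamma> x by (simp add: a_def field_simps)
  let ?D = "\<lambda>n. nat \<lfloor>x * real n\<rfloor>"
  have Dlim: "filterlim ?D at_top sequentially" using x by real_asymp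
  have "measure_pmf.expectation (map_pmf (L \<Omega>) gw) real < a" using a by (simp add: mean_L_def)
  from filterlim_compose[OF weak_law_upper[OF _ this] Dlim]
  have l2: "(\<lambda>n. measure_pmf.prob (replicate_pmf (?D n) gw) {ts. real (sum_list (map (L \<Omega>) ts)) \<ge> a * real (?D n)}) \<longlonglongrightarrow> 0"
    unfolding prob_replicate_L[where Q = "\<lambda>s. real s \<ge> c" for c] using integrable_L by simp
  have l1: "(\<lambda>n. measure_pmf.prob bullet {T. real (L \<Omega> (fst T)) \<ge> \<gamma> * real n}) \<longlonglongrightarrow> 0"
    by (rule prob_ge_tendsto_0[OF \<gamma>(1)])
  from tendsto_add[OF l1 l2]
  have lim: "(\<lambda>n. measure_pmf.prob bullet {T. real (L \<Omega> (fst T)) \<ge> \<gamma> * real n} +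
     measure_pmf.prob (replicate_pmf (?D n) gw) {ts. real (sum_list (map (L \<Omega>) ts)) \<ge> a * real (?D n)}) \<longlonglongrightarrow> 0" by simp
  show ?thesis
  proof (rule tendsto_sandwich[OF _ _ tendsto_const lim])
    show "\<forall>\<^sub>F n in sequentially. measure_pmf.prob (forest (?D n)) {z. n \<le> Suc (total_L \<Omega> z)} \<le>
      measure_pmf.prob bullet {T. real (L \<Omega> (fst T)) \<ge> \<gamma> * real n} +
       measure_pmf.prob (replicate_pmf (?D n) gw) {ts. real (sum_list (map (L \<Omega>) ts)) \<ge> a * real (?D n)}"
      using eventually_ge_at_top[of "nat \<lceil>1 / \<gamma>\<rceil>"]
    proof eventually_elim
      case (elim n)
      have "1 / \<gamma> \<le> real n" using elim by linarith
      then have n: "1 \<le> \<gamma> * real n" using \<gamma> by (simp add: field_simps)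
      have aD: "a * real (?D n) \<le> (1 - 2 * \<gamma>) * real n"
      proof -
        have "real (?D n) \<le> x * real n" using x by simp
        then have "a * real (?D n) \<le> a * (x * real n)" using a mean_L_pos by (intro mult_left_mono) auto
        then show ?thesis using x by (simp add: a_def)
      qed
      have "measure_pmf.prob (forest (?D n)) {z. n \<le> Suc (total_L \<Omega> z)}
        \<le> measure_pmf.prob (forest (?D n)) ({T. real (L \<Omega> (fst T)) \<ge> \<gamma> * real n} \<times> UNIV
            \<union> UNIV \<times> {ts. real (sum_list (map (L \<Omega>) ts)) \<ge> a * real (?D n)})"
      proof (rule measure_pmf.finite_measure_mono)
        show "{z. n \<le> Suc (total_L \<Omega> z)} \<subseteq> {T. real (L \<Omega> (fst T)) \<ge> \<gamma> * real n} \<times> UNIV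
            \<union> UNIV \<times> {ts. real (sum_list (map (L \<Omega>) ts)) \<ge> a * real (?D n)}"
        proof
          fix z assume z: "z \<in> {z. n \<le> Suc (total_L \<Omega> z)}"
          obtain T ts where zz: "z = (T, ts)" by (cases z)
          have "real n \<le> 1 + real (L \<Omega> (fst T)) + real (sum_list (map (L \<Omega>) ts))"
            using z unfolding zz total_L_def by simp
          then have "real (L \<Omega> (fst T)) \<ge> \<gamma> * real n \<or> real (sum_list (map (L \<Omega>) ts)) \<ge> (1 - 2 * \<gamma>) * real n"
            using n by (auto simp: algebra_simps)
          then show "z \<in> {T. real (L \<Omega> (fst T)) \<ge> \<gamma> * real n} \<times> UNIV
            \<union> UNIV \<times> {ts. real (sum_list (map (L \<Omega>) ts)) \<ge> a * real (?D n)}"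
            using aD unfolding zz by auto
        qed
      qed auto
      also have "\<dots> \<le> measure_pmf.prob (forest (?D n)) ({T. real (L \<Omega> (fst T)) \<ge> \<gamma> * real n} \<times> UNIV)
            + measure_pmf.prob (forest (?D n)) (UNIV \<times> {ts. real (sum_list (map (L \<Omega>) ts)) \<ge> a * real (?D n)})"
        by (rule measure_Un_le) auto
      finally show ?case by (simp only: prob_pair_times) simp
    qed
  qed auto
qed

lemma concentration_above:
  assumes x: "1 < x * mean_L" and D: "\<And>n. real (D n) \<ge> x * real n"
  shows "(\<lambda>n. measure_pmf.prob (forest (D n)) {z. total_L \<Omega> z \<le> Suc n}) \<longlonglongrightarrow> 0"
proof -
  have x0: "x > 0" using x mean_L_pos by (smt (verit) mult_nonpos_nonneg)
  define a where "a = (mean_L + 1 / x) / 2"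
  have "1 / x < mean_L" using x x0 by (simp add: field_simps)
  then have a: "a < mean_L" "1 / x < a" by (auto simp: a_def)
  define \<gamma> where "\<gamma> = a - 1 / x"
  have \<gamma>: "\<gamma> > 0" using a by (simp add: \<gamma>_def)
  have Dlim: "filterlim D at_top sequentially"
  proof -
    have "filterlim (\<lambda>n. x * real n) at_top sequentially" using x0 by real_asymp
    then have "filterlim (\<lambda>n. real (D n)) at_top sequentially"
      by (rule filterlim_at_top_mono) (use D in \<open>auto intro: always_eventually\<close>)
    then show ?thesis by (simp add: filterlim_sequentially_iff_filterlim_real)
  qed
  have "a < measure_pmf.expectation (map_pmf (L \<Omega>) gw) real" using a by (simp add: mean_L_def)
  from filterlim_compose[OF weak_law_lower[OF _ this] Dlim]
  have lim: "(\<lambda>n. measure_pmf.prob (replicate_pmf (D n) gw) {ts. real (sum_list (map (L \<Omega>) ts)) \<le> a * real (D n)}) \<longlonglongrightarrow> 0"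
    unfolding prob_replicate_L[where Q = "\<lambda>s. real s \<le> c" for c] using integrable_L by simp
  show ?thesis
  proof (rule tendsto_sandwich[OF _ _ tendsto_const lim])
    have "\<forall>\<^sub>F n in sequentially. D n \<ge> nat \<lceil>1 / \<gamma>\<rceil>"
      using Dlim unfolding filterlim_at_top by blast
    then show "\<forall>\<^sub>F n in sequentially. measure_pmf.prob (forest (D n)) {z. total_L \<Omega> z \<le> Suc n}
       \<le> measure_pmf.prob (replicate_pmf (D n) gw) {ts. real (sum_list (map (L \<Omega>) ts)) \<le> a * real (D n)}"
    proof eventually_elim
      case (elim n)
      have "1 / \<gamma> \<le> real (D n)" using elim by linarith
      then have "1 \<le> \<gamma> * real (D n)" using \<gamma> by (simp add: field_simps)
      moreover have "real n \<le> real (D n) / x" using D[of n] x0 by (simp add: field_simps)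
      ultimately have n: "real n + 1 \<le> a * real (D n)" by (simp add: \<gamma>_def algebra_simps)
      have "measure_pmf.prob (forest (D n)) {z. total_L \<Omega> z \<le> Suc n}
        \<le> measure_pmf.prob (forest (D n)) (UNIV \<times> {ts. real (sum_list (map (L \<Omega>) ts)) \<le> a * real (D n)})"
        by (rule measure_pmf.finite_measure_mono) (use n in \<open>auto simp: total_L_def\<close>)
      then show ?case by (simp only: prob_pair_times) simp
    qed
  qed auto
qed

end

section \<open>Convergence in total variation\<close>

context condensation_tree
begin

definition typical_deg :: "nat \<Rightarrow> nat" where "typical_deg n = nat \<lfloor>real n / mean_L\<rfloor>"
text \<open>The asymptotic value of \<open>P(L = n)\<close>.\<close>

definition asymp_prob :: "nat \<Rightarrow> real" where "asymp_prob n = pmf \<xi> (typical_deg n) / ((1 - mean \<xi>) * mean_L)"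

lemma filterlim_typical_deg: "filterlim typical_deg at_top sequentially"
  unfolding typical_deg_def using mean_L_pos by real_asymp

lemma typical_deg_bounds: "real (typical_deg n) \<le> real n / mean_L" "real n / mean_L - 1 \<le> real (typical_deg n)"
proof -
  have "real n / mean_L \<ge> 0" using mean_L_pos by simp
  then show "real (typical_deg n) \<le> real n / mean_L" "real n / mean_L - 1 \<le> real (typical_deg n)" by (simp_all add: typical_deg_def)
qed

lemma eventually_asymp_prob_pos: "\<forall>\<^sub>F n in sequentially. asymp_prob n > 0"
  using eventually_compose_filterlim[OF eventually_p_pos filterlim_typical_deg]
  by eventually_elim (use mean_L_pos mean_less_1 in \<open>simp add: asymp_prob_def\<close>)

text \<open>The limits of the window lie strictly on both sides of \<open>1 / mean_L\<close>, so that the weak law excludes degrees outside the window, while inside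
  it regular variation makes the offspring probabilities almost constant.\<close>

lemma window:
  assumes "\<eta> > 0"
  shows "\<exists>x1 x2. 0 < x1 \<and> x1 * mean_L < 1 \<and> 1 < x2 * mean_L \<and> 0 < x2 \<and> x1 \<le> x2 \<and>
    (\<forall>\<^sub>F n in sequentially. \<forall>d\<in>{nat \<lfloor>x1 * real n\<rfloor>..nat \<lceil>x2 * real n\<rceil>}.
       pmf \<xi> d \<le> (1 + \<eta>) * pmf \<xi> (typical_deg n) \<and> pmf \<xi> (typical_deg n) \<le> (1 + \<eta>) * pmf \<xi> d)"
proof -
  from p_close[OF assms] obtain \<epsilon> where \<epsilon>: "\<epsilon> > 0"
    and close: "\<forall>\<^sub>F n in sequentially. \<forall>d. \<bar>real d - real n\<bar> \<le> \<epsilon> * real n \<longrightarrow>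
     pmf \<xi> d \<le> (1 + \<eta>) * pmf \<xi> n \<and> pmf \<xi> n \<le> (1 + \<eta>) * pmf \<xi> d" by blast
  \<comment> \<open>the factor \<open>4\<close> leaves room for the rounding of degrees\<close>
  define \<delta> where "\<delta> = min (\<epsilon> / 4) (1/2)"
  have \<delta>: "\<delta> > 0" "\<delta> \<le> 1/2" "4 * \<delta> \<le> \<epsilon>"
  proof -
    have "\<delta> \<le> \<epsilon> / 4" unfolding \<delta>_def by (rule min.cobounded1)
    then show "4 * \<delta> \<le> \<epsilon>" by simp
  qed (use \<epsilon> in \<open>auto simp: \<delta>_def\<close>)
  define x1 where "x1 = (1 - \<delta>) / mean_L"
  define x2 where "x2 = (1 + \<delta>) / mean_L"
  have "\<forall>\<^sub>F n in sequentially. \<forall>d\<in>{nat \<lfloor>x1 * real n\<rfloor>..nat \<lceil>x2 * real n\<rceil>}.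
       pmf \<xi> d \<le> (1 + \<eta>) * pmf \<xi> (typical_deg n) \<and> pmf \<xi> (typical_deg n) \<le> (1 + \<eta>) * pmf \<xi> d"
    using eventually_compose_filterlim[OF close filterlim_typical_deg] eventually_ge_at_top[of "nat \<lceil>mean_L * ((2 + \<epsilon>) / (3 * \<delta>))\<rceil>"]
  proof eventually_elim
    case (elim n)
    define y where "y = real n / mean_L"
    have y0: "y \<ge> 0" using mean_L_pos by (simp add: y_def)
    have "mean_L * ((2 + \<epsilon>) / (3 * \<delta>)) \<le> real n" using elim by linarith
    then have "(2 + \<epsilon>) / (3 * \<delta>) \<le> y" using mean_L_pos by (simp add: y_def pos_le_divide_eq mult.commute)
    then have y: "2 + \<epsilon> \<le> 3 * (\<delta> * y)" using \<delta> by (simp add: pos_divide_le_eq mult_ac)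
    have Nn: "real (typical_deg n) \<le> y" "y - 1 \<le> real (typical_deg n)" using typical_deg_bounds[of n] by (auto simp: y_def)
    show ?case
    proof
      fix d assume d: "d \<in> {nat \<lfloor>x1 * real n\<rfloor>..nat \<lceil>x2 * real n\<rceil>}"
      have x1n: "x1 * real n = y - \<delta> * y" by (simp add: x1_def y_def algebra_simps diff_divide_distrib)
      have x2n: "x2 * real n = y + \<delta> * y" by (simp add: x2_def y_def algebra_simps add_divide_distrib)
      have "x1 * real n - 1 \<le> real d" using d by auto linarith
      moreover have "real d \<le> x2 * real n + 1"
      proof -
        have "0 \<le> x2 * real n" unfolding x2n using y0 \<delta> by simp
        then show ?thesis using d by auto linarith
      qed
      ultimately have "\<bar>real d - real (typical_deg n)\<bar> \<le> \<delta> * y + 2" unfolding x1n x2n using Nn by auto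
      also have "\<dots> \<le> 4 * \<delta> * y - \<epsilon>" using y by simp
      also have "\<dots> \<le> \<epsilon> * y - \<epsilon>" using \<delta> y0 by (simp add: mult_right_mono)
      also have "\<dots> \<le> \<epsilon> * real (typical_deg n)" using mult_left_mono[OF Nn(2), of \<epsilon>] \<epsilon> by (simp add: algebra_simps)
      finally show "pmf \<xi> d \<le> (1 + \<eta>) * pmf \<xi> (typical_deg n) \<and> pmf \<xi> (typical_deg n) \<le> (1 + \<eta>) * pmf \<xi> d"
        using elim by blast
    qed
  qed
  moreover have "0 < x1" "x1 * mean_L < 1" "1 < x2 * mean_L" "0 < x2" "x1 \<le> x2"
    using \<delta> mean_L_pos by (auto simp: x1_def x2_def divide_right_mono)
  ultimately show ?thesis by blast
qed

lemma hit_prob_True: "hit_prob offset (\<lambda>_. True) d t n = measure_pmf.prob (forest d) {z. total_L \<Omega> z + offset = Suc n}"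
  unfolding hit_prob_def by (auto intro!: arg_cong[of _ _ "measure_pmf.prob (forest d)"])

lemma prob_hit_eq:
  "measure_pmf.prob (forest d) {z. total_L \<Omega> z + offset = Suc n} \<le> measure_pmf.prob (forest d) {z. total_L \<Omega> z = Suc n - offset}"
  by (intro measure_pmf.finite_measure_mono) auto

lemma sum_hit_below:
  assumes "finite I" "\<And>d. d \<in> I \<Longrightarrow> d \<le> D"
  shows "(\<Sum>d\<in>I. measure_pmf.prob (forest d) {z. total_L \<Omega> z + offset = Suc n})
    \<le> renewal_bound * measure_pmf.prob (forest D) {z. n \<le> Suc (total_L \<Omega> z)}"
proof -
  have "(\<Sum>d\<in>I. measure_pmf.prob (forest d) {z. total_L \<Omega> z + offset = Suc n})
    \<le> (\<Sum>d\<in>I. measure_pmf.prob (forest d) {z. total_L \<Omega> z = Suc n - offset})" by (intro sum_mono prob_hit_eq)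
  also have "\<dots> \<le> renewal_bound * measure_pmf.prob (forest D) {z. Suc n - offset \<le> total_L \<Omega> z}"
    using assms by (intro sum_forest_le_below)
  also have "\<dots> \<le> renewal_bound * measure_pmf.prob (forest D) {z. n \<le> Suc (total_L \<Omega> z)}"
    using renewal_bound_pos offset_le_2 by (intro mult_left_mono measure_pmf.finite_measure_mono) auto
  finally show ?thesis .
qed

lemma sum_hit_above:
  assumes "finite I" "\<And>d. d \<in> I \<Longrightarrow> D \<le> d"
  shows "(\<Sum>d\<in>I. measure_pmf.prob (forest d) {z. total_L \<Omega> z + offset = Suc n})
    \<le> renewal_bound * measure_pmf.prob (forest D) {z. total_L \<Omega> z \<le> Suc n}"
proof -
  have "(\<Sum>d\<in>I. measure_pmf.prob (forest d) {z. total_L \<Omega> z + offset = Suc n})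
    \<le> (\<Sum>d\<in>I. measure_pmf.prob (forest d) {z. total_L \<Omega> z = Suc n - offset})" by (intro sum_mono prob_hit_eq)
  also have "\<dots> \<le> renewal_bound * measure_pmf.prob (forest D) {z. total_L \<Omega> z \<le> Suc n - offset}"
    using assms by (intro sum_forest_le_above)
  also have "\<dots> \<le> renewal_bound * measure_pmf.prob (forest D) {z. total_L \<Omega> z \<le> Suc n}"
    using renewal_bound_pos by (intro mult_left_mono measure_pmf.finite_measure_mono) auto
  finally show ?thesis .
qed

lemma prob_max_outdeg_in_le:
  assumes I: "finite I" "\<And>d. d \<in> I \<Longrightarrow> d \<ge> deg0 \<and> pmf \<xi> d \<le> c" 
    and S: "(\<Sum>d\<in>I. measure_pmf.prob (forest d) {z. total_L \<Omega> z + offset = Suc n}) \<le> s" and c: "c \<ge> 0"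
  shows "measure_pmf.prob gw {T. L \<Omega> T = n \<and> max_outdeg T \<in> I} \<le> c / (1 - mean \<xi>) * s"
proof -
  have "{T. L \<Omega> T = n \<and> max_outdeg T \<in> I} = (\<Union>d\<in>I. {T. L \<Omega> T = n \<and> max_outdeg T = d})" by auto
  then have "measure_pmf.prob gw {T. L \<Omega> T = n \<and> max_outdeg T \<in> I} \<le> (\<Sum>d\<in>I. measure_pmf.prob gw {T. L \<Omega> T = n \<and> max_outdeg T = d})"
    using I by (auto intro: measure_UNION_le)
  also have "\<dots> \<le> (\<Sum>d\<in>I. c / (1 - mean \<xi>) * measure_pmf.prob (forest d) {z. total_L \<Omega> z + offset = Suc n})"
  proof (intro sum_mono)
    fix d assume d: "d \<in> I"
    have "measure_pmf.prob gw {T. L \<Omega> T = n \<and> max_outdeg T = d}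
       \<le> pmf \<xi> d / (1 - mean \<xi>) * measure_pmf.prob (forest d) {z. total_L \<Omega> z + offset = Suc n}"
      using I(2)[OF d] by (intro prob_max_outdeg_eq_le) auto
    also have "\<dots> \<le> c / (1 - mean \<xi>) * measure_pmf.prob (forest d) {z. total_L \<Omega> z + offset = Suc n}"
      using I(2)[OF d] mean_less_1 by (intro mult_right_mono divide_right_mono) auto
    finally show "measure_pmf.prob gw {T. L \<Omega> T = n \<and> max_outdeg T = d}
       \<le> c / (1 - mean \<xi>) * measure_pmf.prob (forest d) {z. total_L \<Omega> z + offset = Suc n}" .
  qed
  also have "\<dots> \<le> c / (1 - mean \<xi>) * s"
    unfolding sum_distrib_left[symmetric] using S c mean_less_1 by (intro mult_left_mono) auto
  finally show ?thesis .
qed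

text \<open>The polynomial bound of arbitrary order beats the offspring probability at the typical degree.\<close>

lemma prob_small_max_outdeg_le:
  assumes "\<eta> > 0"
  shows "\<exists>\<delta>>0. \<forall>\<^sub>F n in sequentially.
    measure_pmf.prob gw {T. L \<Omega> T = n \<and> real (max_outdeg T) \<le> \<delta> * real n} \<le> \<eta> * asymp_prob n"
proof -
  obtain \<rho> where \<rho>: "0 < \<rho>" "\<rho> \<le> 1" "summable (\<lambda>k. pmf \<xi> k * real k powr (1 + \<rho>))"
    using summable_moment by blast
  obtain K where K: "K > 0" "\<forall>\<^sub>F n in sequentially. pmf \<xi> n \<ge> real n powr - K" using p_lower_bound by blast
  from prob_L_small_max_outdeg[OF \<rho>(3,1,2), of "K + 1" \<Omega>] K(1) obtain \<delta> where \<delta>: "\<delta> > 0"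
    "\<forall>\<^sub>F n in sequentially. measure_pmf.prob gw {T. L \<Omega> T = n \<and> real (max_outdeg T) \<le> \<delta> * real n} \<le> 2 * real n powr - (K + 1)"
    by auto
  define c where "c = (1 - mean \<xi>) * mean_L"
  have c: "c > 0" using mean_less_1 mean_L_pos by (simp add: c_def)
  have "(\<lambda>n. 2 * (c * (1 / mean_L) powr K) * real n powr - 1) \<longlonglongrightarrow> 0"
    using c mean_L_pos by real_asymp
  then have "\<forall>\<^sub>F n in sequentially. 2 * (c * (1 / mean_L) powr K) * real n powr - 1 < \<eta>"
    using assms by (intro order_tendstoD(2)) auto
  then have "\<forall>\<^sub>F n in sequentially.
    measure_pmf.prob gw {T. L \<Omega> T = n \<and> real (max_outdeg T) \<le> \<delta> * real n} \<le> \<eta> * asymp_prob n"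
    using \<delta>(2) eventually_compose_filterlim[OF K(2) filterlim_typical_deg] eventually_gt_at_top[of 0]
      eventually_compose_filterlim[OF eventually_gt_at_top[of 0] filterlim_typical_deg]
  proof eventually_elim
    case (elim n)
    have n: "real n > 0" "real (typical_deg n) > 0" using elim by auto
    have "real n powr - K * (1 / mean_L) powr - K = (real n / mean_L) powr - K"
      using n mean_L_pos by (simp add: powr_mult[symmetric])
    also have "\<dots> \<le> real (typical_deg n) powr - K"
      using typical_deg_bounds(1)[of n] n K(1) by (intro powr_mono2') auto
    also have "\<dots> \<le> pmf \<xi> (typical_deg n)" using elim by simp
    finally have p: "real n powr - K * (1 / mean_L) powr - K \<le> c * asymp_prob n"
      using c by (simp add: asymp_prob_def c_def[symmetric])
    have "2 * real n powr - (K + 1) = 2 * real n powr - 1 * (real n powr - K)"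
    proof -
      have e: "- (K + 1) = - 1 + - K" by simp
      show ?thesis unfolding e powr_add by (simp only: mult.assoc)
    qed
    also have "\<dots> = (2 * ((1 / mean_L) powr K) * real n powr - 1) * (real n powr - K * (1 / mean_L) powr - K)"
      using mean_L_pos by (simp add: powr_minus field_simps)
    also have "\<dots> \<le> (2 * ((1 / mean_L) powr K) * real n powr - 1) * (c * asymp_prob n)"
      using p by (intro mult_left_mono) auto
    also have "\<dots> = (2 * (c * (1 / mean_L) powr K) * real n powr - 1) * asymp_prob n" by (simp add: mult_ac)
    also have "\<dots> \<le> \<eta> * asymp_prob n"
      using elim c mean_less_1 mean_L_pos by (intro mult_right_mono) (auto simp: asymp_prob_def)
    finally show ?case using elim by linarith
  qed
  with \<delta> show ?thesis by blast
qed

text \<open>The maximal outdegree is either small, below the window, in the window, or above it. In the window the comparison with first passage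
  bounds the sum of hitting probabilities by \<open>1 / mean_L\<close> up to a small error, since the passage probabilities sum to at
  most one.\<close>

lemma prob_L_eq_upper:
  assumes \<eta>: "0 < \<eta>" "\<eta> \<le> 1"
  shows "\<forall>\<^sub>F n in sequentially. measure_pmf.prob gw {T. L \<Omega> T = n} \<le> (1 + \<eta>) * asymp_prob n"
proof -
  obtain x1 x2 where x: "0 < x1" "x1 * mean_L < 1" "1 < x2 * mean_L" "0 < x2" and x12: "x1 \<le> x2"
    and win: "\<forall>\<^sub>F n in sequentially. \<forall>d\<in>{nat \<lfloor>x1 * real n\<rfloor>..nat \<lceil>x2 * real n\<rceil>}.
       pmf \<xi> d \<le> (1 + \<eta> / 4) * pmf \<xi> (typical_deg n) \<and> pmf \<xi> (typical_deg n) \<le> (1 + \<eta> / 4) * pmf \<xi> d"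
    using window[of "\<eta> / 4"] \<eta> by auto
  define D1 where "D1 n = nat \<lfloor>x1 * real n\<rfloor>" for n :: nat
  define D2 where "D2 n = nat \<lceil>x2 * real n\<rceil>" for n :: nat
  have D1_lim: "filterlim D1 at_top sequentially" unfolding D1_def using x by real_asymp
  have D12: "D1 n \<le> D2 n" for n
  proof -
    have "x1 * real n \<le> x2 * real n" using x12 by (intro mult_right_mono) auto
    then show ?thesis unfolding D1_def D2_def by linarith
  qed
  define c1 where "c1 n = measure_pmf.prob (forest (D1 n)) {z. n \<le> Suc (total_L \<Omega> z)}" for n
  define c2 where "c2 n = measure_pmf.prob (forest (D2 n)) {z. total_L \<Omega> z \<le> Suc n}" for n
  have c1: "c1 \<longlonglongrightarrow> 0" unfolding c1_def D1_def by (rule concentration_below[OF x(1,2)])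
  have c2: "c2 \<longlonglongrightarrow> 0" unfolding c2_def
  proof (rule concentration_above[OF x(3)])
    fix n show "x2 * real n \<le> real (D2 n)" unfolding D2_def by linarith
  qed
  from prob_small_max_outdeg_le[of "\<eta> / 16"] \<eta> obtain \<delta> where \<delta>: "\<delta> > 0"
    and small: "\<forall>\<^sub>F n in sequentially.
      measure_pmf.prob gw {T. L \<Omega> T = n \<and> real (max_outdeg T) \<le> \<delta> * real n} \<le> \<eta> / 16 * asymp_prob n" by auto
  from p_le_of_ge[of "\<delta> * mean_L"] \<delta> mean_L_pos obtain C where C: "C > 0"
    and Cev: "\<forall>\<^sub>F m in sequentially. \<forall>d. real d \<ge> \<delta> * mean_L * real m \<longrightarrow> pmf \<xi> d \<le> C * pmf \<xi> m" by auto
  define e where "e = \<eta> / 4 / renewal_bound"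
  have e: "e > 0" "renewal_bound * e = \<eta> / 4" using \<eta> renewal_bound_pos by (auto simp: e_def)
  obtain t where t: "l1_le (gf_L ^ t * (fps_const mean_L * fps_X ^ offset - fps_X * gf_tail)) e"
    using smoothing[OF e(1), of offset] by (auto simp: eventually_at_top_linorder)
  have "(\<lambda>n. C * mean_L * renewal_bound * (c1 n + c2 n)) \<longlonglongrightarrow> C * mean_L * renewal_bound * (0 + 0)"
    by (intro tendsto_intros c1 c2)
  then have cs: "\<forall>\<^sub>F n in sequentially. C * mean_L * renewal_bound * (c1 n + c2 n) < \<eta> / 16"
    using \<eta> by (intro order_tendstoD(2)) auto
  have dlim: "\<forall>\<^sub>F n in sequentially. \<delta> * real n \<ge> real deg0"
  proof -
    have "filterlim (\<lambda>n. \<delta> * real n) at_top sequentially" using \<delta> by real_asymp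
    then show ?thesis unfolding filterlim_at_top by blast
  qed
  have D1ev: "\<forall>\<^sub>F n in sequentially. D1 n \<ge> max deg0 t" using D1_lim unfolding filterlim_at_top by blast
  show ?thesis
    using win small eventually_compose_filterlim[OF Cev filterlim_typical_deg] cs dlim D1ev eventually_asymp_prob_pos
  proof eventually_elim
    case (elim n)
    define pN where "pN = pmf \<xi> (typical_deg n)"
    define \<mu> where "\<mu> = 1 - mean \<xi>"
    have \<mu>: "\<mu> > 0" using mean_less_1 by (simp add: \<mu>_def)
    have asymp_prob: "asymp_prob n = pN / (\<mu> * mean_L)" by (simp add: asymp_prob_def pN_def \<mu>_def)
    have pN: "pN = asymp_prob n * \<mu> * mean_L" using \<mu> mean_L_pos by (simp add: asymp_prob)
    have pN0: "pN \<ge> 0" by (simp add: pN_def)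
    have dC: "pmf \<xi> d \<le> C * pN" if "real d > \<delta> * real n" for d
    proof -
      have "\<delta> * mean_L * real (typical_deg n) \<le> \<delta> * mean_L * (real n / mean_L)"
        using \<delta> mean_L_pos typical_deg_bounds(1)[of n] by (intro mult_left_mono) auto
      also have "\<dots> = \<delta> * real n" using mean_L_pos by simp
      finally show ?thesis using elim that by (auto simp: pN_def)
    qed
    have big: "d \<ge> deg0" if "real d > \<delta> * real n" for d using that elim by linarith
    have mid: "measure_pmf.prob gw {T. L \<Omega> T = n \<and> max_outdeg T \<in> {d \<in> {..<D1 n}. \<delta> * real n < real d}} \<le> C * pN / \<mu> * (renewal_bound * c1 n)"
      unfolding \<mu>_def
    proof (rule prob_max_outdeg_in_le)
      show "(\<Sum>d\<in>{d \<in> {..<D1 n}. \<delta> * real n < real d}. measure_pmf.prob (forest d) {z. total_L \<Omega> z + offset = Suc n}) \<le> renewal_bound * c1 n"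
        unfolding c1_def by (rule sum_hit_below) auto
    qed (use dC big pN0 C in auto)
    have high: "measure_pmf.prob gw {T. L \<Omega> T = n \<and> max_outdeg T \<in> {d \<in> {D2 n..R}. \<delta> * real n < real d}} \<le> C * pN / \<mu> * (renewal_bound * c2 n)" for R
      unfolding \<mu>_def
    proof (rule prob_max_outdeg_in_le)
      show "(\<Sum>d\<in>{d \<in> {D2 n..R}. \<delta> * real n < real d}. measure_pmf.prob (forest d) {z. total_L \<Omega> z + offset = Suc n}) \<le> renewal_bound * c2 n"
        unfolding c2_def by (rule sum_hit_above) auto
    qed (use dC big pN0 C in auto)
    have good: "measure_pmf.prob gw {T. L \<Omega> T = n \<and> max_outdeg T \<in> {D1 n..D2 n}} \<le> ((1 + \<eta> / 4) * pN) / \<mu> * ((1 + \<eta> / 4) / mean_L)"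
      unfolding \<mu>_def
    proof (rule prob_max_outdeg_in_le)
      have "\<bar>mean_L * (\<Sum>d\<in>{D1 n..D2 n}. hit_prob offset (\<lambda>_. True) d t n) - (\<Sum>d\<in>{D1 n..D2 n}. overshoot_prob (\<lambda>_. True) d t n)\<bar> \<le> renewal_bound * e"
        using elim by (intro hit_overshoot_compare t) auto
      moreover have "overshoot_prob (\<lambda>_. True) d t n = overshoot_prob (\<lambda>_. True) d 0 n" for d
        unfolding overshoot_prob_def by simp
      moreover have "(\<Sum>d\<in>{D1 n..D2 n}. overshoot_prob (\<lambda>_. True) d 0 n) \<le> 1"
        by (rule sum_overshoot_prob_le_1[OF D12])
      ultimately have "mean_L * (\<Sum>d\<in>{D1 n..D2 n}. measure_pmf.prob (forest d) {z. total_L \<Omega> z + offset = Suc n}) \<le> 1 + \<eta> / 4"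
        unfolding hit_prob_True e(2) by (simp only:)
      then show "(\<Sum>d\<in>{D1 n..D2 n}. measure_pmf.prob (forest d) {z. total_L \<Omega> z + offset = Suc n}) \<le> (1 + \<eta> / 4) / mean_L"
        using mean_L_pos by (simp add: pos_le_divide_eq mult.commute)
      fix d assume d: "d \<in> {D1 n..D2 n}"
      then show "deg0 \<le> d \<and> pmf \<xi> d \<le> (1 + \<eta> / 4) * pN"
        using elim by (auto simp: pN_def D1_def D2_def)
    qed (use \<eta> pN0 in auto)
    define bound where "bound = \<eta> / 16 * asymp_prob n + C * pN / \<mu> * (renewal_bound * c1 n) + C * pN / \<mu> * (renewal_bound * c2 n)
        + ((1 + \<eta> / 4) * pN) / \<mu> * ((1 + \<eta> / 4) / mean_L)"
    \<comment> \<open>degrees beyond \<open>R\<close> are cut off to keep the sums over degrees finite; afterwards \<open>R\<close> tends to infinity\<close>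
    have "measure_pmf.prob gw {T. L \<Omega> T = n} \<le> bound + measure_pmf.prob gw {T. real (max_outdeg T) \<ge> 1 * real R}" for R
    proof -
      define S1 where "S1 = {T. L \<Omega> T = n \<and> real (max_outdeg T) \<le> \<delta> * real n}"
      define S2 where "S2 = {T. L \<Omega> T = n \<and> max_outdeg T \<in> {d \<in> {..<D1 n}. \<delta> * real n < real d}}"
      define S3 where "S3 = {T. L \<Omega> T = n \<and> max_outdeg T \<in> {d \<in> {D2 n..R}. \<delta> * real n < real d}}"
      define S4 where "S4 = {T. L \<Omega> T = n \<and> max_outdeg T \<in> {D1 n..D2 n}}"
      define S5 where "S5 = {T. real (max_outdeg T) \<ge> 1 * real R}"
      have "measure_pmf.prob gw {T. L \<Omega> T = n} \<le> measure_pmf.prob gw (S1 \<union> S2 \<union> S3 \<union> S4 \<union> S5)"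
        by (intro measure_pmf.finite_measure_mono) (auto simp: S1_def S2_def S3_def S4_def S5_def)
      also have "\<dots> \<le> measure_pmf.prob gw S1 + measure_pmf.prob gw S2 + measure_pmf.prob gw S3
          + measure_pmf.prob gw S4 + measure_pmf.prob gw S5"
        by (intro order_trans[OF measure_Un_le] add_right_mono) auto
      also have "\<dots> \<le> bound + measure_pmf.prob gw S5"
        unfolding bound_def using elim(2) mid high[of R] good by (simp add: S1_def S2_def S3_def S4_def)
      finally show ?thesis by (simp add: S5_def)
    qed
    moreover have "(\<lambda>R. bound + measure_pmf.prob gw {T. real (max_outdeg T) \<ge> 1 * real R}) \<longlonglongrightarrow> bound + 0"
      by (intro tendsto_intros prob_ge_tendsto_0) simp
    ultimately have "measure_pmf.prob gw {T. L \<Omega> T = n} \<le> bound + 0"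
      by (intro LIMSEQ_le_const) auto
    also have "bound + 0 = asymp_prob n * (\<eta> / 16 + C * mean_L * renewal_bound * (c1 n + c2 n) + (1 + \<eta> / 4) * (1 + \<eta> / 4))"
    proof -
      have e1: "C * pN / \<mu> = C * (asymp_prob n * mean_L)" using \<mu> by (simp add: pN)
      have e2: "((1 + \<eta> / 4) * pN) / \<mu> * ((1 + \<eta> / 4) / mean_L) = (1 + \<eta> / 4) * (1 + \<eta> / 4) * asymp_prob n"
        using \<mu> mean_L_pos by (simp add: pN)
      show ?thesis unfolding bound_def e1 e2 by (simp add: algebra_simps)
    qed
    also have "\<dots> \<le> asymp_prob n * (1 + \<eta>)"
    proof (intro mult_left_mono)
      have "\<eta> * \<eta> \<le> \<eta> * 1" using \<eta> by (intro mult_left_mono) auto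
      moreover have "(1 + \<eta> / 4) * (1 + \<eta> / 4) = 1 + \<eta> / 2 + \<eta> * \<eta> / 16" by (simp add: algebra_simps)
      ultimately show "\<eta> / 16 + C * mean_L * renewal_bound * (c1 n + c2 n) + (1 + \<eta> / 4) * (1 + \<eta> / 4) \<le> 1 + \<eta>"
        using elim(4) \<eta> by linarith
    qed (use elim in auto)
    finally show ?case by (simp add: mult.commute)
  qed
qed

text \<open>The limit law of an event is, up to concentration errors, a sum of passage probabilities over the window, hence up to
  smoothing errors \<open>mean_L\<close> times a sum of hitting probabilities, and these belong to good forests up to the errors
  \<open>b1\<close>, \<open>b2\<close> and \<open>b3\<close>. All errors are uniform in the event.\<close>

lemma prob_cond_map_lower:
  fixes t :: "nat \<Rightarrow> nat"
  assumes \<eta>: "0 < \<eta>" and t: "filterlim t at_top sequentially" "(\<lambda>n. real (t n) / real n) \<longlonglongrightarrow> 0"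
    and C: "C > measure_pmf.expectation gw (\<lambda>T. real (num_vertices T))"
  shows "\<forall>\<^sub>F n in sequentially. \<forall>S. asymp_prob n * (measure (law_limit \<xi> \<Omega> n (int (t n))) S - \<eta>)
     \<le> measure_pmf.prob gw {T. L \<Omega> T = n \<and> cond_map C (t n) T \<in> S}"
proof -
  define \<eta>' where "\<eta>' = \<eta> / 4"
  have \<eta>': "\<eta>' > 0" using \<eta> by (simp add: \<eta>'_def)
  obtain x1 x2 where x: "0 < x1" "x1 * mean_L < 1" "1 < x2 * mean_L" "0 < x2" and x12: "x1 \<le> x2"
    and win: "\<forall>\<^sub>F n in sequentially. \<forall>d\<in>{nat \<lfloor>x1 * real n\<rfloor>..nat \<lceil>x2 * real n\<rceil>}.
       pmf \<xi> d \<le> (1 + \<eta>') * pmf \<xi> (typical_deg n) \<and> pmf \<xi> (typical_deg n) \<le> (1 + \<eta>') * pmf \<xi> d"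
    using window[OF \<eta>'] by blast
  define D1 where "D1 n = nat \<lfloor>x1 * real n\<rfloor>" for n :: nat
  define D2 where "D2 n = nat \<lceil>x2 * real n\<rceil>" for n :: nat
  have D1_lim: "filterlim D1 at_top sequentially" unfolding D1_def using x by real_asymp
  have D12: "D1 n \<le> D2 n" for n
  proof -
    have "x1 * real n \<le> x2 * real n" using x12 by (intro mult_right_mono) auto
    then show ?thesis unfolding D1_def D2_def by linarith
  qed
  define c1 where "c1 n = measure_pmf.prob (forest (D1 n)) {z. n \<le> Suc (total_L \<Omega> z)}" for n
  define c2 where "c2 n = measure_pmf.prob (forest (Suc (D2 n))) {z. total_L \<Omega> z \<le> Suc n}" for n
  have c1: "c1 \<longlonglongrightarrow> 0" unfolding c1_def D1_def by (rule concentration_below[OF x(1,2)])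
  have c2: "c2 \<longlonglongrightarrow> 0" unfolding c2_def
  proof (rule concentration_above[OF x(3)])
    fix n show "x2 * real n \<le> real (Suc (D2 n))" unfolding D2_def by linarith
  qed
  \<comment> \<open>the three ways in which a forest may fail to come from a tree with the right data\<close>
  define b1 where "b1 n = measure_pmf.prob bullet {T. D1 n \<le> max_outdeg (fst T)}" for n
  define b2 where "b2 n = real (D2 n) * measure_pmf.prob gw {T. D1 n \<le> max_outdeg T}" for n
  define b3 where "b3 n = measure_pmf.prob (replicate_pmf (Suc (t n)) gw) {ts. C * real (t n) \<le> real (sum_list (map num_vertices ts))}" for n
  have b1: "b1 \<longlonglongrightarrow> 0"
  proof -
    from filterlim_compose[OF prob_ge_tendsto_0[of 1 bullet "\<lambda>T. max_outdeg (fst T)"] D1_lim]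
    show ?thesis unfolding b1_def by simp
  qed
  have b2: "b2 \<longlonglongrightarrow> 0"
  proof -
    have "(\<lambda>n. real (D2 n) / real (D1 n)) \<longlonglongrightarrow> x2 * inverse x1"
      unfolding D1_def D2_def using x by real_asymp
    from tendsto_mult[OF this filterlim_compose[OF tail_times_index_tendsto_0[OF integrable_\<xi>] D1_lim]]
    have lim: "(\<lambda>n. real (D2 n) / real (D1 n) * (real (D1 n) * measure_pmf.prob \<xi> {D1 n..}) / (1 - mean \<xi>)) \<longlonglongrightarrow> 0"
      by (simp add: tendsto_divide_zero)
    show ?thesis
    proof (rule tendsto_sandwich[OF _ _ tendsto_const lim])
      have "\<forall>\<^sub>F n in sequentially. D1 n \<ge> 1" using D1_lim unfolding filterlim_at_top by blast
      then show "\<forall>\<^sub>F n in sequentially. b2 n \<le> real (D2 n) / real (D1 n) * (real (D1 n) * measure_pmf.prob \<xi> {D1 n..}) / (1 - mean \<xi>)"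
      proof eventually_elim
        case (elim n)
        have "b2 n \<le> real (D2 n) * (measure_pmf.prob \<xi> {D1 n..} / (1 - mean \<xi>))"
          unfolding b2_def by (intro mult_left_mono prob_max_outdeg_ge) auto
        then show ?case using elim by simp
      qed
    qed (auto simp: b2_def intro!: always_eventually)
  qed
  have b3: "b3 \<longlonglongrightarrow> 0"
  proof -
    define m where "m = measure_pmf.expectation gw (\<lambda>T. real (num_vertices T))"
    have m0: "m \<ge> 0" unfolding m_def by (intro Bochner_Integration.integral_nonneg) auto
    define a where "a = (m + C) / 2"
    have "m < C" using C by (simp add: m_def)
    then have a: "m < a" "a < C" "a \<ge> 0" using m0 by (auto simp: a_def)
    have St: "filterlim (\<lambda>n. Suc (t n)) at_top sequentially" by (rule filterlim_compose[OF filterlim_Suc t(1)])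
    have i: "integrable (map_pmf num_vertices gw) real"
      using integrable_L[of UNIV] by (simp add: num_vertices_eq_L)
    have "measure_pmf.expectation (map_pmf num_vertices gw) real < a" using a by (simp add: m_def)
    from filterlim_compose[OF weak_law_upper[OF i this] St]
    have lim: "(\<lambda>n. measure_pmf.prob (replicate_pmf (Suc (t n)) gw) {ts. real (sum_list (map num_vertices ts)) \<ge> a * real (Suc (t n))}) \<longlonglongrightarrow> 0"
      unfolding prob_replicate_L[where Q = "\<lambda>s. real s \<ge> c" for c] .
    show ?thesis
    proof (rule tendsto_sandwich[OF _ _ tendsto_const lim])
      have "\<forall>\<^sub>F n in sequentially. t n \<ge> nat \<lceil>a / (C - a)\<rceil>" using t(1) unfolding filterlim_at_top by blast
      then show "\<forall>\<^sub>F n in sequentially. b3 n \<le> measure_pmf.prob (replicate_pmf (Suc (t n)) gw) {ts. real (sum_list (map num_vertices ts)) \<ge> a * real (Suc (t n))}"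
      proof eventually_elim
        case (elim n)
        have "a / (C - a) \<le> real (t n)" using elim by linarith
        then have "a * real (Suc (t n)) \<le> C * real (t n)" using a by (simp add: pos_divide_le_eq algebra_simps)
        then show ?case unfolding b3_def by (intro measure_pmf.finite_measure_mono) auto
      qed
    qed (auto simp: b3_def intro!: always_eventually)
  qed
  define e where "e = \<eta>' / renewal_bound"
  have e: "e > 0" "renewal_bound * e = \<eta>'" using \<eta>' renewal_bound_pos by (auto simp: e_def)
  have sm: "\<forall>\<^sub>F n in sequentially. l1_le (gf_L ^ t n * (fps_const mean_L * fps_X ^ offset - fps_X * gf_tail)) e"
    by (rule eventually_compose_filterlim[OF smoothing[OF e(1)] t(1)])
  have "(\<lambda>n. c1 n + c2 n + mean_L * renewal_bound * (b1 n + b2 n + b3 n)) \<longlonglongrightarrow> 0 + 0 + mean_L * renewal_bound * (0 + 0 + 0)"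
    by (intro tendsto_intros c1 c2 b1 b2 b3)
  then have err: "\<forall>\<^sub>F n in sequentially. c1 n + c2 n + mean_L * renewal_bound * (b1 n + b2 n + b3 n) < \<eta>'"
    using \<eta>' by (intro order_tendstoD(2)) auto
  have D1t: "\<forall>\<^sub>F n in sequentially. t n < D1 n"
  proof -
    have "\<forall>\<^sub>F n in sequentially. real (t n) / real n < x1 / 2"
      using order_tendstoD(2)[OF t(2), of "x1 / 2"] x by simp
    moreover have "\<forall>\<^sub>F n in sequentially. real (D1 n) > x1 / 2 * real n"
      unfolding D1_def using x by real_asymp
    ultimately show ?thesis using eventually_gt_at_top[of 0]
    proof eventually_elim
      case (elim n)
      have "real (t n) < x1 / 2 * real n" using elim by (simp add: pos_divide_less_eq)
      also have "\<dots> < real (D1 n)" using elim by simp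
      finally show ?case by simp
    qed
  qed
  have D1ev: "\<forall>\<^sub>F n in sequentially. D1 n \<ge> max deg0 1" using D1_lim unfolding filterlim_at_top by blast
  show ?thesis using win sm err D1t D1ev eventually_asymp_prob_pos
  proof eventually_elim
    case (elim n)
    define pN where "pN = pmf \<xi> (typical_deg n)"
    define \<mu> where "\<mu> = 1 - mean \<xi>"
    have \<mu>: "\<mu> > 0" using mean_less_1 by (simp add: \<mu>_def)
    have pN: "pN = asymp_prob n * \<mu> * mean_L" using \<mu> mean_L_pos by (simp add: asymp_prob_def pN_def \<mu>_def)
    let ?I = "{D1 n..D2 n}"
    have I: "D1 n \<le> d \<and> d \<le> D2 n \<and> t n < d \<and> deg0 \<le> d" if "d \<in> ?I" for d using that elim by auto
    show ?case
    proof
      fix S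
      define Q where "Q = measure (law_limit \<xi> \<Omega> n (int (t n))) S"
      define P where "P = (\<lambda>(T :: mtree, ts :: ptree list). (T, ts, 0 :: nat) \<in> S)"
      define H where "H = (\<Sum>d\<in>?I. hit_prob offset P d (t n) n)"
      define V where "V = (\<Sum>d\<in>?I. overshoot_prob P d (t n) n)"
      define G where "G = (\<Sum>d\<in>?I. measure_pmf.prob (forest d) (good_set d (t n) n C S))"
      have Q1: "Q \<le> V + c1 n + c2 n"
      proof -
        have "Q \<le> V + measure_pmf.prob (forest (D1 n)) {z. n < total_L \<Omega> z} + measure_pmf.prob (forest (Suc (D2 n))) {z. total_L \<Omega> z \<le> n}"
          unfolding Q_def V_def overshoot_prob_def P_def
          using measure_law_limit_le[of "D1 n" "D2 n" \<Omega> n "t n" S] elim D12[of n] by simp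
        moreover have "measure_pmf.prob (forest (D1 n)) {z. n < total_L \<Omega> z} \<le> c1 n"
          unfolding c1_def by (intro measure_pmf.finite_measure_mono) auto
        moreover have "measure_pmf.prob (forest (Suc (D2 n))) {z. total_L \<Omega> z \<le> n} \<le> c2 n"
          unfolding c2_def by (intro measure_pmf.finite_measure_mono) auto
        ultimately show ?thesis by linarith
      qed
      have HV: "\<bar>mean_L * H - V\<bar> \<le> \<eta>'"
        unfolding H_def V_def e(2)[symmetric]
      proof (rule hit_overshoot_compare[OF _ _ elim(2)])
        show "t n \<le> d" if "d \<in> ?I" for d using I[OF that] by simp
      qed simp
      have HG: "H \<le> G + renewal_bound * (b1 n + b2 n + b3 n)"
        unfolding H_def G_def b1_def b2_def b3_def P_def using I by (intro sum_hit_le_sum_good) auto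
      have "asymp_prob n / (1 + \<eta>') * (mean_L * G) \<le> (\<Sum>d\<in>?I. pmf \<xi> d / (1 - mean \<xi>) * measure_pmf.prob (forest d) (good_set d (t n) n C S))"
      proof -
        have "asymp_prob n / (1 + \<eta>') * (mean_L * G) = (\<Sum>d\<in>?I. pN / (1 + \<eta>') / \<mu> * measure_pmf.prob (forest d) (good_set d (t n) n C S))"
        proof -
          have "pN / (1 + \<eta>') / \<mu> = (pN / \<mu>) / (1 + \<eta>')" by simp
          also have "pN / \<mu> = asymp_prob n * mean_L" using \<mu> by (simp add: pN)
          finally have "pN / (1 + \<eta>') / \<mu> = asymp_prob n / (1 + \<eta>') * mean_L" by simp
          then show ?thesis unfolding G_def by (simp only: sum_distrib_left mult.assoc)
        qed
        also have "\<dots> \<le> (\<Sum>d\<in>?I. pmf \<xi> d / (1 - mean \<xi>) * measure_pmf.prob (forest d) (good_set d (t n) n C S))"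
          unfolding \<mu>_def
        proof (intro sum_mono mult_right_mono divide_right_mono)
          fix d assume "d \<in> ?I"
          then have "pN \<le> (1 + \<eta>') * pmf \<xi> d" using elim(1) by (simp add: pN_def D1_def D2_def)
          then show "pN / (1 + \<eta>') \<le> pmf \<xi> d" using \<eta>' by (simp add: pos_divide_le_eq mult.commute)
        qed (use mean_less_1 in auto)
        finally show ?thesis .
      qed
      also have "\<dots> \<le> measure_pmf.prob gw {T. L \<Omega> T = n \<and> cond_map C (t n) T \<in> S}"
        using I by (intro prob_cond_map_ge) auto
      finally have low: "asymp_prob n / (1 + \<eta>') * (mean_L * G) \<le> measure_pmf.prob gw {T. L \<Omega> T = n \<and> cond_map C (t n) T \<in> S}" .
      have G0: "mean_L * G \<ge> 0" unfolding G_def using mean_L_pos by (intro mult_nonneg_nonneg sum_nonneg) auto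
      have "mean_L * H \<le> mean_L * (G + renewal_bound * (b1 n + b2 n + b3 n))" using HG mean_L_pos by (intro mult_left_mono) auto
      then have eG: "mean_L * G \<ge> Q - 2 * \<eta>'" using Q1 HV elim(3) by (simp add: algebra_simps)
      have Q01: "Q \<le> 1"
      proof -
        interpret prob_space "law_limit \<xi> \<Omega> n (int (t n))" by (rule prob_space_law_limit)
        show ?thesis unfolding Q_def by (rule prob_le_1)
      qed
      have "Q - \<eta> \<le> mean_L * G / (1 + \<eta>')"
      proof (cases "Q - \<eta> \<le> 0")
        case True
        have "0 \<le> mean_L * G / (1 + \<eta>')" using G0 \<eta>' by simp
        with True show ?thesis by linarith
      next
        case False
        have "(Q - \<eta>) * \<eta>' \<le> 1 * \<eta>'" using Q01 \<eta> \<eta>' False by (intro mult_right_mono) auto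
        then have "(Q - \<eta>) * (1 + \<eta>') \<le> Q - \<eta> + \<eta>'" by (simp add: algebra_simps)
        also have "\<dots> \<le> mean_L * G" using eG \<eta>' by (simp add: \<eta>'_def)
        finally show ?thesis using \<eta>' by (simp add: pos_le_divide_eq)
      qed
      then have "asymp_prob n * (Q - \<eta>) \<le> asymp_prob n * (mean_L * G / (1 + \<eta>'))" using elim by (intro mult_left_mono) auto
      then show "asymp_prob n * (measure (law_limit \<xi> \<Omega> n (int (t n))) S - \<eta>)
         \<le> measure_pmf.prob gw {T. L \<Omega> T = n \<and> cond_map C (t n) T \<in> S}"
        using low by (simp add: Q_def)
    qed
  qed
qed

text \<open>The ratio of the lower bound for joint probabilities to the upper bound for \<open>P(L = n)\<close>.\<close>

lemma tv_dist_tendsto_0: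
  fixes t :: "nat \<Rightarrow> nat"
  assumes t: "filterlim t at_top sequentially" "(\<lambda>n. real (t n) / real n) \<longlonglongrightarrow> 0"
    and C: "C > measure_pmf.expectation gw (\<lambda>T. real (num_vertices T))"
  shows "(\<lambda>n. tv_dist (law_cond \<xi> \<Omega> C n (int (t n))) (law_limit \<xi> \<Omega> n (int (t n)))) \<longlonglongrightarrow> 0"
proof (rule LIMSEQ_I)
  fix \<epsilon> :: real assume \<epsilon>: "\<epsilon> > 0"
  define \<eta> where "\<eta> = min (1/2) (\<epsilon> / 3)"
  have "\<eta> \<le> \<epsilon> / 3" unfolding \<eta>_def by (rule min.cobounded2)
  then have \<eta>: "0 < \<eta>" "\<eta> \<le> 1/2" "2 * \<eta> < \<epsilon>" using \<epsilon> by (auto simp: \<eta>_def)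
  then have \<eta>1: "\<eta> \<le> 1" by simp
  have "\<forall>\<^sub>F n in sequentially. norm (tv_dist (law_cond \<xi> \<Omega> C n (int (t n))) (law_limit \<xi> \<Omega> n (int (t n))) - 0) < \<epsilon>"
    using prob_L_eq_upper[OF \<eta>(1) \<eta>1] prob_cond_map_lower[OF \<eta>(1) t C] eventually_asymp_prob_pos
  proof eventually_elim
    case (elim n)
    let ?q = "measure_pmf.prob gw {T. L \<Omega> T = n}"
    let ?Q = "\<lambda>S. measure (law_limit \<xi> \<Omega> n (int (t n))) S"
    interpret Q: prob_space "law_limit \<xi> \<Omega> n (int (t n))" by (rule prob_space_law_limit)
    have up: "?q \<le> (1 + \<eta>) * asymp_prob n" using elim(1) \<eta> by simp
    have low: "asymp_prob n * (?Q S - \<eta>) \<le> measure_pmf.prob gw {T. L \<Omega> T = n \<and> cond_map C (t n) T \<in> S}" for S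
      using elim(2) by blast
    have sQ: "sets (law_limit \<xi> \<Omega> n (int (t n))) = UNIV" by (simp add: law_limit_eq)
    have "space (law_limit \<xi> \<Omega> n (int (t n))) = UNIV" by (simp add: law_limit_eq)
    then have "?Q UNIV = 1" using Q.prob_space by simp
    with low[of UNIV] have "asymp_prob n * (1 - \<eta>) \<le> ?q" by simp
    moreover have "0 < asymp_prob n * (1 - \<eta>)" using elim(3) \<eta> by simp
    ultimately have q: "?q > 0" by linarith
    note lc = law_cond_eq[OF q, of C "t n"]
    have "?Q S \<le> measure (law_cond \<xi> \<Omega> C n (int (t n))) S + 2 * \<eta>" for S
    proof (cases "?Q S \<le> \<eta>")
      case True
      then show ?thesis using \<eta> by (simp add: add_increasing)
    next
      case False
      have Q1: "?Q S \<le> 1" by (rule Q.prob_le_1)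
      have "(?Q S - 2 * \<eta>) * ?q \<le> (?Q S - \<eta>) * asymp_prob n"
      proof (cases "?Q S - 2 * \<eta> \<le> 0")
        case True
        then have "(?Q S - 2 * \<eta>) * ?q \<le> 0" using q by (simp add: mult_nonpos_nonneg)
        also have "0 \<le> (?Q S - \<eta>) * asymp_prob n" using False elim(3) by simp
        finally show ?thesis .
      next
        case False
        then have "(?Q S - 2 * \<eta>) * ?q \<le> (?Q S - 2 * \<eta>) * ((1 + \<eta>) * asymp_prob n)"
          using up by (intro mult_left_mono) auto
        also have "\<dots> = ((?Q S - 2 * \<eta>) * (1 + \<eta>)) * asymp_prob n" by simp
        also have "\<dots> \<le> (?Q S - \<eta>) * asymp_prob n"
        proof (rule mult_right_mono)
          have "?Q S - 2 * \<eta> \<le> 1" using Q1 \<eta>(1) by linarith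
          then have "(?Q S - 2 * \<eta>) * \<eta> \<le> 1 * \<eta>" using \<eta>(1) by (intro mult_right_mono) auto
          then show "(?Q S - 2 * \<eta>) * (1 + \<eta>) \<le> ?Q S - \<eta>" by (simp add: algebra_simps)
        qed (use elim(3) in simp)
        finally show ?thesis .
      qed
      also have "\<dots> \<le> measure_pmf.prob gw {T. L \<Omega> T = n \<and> cond_map C (t n) T \<in> S}"
        using low[of S] by (simp add: mult.commute)
      finally have "?Q S - 2 * \<eta> \<le> measure (law_cond \<xi> \<Omega> C n (int (t n))) S"
        unfolding lc(3) using q by (simp add: pos_le_divide_eq)
      then show ?thesis by simp
    qed
    from tv_dist_le[OF lc(2,1) prob_space_law_limit sQ this]
    show ?case using \<eta> by simp
  qed
  then show "\<exists>no. \<forall>n\<ge>no. norm (tv_dist (law_cond \<xi> \<Omega> C n (int (t n))) (law_limit \<xi> \<Omega> n (int (t n))) - 0) < \<epsilon>"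
    by (simp add: eventually_at_top_linorder)
qed

end

theorem theorem1p2:
  fixes \<xi> :: "nat pmf" and \<Omega> :: "nat set" and f :: "real \<Rightarrow> real" and \<alpha> :: real
  assumes "measure_pmf.prob \<xi> {0} > 0"
    and "measure_pmf.prob \<xi> {..1} < 1"
    and "integrable (measure_pmf \<xi>) real" and "measure_pmf.expectation \<xi> real < 1"
    and "slowly_varying f" and "\<alpha> > 1"
    and "\<forall>\<^sub>F n in sequentially. measure_pmf.prob \<xi> {n} = f (real n) * real n powr (- 1 - \<alpha>)"
    and "\<Omega> \<noteq> {}" and "measure_pmf.prob \<xi> \<Omega> > 0" and "finite \<Omega> \<or> finite (- \<Omega>)"
  shows "\<exists>C>0. \<forall>t :: nat \<Rightarrow> int.
     filterlim t at_top sequentially \<longrightarrow>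
     (\<lambda>n. real_of_int (t n)) \<in> o(\<lambda>n. real n) \<longrightarrow>
     (\<lambda>n. tv_dist (law_cond \<xi> \<Omega> C n (t n)) (law_limit \<xi> \<Omega> n (t n))) \<longlonglongrightarrow> 0"
proof -
  interpret condensation_tree \<xi> f \<alpha> \<Omega>
    by unfold_locales (use assms in \<open>simp_all add: measure_pmf_single\<close>)
  define C where "C = measure_pmf.expectation gw (\<lambda>T. real (num_vertices T)) + 1"
  have "measure_pmf.expectation gw (\<lambda>T. real (num_vertices T)) \<ge> 0"
    by (intro Bochner_Integration.integral_nonneg) auto
  then have C: "C > 0" "C > measure_pmf.expectation gw (\<lambda>T. real (num_vertices T))"
    unfolding C_def by linarith+
  show ?thesis
  proof (intro exI[of _ C] conjI C(1) allI impI)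
    fix t :: "nat \<Rightarrow> int"
    assume t: "filterlim t at_top sequentially" and o: "(\<lambda>n. real_of_int (t n)) \<in> o(\<lambda>n. real n)"
    define s where "s n = nat (t n)" for n
    have nonneg: "\<forall>\<^sub>F n in sequentially. t n \<ge> 0" using t unfolding filterlim_at_top by blast
    then have ts: "\<forall>\<^sub>F n in sequentially. int (s n) = t n" by eventually_elim (simp add: s_def)
    have "filterlim s at_top sequentially" unfolding s_def by (rule filterlim_compose[OF filterlim_nat_sequentially t])
    moreover have "(\<lambda>n. real (s n) / real n) \<longlonglongrightarrow> 0"
    proof -
      have "(\<lambda>n. real_of_int (t n) / real n) \<longlonglongrightarrow> 0" by (rule smalloD_tendsto[OF o])
      moreover have "\<forall>\<^sub>F n in sequentially. real_of_int (t n) / real n = real (s n) / real n"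
        using ts by eventually_elim (metis of_int_of_nat_eq)
      ultimately show ?thesis by (simp add: tendsto_cong)
    qed
    ultimately have "(\<lambda>n. tv_dist (law_cond \<xi> \<Omega> C n (int (s n))) (law_limit \<xi> \<Omega> n (int (s n)))) \<longlonglongrightarrow> 0"
      by (rule tv_dist_tendsto_0[OF _ _ C(2)])
    moreover have "\<forall>\<^sub>F n in sequentially. tv_dist (law_cond \<xi> \<Omega> C n (int (s n))) (law_limit \<xi> \<Omega> n (int (s n)))
        = tv_dist (law_cond \<xi> \<Omega> C n (t n)) (law_limit \<xi> \<Omega> n (t n))"
      using ts by eventually_elim simp
    ultimately show "(\<lambda>n. tv_dist (law_cond \<xi> \<Omega> C n (t n)) (law_limit \<xi> \<Omega> n (t n))) \<longlonglongrightarrow> 0"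
      by (rule Lim_transform_eventually)
  qed
qed


end
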